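(* Let $n\le 3$ and $m\ge1$ be positive integers. For each integer $k$ with $1\le k<\min(m,n)$, the subspace $$\mathcal F_{n,k}=\mathrm{Span}_{\mathbb F_q}\{\delta_{s+1;m}^{n-s}(f)\;:\; f\in\Delta^m_s,\ 0\le s\le k\}\subseteq\mathcal Q_m(n)^{G_n}$$ is an $\mathcal A$-submodule as well as a $\mathcal D_n$-submodule of $\mathcal Q_m(n)^{G_n}$. Moreover, $\mathcal F_{n,k}$ is annihilated by the Dickson invariants $Q_{n,0},Q_{n,1},\ldots,Q_{n,n-k-1}$.
   Context: Let $\mathbb F_q$ be the field with $q$ elements, $q$ a power of a prime $p$. $S(n)=\mathbb F_q[x_1,\ldots,x_n]$ with $\deg x_i=1$, $I_m(n)=(x_1^{q^m},\ldots,x_n^{q^m})$, $\mathcal Q_m(n)=S(n)/I_m(n)$. $G_n=GL_n(\mathbb F_q)$ acts on $S(n)$ by linear substitutions of the variables, hence on $\mathcal Q_m(n)$. Polynomials are identified with their classes when regarded in $\mathcal Q_m(n)$; the elements $\delta_{s+1;m}^{n-s}(f)$ in question are polynomials whose classes are $G_n$-invariant. Dickson invariants: for $s\ge1$, $Q_{s,i}=Q_{s,i}(x_1,\ldots,x_s)$, $0\le i\le s-1$, are defined by $$\prod_{\lambda\in\mathbb F_q^{s}}(X+\lambda_1x_1+\cdots+\lambda_sx_s)=X^{q^s}+\sum_{i=0}^{s-1}(-1)^{s-i}Q_{s,i}X^{q^i},$$ and $\mathcal D_s=\mathbb F_q[Q_{s,0},\ldots,Q_{s,s-1}]=\mathbb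 F_q[x_1,\ldots,x_s]^{G_s}$, $\mathcal D_0=\mathbb F_q$. $\mathcal Q_m(n)^{G_n}$ is a $\mathcal D_n$-module via the projection $S(n)\to\mathcal Q_m(n)$. The sets $\Delta^m_s$: for $1\le s\le m$, $\Delta^m_s$ is the set of monomials $Q_{s,s-1}^{e_1}Q_{s,s-2}^{e_2}\cdots Q_{s,0}^{e_s}$ for which there is a partition $m-s\ge\lambda_1\ge\cdots\ge\lambda_s\ge0$ (with $\lambda_{s+1}=0$) such that $\frac{q^{\lambda_i}-q^{\lambda_{i+1}}}{q-1}\le e_i<\frac{q^{\lambda_i+1}-q^{\lambda_{i+1}}}{q-1}$ for all $i$. Also $\Delta^m_0=\{1\}$ and $\Delta^m_s=\emptyset$ if $s>m$. Delta operator: for integers $b\ge1$, $c\ge 0$, $1\le a\le c+1$ and a rational function $f$ in $c$ variables (a constant if $c=0$), $\delta_{a;b}(f)$ is the function of $c+1$ variables $x_1,\dots,x_{c+1}$ equal to the quotient of two $a\times a$ determinants. The numerator matrix has $(i,j)$ entry $x_j^{q^{i-1}}$ for $1\le i\le a-1$ and $(a,j)$ entry $x_j^{q^b}f(x_1,\ldots,\widehat{x_j},\ldots,x_{c+1})$; the denominator is $\det(x_j^{q^{i-1}})_{1\le i,j\le a}$. Powers denote iteration, each application increasing the number of variables by one. Elements of $\mathcal D_s$ are viewed as polynomials in $x_1,\ldots,x_s$. Steenrod algebra: $\mathcal A$ is the mod $q$ Steenrod algebra, generated by reduced powers $\mathcal P^i$, $i\ge0$. They act $\mathbb F_q$-linearly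 on $S(n)$, $\mathcal P^i$ raising degree by $i(q-1)$, with $\mathcal P^0=\mathrm{id}$, $\mathcal P^i(fg)=\sum_{a+b=i}\mathcal P^a(f)\mathcal P^b(g)$, $\mathcal P^1(x_j)=x_j^q$ and $\mathcal P^i(x_j)=0$ for $i>1$. This action commutes with $G_n$ and preserves $I_m(n)$, so $\mathcal A$ acts on $\mathcal Q_m(n)^{G_n}$; an $\mathcal A$-submodule is a subspace stable under all $\mathcal P^i$. *)

theory Defs
  imports
    "HOL-Library.Poly_Mapping"
    "HOL-Library.Cardinality"
    "HOL-Computational_Algebra.Polynomial_Factorial"
    "HOL-Algebra.QuotRing"
    "HOL-Algebra.Generated_Rings"
    "Jordan_Normal_Form.VS_Connect"
begin

section \<open>Polynomials and substitution\<close>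

text \<open>Polynomials in the variables \<open>x\<^sub>0, x\<^sub>1, x\<^sub>2, \<dots>\<close>; a monomial is its finitely supported
  exponent function. Only \<open>x\<^sub>1, x\<^sub>2, \<dots>\<close> are ever used. The field \<open>\<bbbF>\<^sub>q\<close> is a type \<open>'a\<close> of sort
  \<open>{field, finite}\<close>, and \<open>q\<close> is \<open>CARD('a)\<close>.\<close>

type_synonym 'a mpol = "(nat \<Rightarrow>\<^sub>0 nat) \<Rightarrow>\<^sub>0 'a"

definition Const :: "'a::comm_ring_1 \<Rightarrow> 'a mpol" where
  "Const c = Poly_Mapping.single 0 c"

definition Var :: "nat \<Rightarrow> 'a::comm_ring_1 mpol" where
  "Var i = Poly_Mapping.single (Poly_Mapping.single i 1) 1"

definition monom_eval :: "(nat \<Rightarrow> 'b::comm_ring_1) \<Rightarrow> (nat \<Rightarrow>\<^sub>0 nat) \<Rightarrow> 'b" where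
  "monom_eval \<sigma> t = (\<Prod>i\<in>Poly_Mapping.keys t. \<sigma> i ^ Poly_Mapping.lookup t i)"

text \<open>The ring homomorphism that acts as \<open>h\<close> on coefficients and sends \<open>x\<^sub>i\<close> to \<open>\<sigma> i\<close>.\<close>

definition msubst :: "('a::comm_ring_1 \<Rightarrow> 'b::comm_ring_1) \<Rightarrow> (nat \<Rightarrow> 'b) \<Rightarrow> 'a mpol \<Rightarrow> 'b" where
  "msubst h \<sigma> p = (\<Sum>t\<in>Poly_Mapping.keys p. h (Poly_Mapping.lookup p t) * monom_eval \<sigma> t)"

lemma poly_mapping_single_induct [case_names single sum]:
  fixes p :: "'c \<Rightarrow>\<^sub>0 'd::monoid_add"
  assumes single: "\<And>t c. P (Poly_Mapping.single t c)"
    and sum: "\<And>f g. P f \<Longrightarrow> P g \<Longrightarrow> P (f + g)"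
  shows "P p"
proof (induction p rule: update_induct)
  case const
  show ?case using single[of undefined 0] by simp
next
  case (update f a b)
  have "Poly_Mapping.update a b f = Poly_Mapping.single a b + f"
    using update(1)
    by (intro poly_mapping_eqI) (auto simp: lookup_update lookup_add lookup_single when_def in_keys_iff)
  then show ?case
    using update(3) single sum by simp
qed

lemma monom_eval_superset:
  assumes "finite A" "Poly_Mapping.keys t \<subseteq> A"
  shows "monom_eval \<sigma> t = (\<Prod>i\<in>A. \<sigma> i ^ Poly_Mapping.lookup t i)"
  unfolding monom_eval_def
  by (rule prod.mono_neutral_left) (use assms in \<open>auto simp: in_keys_iff\<close>)

lemma monom_eval_0 [simp]: "monom_eval \<sigma> 0 = 1"
  by (simp add: monom_eval_def)

lemma monom_eval_single [simp]: "monom_eval \<sigma> (Poly_Mapping.single i k) = \<sigma> i ^ k"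
  by (subst monom_eval_superset[of "{i}"]) auto

lemma monom_eval_add: "monom_eval \<sigma> (s + t) = monom_eval \<sigma> s * monom_eval \<sigma> t"
proof -
  let ?A = "Poly_Mapping.keys s \<union> Poly_Mapping.keys t"
  have "Poly_Mapping.keys (s + t) \<subseteq> ?A" by (rule Poly_Mapping.keys_add)
  then show ?thesis
    by (simp add: monom_eval_superset[of ?A] lookup_add power_add prod.distrib)
qed

context
  fixes h :: "'a::comm_ring_1 \<Rightarrow> 'b::comm_ring_1"
  assumes h: "comm_ring_hom h"
begin

interpretation h: comm_ring_hom h by (rule h)

lemma msubst_superset:
  assumes "finite A" "Poly_Mapping.keys p \<subseteq> A"
  shows "msubst h \<sigma> p = (\<Sum>t\<in>A. h (Poly_Mapping.lookup p t) * monom_eval \<sigma> t)"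
  unfolding msubst_def
  by (rule sum.mono_neutral_left) (use assms in \<open>auto simp: in_keys_iff\<close>)

lemma msubst_0 [simp]: "msubst h \<sigma> 0 = 0"
  by (simp add: msubst_def)

lemma msubst_add: "msubst h \<sigma> (p + r) = msubst h \<sigma> p + msubst h \<sigma> r"
proof -
  let ?A = "Poly_Mapping.keys p \<union> Poly_Mapping.keys r"
  have "Poly_Mapping.keys (p + r) \<subseteq> ?A" by (rule Poly_Mapping.keys_add)
  then show ?thesis
    by (simp add: msubst_superset[of ?A] lookup_add h.hom_add distrib_right sum.distrib)
qed

lemma msubst_single: "msubst h \<sigma> (Poly_Mapping.single t c) = h c * monom_eval \<sigma> t"
  by (subst msubst_superset[of "{t}"]) auto

lemma msubst_Const: "msubst h \<sigma> (Const c) = h c"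
  by (simp add: Const_def msubst_single)

lemma msubst_Var: "msubst h \<sigma> (Var i) = \<sigma> i"
  by (simp add: Var_def msubst_single)

lemma msubst_1: "msubst h \<sigma> 1 = 1"
  using msubst_single[of \<sigma> 0 1] by simp

lemma msubst_mult: "msubst h \<sigma> (p * r) = msubst h \<sigma> p * msubst h \<sigma> r"
proof (induction p rule: poly_mapping_single_induct)
  case p: (single s c)
  show ?case
  proof (induction r rule: poly_mapping_single_induct)
    case (single t d)
    show ?case
      by (simp add: mult_single msubst_single monom_eval_add h.hom_mult ac_simps)
  next
    case (sum f g)
    then show ?case
      by (simp add: distrib_left msubst_add)
  qed
next
  case (sum f g)
  then show ?case
    by (simp add: distrib_right msubst_add)
qed

lemma msubst_power: "msubst h \<sigma> (p ^ k) = msubst h \<sigma> p ^ k"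
  by (induction k) (simp_all add: msubst_1 msubst_mult)

end

lemma comm_ring_hom_Const: "comm_ring_hom Const"
  by unfold_locales
    (simp_all add: Const_def single_add mult_single)

section \<open>Omitting a variable in a rational function\<close>

text \<open>\<open>f(x\<^sub>1, \<dots>, x\<^sub>c) \<mapsto> f(x\<^sub>1, \<dots>, x\<^sub>j\<^sub>-\<^sub>1, x\<^sub>j\<^sub>+\<^sub>1, \<dots>, x\<^sub>c\<^sub>+\<^sub>1)\<close>, first for polynomials.\<close>

definition skip_var :: "nat \<Rightarrow> 'a::comm_ring_1 mpol \<Rightarrow> 'a mpol" where
  "skip_var j = msubst Const (\<lambda>i. Var (if i < j then i else Suc i))"

lemma msubst_skip_var:
  "msubst Const (\<lambda>i. Var (if i < j then i else i - 1)) (skip_var j p) = p"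
proof (induction p rule: poly_mapping_single_induct)
  case (single t c)
  note C = comm_ring_hom_Const
  let ?r = "\<lambda>i. if i < j then i else Suc i" and ?l = "\<lambda>i. if i < j then i else i - 1"
  have mon: "msubst Const (\<lambda>i. Var (?l i)) (monom_eval (\<lambda>i. Var (?r i)) t)
      = (Poly_Mapping.single t 1 :: 'a mpol)" for t :: "nat \<Rightarrow>\<^sub>0 nat"
  proof (induction t rule: poly_mapping_single_induct)
    case (single i k)
    have "(Var i :: 'a mpol) ^ k = Poly_Mapping.single (Poly_Mapping.single i k) 1"
    proof (induction k)
      case (Suc k)
      have "Poly_Mapping.single i (Suc k) = Poly_Mapping.single i 1 + Poly_Mapping.single i k"
        by (simp flip: single_add)
      then show ?case
        using Suc by (simp add: Var_def mult_single)
    qed simp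
    then show ?case
      by (auto simp: msubst_power[OF C] msubst_Var[OF C])
  next
    case (sum f g)
    then show ?case
      by (simp add: monom_eval_add msubst_mult[OF C] mult_single)
  qed
  show ?case
    unfolding skip_var_def
    by (simp add: msubst_single[OF C] msubst_mult[OF C] msubst_Const[OF C] mon)
       (simp add: Const_def mult_single)
next
  case (sum f g)
  then show ?case
    by (simp add: skip_var_def msubst_add[OF comm_ring_hom_Const])
qed

lemma skip_var_mult: "skip_var j (p * r) = skip_var j p * skip_var j r"
  by (simp add: skip_var_def msubst_mult[OF comm_ring_hom_Const])

lemma skip_var_eq_0_iff [simp]: "skip_var j p = 0 \<longleftrightarrow> p = 0"
  by (metis msubst_skip_var msubst_0[OF comm_ring_hom_Const] skip_var_def)

definition skip_var_fract :: "nat \<Rightarrow> 'a::idom mpol fract \<Rightarrow> 'a mpol fract" where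
  "skip_var_fract j r =
     (THE u. \<exists>a b. b \<noteq> 0 \<and> r = Fract a b \<and> u = Fract (skip_var j a) (skip_var j b))"

lemma skip_var_fract_Fract:
  assumes "b \<noteq> 0"
  shows "skip_var_fract j (Fract a b) = Fract (skip_var j a) (skip_var j b)"
  unfolding skip_var_fract_def
proof (rule the_equality)
  show "\<exists>a' b'. b' \<noteq> 0 \<and> Fract a b = Fract a' b' \<and>
      Fract (skip_var j a) (skip_var j b) = Fract (skip_var j a') (skip_var j b')"
    using assms by blast
next
  fix u
  assume "\<exists>a' b'. b' \<noteq> 0 \<and> Fract a b = Fract a' b' \<and> u = Fract (skip_var j a') (skip_var j b')"
  then obtain a' b' where *: "b' \<noteq> 0" "Fract a b = Fract a' b'"
      "u = Fract (skip_var j a') (skip_var j b')"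
    by blast
  have "a * b' = a' * b"
    using * assms by (simp add: eq_fract)
  then have "skip_var j a * skip_var j b' = skip_var j a' * skip_var j b"
    by (metis skip_var_mult)
  then show "u = Fract (skip_var j a) (skip_var j b)"
    using * assms by (simp add: eq_fract)
qed

section \<open>The delta operator\<close>

text \<open>Matrix indices start at 0, so row \<open>i\<close> carries the exponent \<open>q\<^sup>i\<close> and column \<open>j\<close> the variable
  \<open>x\<^sub>j\<^sub>+\<^sub>1\<close>. The number \<open>c\<close> of variables of \<open>f\<close> does not enter the formula.\<close>

definition delta :: "nat \<Rightarrow> nat \<Rightarrow> 'a::{field,finite} mpol fract \<Rightarrow> 'a mpol fract" where
  "delta a b f =
     det (mat a a (\<lambda>(i, j). if i < a - 1 then to_fract (Var (Suc j)) ^ (CARD('a) ^ i)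
                           else to_fract (Var (Suc j)) ^ (CARD('a) ^ b) * skip_var_fract (Suc j) f))
   / det (mat a a (\<lambda>(i, j). to_fract (Var (Suc j)) ^ (CARD('a) ^ i)))"

section \<open>Dickson invariants and the sets of monomials\<close>

text \<open>\<open>(-1)\<^sup>s\<^sup>-\<^sup>i Q\<^sub>s\<^sub>,\<^sub>i\<close> is the coefficient of \<open>X\<close> to the power \<open>q\<^sup>i\<close> in
  \<open>\<Prod>\<^sub>l (X + l\<^sub>1 x\<^sub>1 + \<dots> + l\<^sub>s x\<^sub>s)\<close>, \<open>l\<close> ranging over \<open>\<bbbF>\<^sub>q\<^sup>s\<close>.\<close>

definition dickson :: "nat \<Rightarrow> nat \<Rightarrow> 'a::{field,finite} mpol" where
  "dickson s i = (- 1) ^ (s - i) *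
     poly.coeff (\<Prod>l \<in> {1..s} \<rightarrow>\<^sub>E (UNIV :: 'a set). [:\<Sum>j = 1..s. Const (l j) * Var j, 1:])
       (CARD('a) ^ i)"

text \<open>The divisions by \<open>q - 1\<close> are exact, and the subtractions do not truncate because
  \<open>\<lambda>\<^sub>i \<ge> \<lambda>\<^sub>i\<^sub>+\<^sub>1\<close>.\<close>

definition Delta :: "nat \<Rightarrow> nat \<Rightarrow> 'a::{field,finite} mpol set" where
  "Delta m s =
     (if s = 0 then {1} else if s > m then {} else
       {(\<Prod>i = 1..s. dickson s (s - i) ^ e i) | e.
          \<exists>l :: nat \<Rightarrow> nat. l 1 \<le> m - s \<and> (\<forall>i\<in>{1..s}. l (Suc i) \<le> l i) \<and> l (Suc s) = 0 \<and>
            (\<forall>i\<in>{1..s}.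
               (CARD('a) ^ l i - CARD('a) ^ l (Suc i)) div (CARD('a) - 1) \<le> e i \<and>
               e i < (CARD('a) ^ (l i + 1) - CARD('a) ^ l (Suc i)) div (CARD('a) - 1))})"

section \<open>The truncated polynomial ring\<close>

definition Sring :: "nat \<Rightarrow> 'a::{field,finite} mpol ring" where
  "Sring n = \<lparr>carrier = {p. \<forall>t\<in>Poly_Mapping.keys p. Poly_Mapping.keys t \<subseteq> {1..n}},
              mult = (*), one = 1, zero = 0, add = (+)\<rparr>"

definition Iideal :: "nat \<Rightarrow> nat \<Rightarrow> 'a::{field,finite} mpol set" where
  "Iideal m n = Idl\<^bsub>Sring n\<^esub> ((\<lambda>i. Var i ^ (CARD('a) ^ m)) ` {1..n})"

definition Qring :: "nat \<Rightarrow> nat \<Rightarrow> 'a::{field,finite} mpol set ring" where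
  "Qring m n = Sring n Quot Iideal m n"

definition cls :: "nat \<Rightarrow> nat \<Rightarrow> 'a::{field,finite} mpol \<Rightarrow> 'a mpol set" where
  "cls m n f = Iideal m n +>\<^bsub>Sring n\<^esub> f"

text \<open>The map on \<open>S(n) / I\<^sub>m(n)\<close> induced by a map \<open>\<phi>\<close> on \<open>S(n)\<close>. For an additive \<open>\<phi>\<close> that preserves
  \<open>I\<^sub>m(n)\<close> all cosets in the union coincide.\<close>

definition induced ::
    "nat \<Rightarrow> nat \<Rightarrow> ('a mpol \<Rightarrow> 'a mpol) \<Rightarrow> 'a::{field,finite} mpol set \<Rightarrow> 'a mpol set" where
  "induced m n \<phi> C = (\<Union>f\<in>C. cls m n (\<phi> f))"

definition GL :: "nat \<Rightarrow> 'a::field mat set" where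
  "GL n = {g \<in> carrier_mat n n. invertible_mat g}"

definition lin_subst :: "nat \<Rightarrow> 'a::field mat \<Rightarrow> 'a mpol \<Rightarrow> 'a mpol" where
  "lin_subst n g = msubst Const (\<lambda>j. \<Sum>i = 1..n. Const (g $$ (i - 1, j - 1)) * Var i)"

definition Qinv :: "nat \<Rightarrow> nat \<Rightarrow> 'a::{field,finite} mpol set set" where
  "Qinv m n = {C \<in> carrier (Qring m n). \<forall>g\<in>GL n. induced m n (lin_subst n g) C = C}"

text \<open>\<open>Q\<^sub>m(n)\<close> and its invariants as modules over any ring of scalars that \<open>\<iota>\<close> maps into \<open>S(n)\<close>:
  \<open>\<bbbF>\<^sub>q\<close> with \<open>\<iota> = Const\<close>, or a subring of \<open>S(n)\<close> with \<open>\<iota> = id\<close>.\<close>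

definition Qmod :: "nat \<Rightarrow> nat \<Rightarrow> ('r \<Rightarrow> 'a::{field,finite} mpol) \<Rightarrow> ('r, 'a mpol set) module" where
  "Qmod m n \<iota> = ring.extend (Qring m n) \<lparr>smult = \<lambda>r C. cls m n (\<iota> r) \<otimes>\<^bsub>Qring m n\<^esub> C\<rparr>"

definition Qinv_mod ::
    "nat \<Rightarrow> nat \<Rightarrow> ('r \<Rightarrow> 'a::{field,finite} mpol) \<Rightarrow> ('r, 'a mpol set) module" where
  "Qinv_mod m n \<iota> = (Qmod m n \<iota>)\<lparr>carrier := Qinv m n\<rparr>"

definition Dring :: "nat \<Rightarrow> 'a::{field,finite} mpol ring" where
  "Dring n = (Sring n)\<lparr>carrier :=
     generate_ring (Sring n) (range Const \<union> dickson n ` {i. i < n})\<rparr>"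

section \<open>Steenrod operations\<close>

text \<open>The total operation \<open>\<Sum>\<^sub>i \<P>\<^sup>i(f) \<xi>\<^sup>i\<close> is the \<open>\<bbbF>\<^sub>q\<close>-algebra homomorphism
  \<open>x\<^sub>j \<mapsto> x\<^sub>j + x\<^sub>j\<^sup>q \<xi>\<close>. The lemmas below are the defining properties of the \<open>\<P>\<^sup>i\<close>, which determine
  them uniquely.\<close>

definition steenrod :: "nat \<Rightarrow> 'a::{field,finite} mpol \<Rightarrow> 'a mpol" where
  "steenrod i f =
     poly.coeff (msubst (\<lambda>c. [:Const c:]) (\<lambda>j. [:Var j, Var j ^ CARD('a):]) f) i"

lemma comm_ring_hom_pCons_Const: "comm_ring_hom (\<lambda>c. [:Const c:])"
proof -
  interpret comm_ring_hom Const by (rule comm_ring_hom_Const)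
  show ?thesis
    by unfold_locales (simp_all add: hom_add hom_mult)
qed

lemma steenrod_add: "steenrod i (f + g) = steenrod i f + steenrod i g"
  by (simp add: steenrod_def msubst_add[OF comm_ring_hom_pCons_Const])

lemma steenrod_Const: "steenrod i (Const c) = (if i = 0 then Const c else 0)"
  by (simp add: steenrod_def msubst_Const[OF comm_ring_hom_pCons_Const] coeff_pCons split: nat.splits)

lemma steenrod_Cartan: "steenrod i (f * g) = (\<Sum>a\<le>i. steenrod a f * steenrod (i - a) g)"
  by (simp add: steenrod_def msubst_mult[OF comm_ring_hom_pCons_Const] coeff_mult)

lemma steenrod_scale: "steenrod i (Const c * f) = Const c * steenrod i f"
proof -
  have "steenrod i (Const c * f) = (\<Sum>a\<le>i. if a = 0 then Const c * steenrod i f else 0)"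
    unfolding steenrod_Cartan by (rule sum.cong) (auto simp: steenrod_Const)
  then show ?thesis by simp
qed

lemma steenrod_Var:
  "steenrod i (Var j :: 'a::{field,finite} mpol) =
     (if i = 0 then Var j else if i = 1 then Var j ^ CARD('a) else 0)"
  by (simp add: steenrod_def msubst_Var[OF comm_ring_hom_pCons_Const] coeff_pCons split: nat.splits)

lemma steenrod_0: "steenrod 0 f = f"
proof (induction f rule: poly_mapping_single_induct)
  case (single t c)
  have mult: "steenrod 0 (f * g) = steenrod 0 f * steenrod 0 g" for f g :: "'a mpol"
    by (simp add: steenrod_Cartan)
  have mon: "steenrod 0 (Poly_Mapping.single t 1 :: 'a mpol) = Poly_Mapping.single t 1" for t
  proof (induction t rule: poly_mapping_single_induct)
    case (single i k)
    show ?case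
    proof (induction k)
      case 0
      show ?case using steenrod_Const[of 0 "1::'a"] by (simp add: Const_def)
    next
      case (Suc k)
      have "(Poly_Mapping.single (Poly_Mapping.single i (Suc k)) 1 :: 'a mpol)
          = Var i * Poly_Mapping.single (Poly_Mapping.single i k) 1"
        by (simp add: Var_def mult_single flip: single_add)
      then show ?case
        by (simp only: mult Suc) (simp add: steenrod_Var)
    qed
  next
    case (sum f g)
    have "(Poly_Mapping.single (f + g) 1 :: 'a mpol)
        = Poly_Mapping.single f 1 * Poly_Mapping.single g 1"
      by (simp add: mult_single)
    then show ?case
      using sum by (simp only: mult)
  qed
  have "(Poly_Mapping.single t c :: 'a mpol) = Const c * Poly_Mapping.single t 1"
    by (simp add: Const_def mult_single)
  then show ?case
    by (simp only: steenrod_scale mon)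
qed (simp add: steenrod_add)

section \<open>Submodules of the invariants\<close>

definition A_submodule :: "nat \<Rightarrow> nat \<Rightarrow> 'a::{field,finite} mpol set set \<Rightarrow> bool" where
  "A_submodule m n H \<longleftrightarrow>
     submodule (class_ring :: 'a ring) H (Qinv_mod m n Const) \<and>
     (\<forall>i. \<forall>C\<in>H. induced m n (steenrod i) C \<in> H)"

text \<open>\<open>g\<close> is the polynomial equal to the rational function \<open>\<delta>\<^sub>s\<^sub>+\<^sub>1\<^sub>;\<^sub>m\<^sup>n\<^sup>-\<^sup>s(f)\<close>. It is unique since
  \<open>to_fract\<close> is injective. An \<open>f\<close> without such a \<open>g\<close> would contribute nothing, so a statement about
  \<open>F\<close> should also assert that \<open>g\<close> exists.\<close>

definition F :: "nat \<Rightarrow> nat \<Rightarrow> nat \<Rightarrow> 'a::{field,finite} mpol set set" where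
  "F m n k = module.span (class_ring :: 'a ring) (Qmod m n Const)
     {cls m n g | g s f. s \<le> k \<and> f \<in> Delta m s \<and> g \<in> carrier (Sring n) \<and>
        to_fract g = (delta (s + 1) m ^^ (n - s)) (to_fract f)}"

end

theory Submission
  imports Defs
begin

text \<open>Write \<open>q\<close> for the order of the field, \<open>I\<close> for the ideal of the \<open>q\<^sup>m\<close>-th powers, \<open>L\<close> for the form
  \<open>x\<^sub>1 x\<^sub>2\<^sup>q - x\<^sub>1\<^sup>q x\<^sub>2\<close> and \<open>M = (q\<^sup>m - 1) / (q - 1)\<close>. Only the pairs \<open>(n, k) = (2, 1), (3, 1), (3, 2)\<close> occur.
  The idea is to replace the span that defines the subspace by an intrinsic description of the
  same space, from which closure under all the operations can be read off.

  For \<open>k = 1\<close> the subspace consists of the classes of the set \<open>B1\<close> of invariants killed by \<open>L\<close>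
  (lemma \<open>F_1\<close>). The generators are the top monomial and polynomials \<open>Phi\<close>, homogeneous parts of a
  product of truncated geometric series; the identity \<open>Phi_recursion\<close> expresses \<open>L \<cdot> Phi\<close> by the
  functions with one variable less, and it shows at once that \<open>Phi\<close> is what the delta operator
  produces, that \<open>Phi\<close> is invariant, and that \<open>L\<close> kills it. Conversely (\<open>B1_span\<close>), invariance under
  scalings and transvections and the relation \<open>L u \<in> I\<close> determine all coefficients of \<open>u\<close> from those
  of \<open>M + 1\<close> monomials. Since \<open>L\<close> divides every Steenrod operation on \<open>L\<close>, the Cartan formula gives
  the closure of \<open>B1\<close>. The Dickson invariants in question are, in two variables, a power of \<open>L\<close>,
  and in three variables sums of multiples of forms \<open>x\<^sub>i x\<^sub>j\<^sup>q - x\<^sub>i\<^sup>q x\<^sub>j\<close>.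

  For \<open>n = 3\<close> and \<open>k = 2\<close> let \<open>V\<close> be the product of the \<open>x\<^sub>3 + \<lambda>\<^sub>1 x\<^sub>1 + \<lambda>\<^sub>2 x\<^sub>2\<close>, and divide: \<open>x\<^sub>3\<close> to the
  power \<open>q\<^sup>m\<close> is \<open>V H + \<alpha> x\<^sub>3 + \<beta> x\<^sub>3\<^sup>q\<close>, where \<open>\<alpha>\<close> and \<open>\<beta>\<close> lie in the algebra \<open>\<D>\<^sub>2\<close> of Dickson invariants
  of \<open>x\<^sub>1, x\<^sub>2\<close>. As \<open>V\<close> is monic in \<open>x\<^sub>3\<close>, the polynomial \<open>\<delta>\<^sub>3\<^sub>;\<^sub>m(f)\<close> is congruent to \<open>f H\<close> after multiplication
  by \<open>L\<close> (lemma \<open>L2_delta3_poly\<close>), while \<open>L V H \<in> I\<close>. So the subspace consists of the classes of the set \<open>B2\<close> of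
  invariants \<open>u\<close> with \<open>L (u - f H) \<in> I\<close> for some \<open>f \<in> \<D>\<^sub>2\<close> (lemma \<open>F_2\<close>). The Dickson invariants of three variables lie in
  \<open>\<D>\<^sub>2\<close> modulo \<open>V\<close>, whence the module structure, and \<open>Q\<^sub>3\<^sub>,\<^sub>0\<close> is divisible by
  \<open>L V\<close>, whence the annihilation. A Steenrod operation on the numerator of \<open>\<delta>\<^sub>3\<^sub>;\<^sub>m(f)\<close> gives
  numerators of \<open>\<delta>\<^sub>3\<^sub>;\<^sub>m\<close> and \<open>\<delta>\<^sub>3\<^sub>;\<^sub>m\<^sub>+\<^sub>1\<close>, and the latter land in \<open>B1\<close>; this is \<open>B2_steenrod\<close>.
  It remains that \<open>\<Delta>\<close> spans \<open>\<D>\<^sub>2\<close> modulo the \<open>f\<close> with \<open>L f \<in> I\<close>: the polynomials \<open>\<beta>\<close> provide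
  relations with leading terms powers of \<open>Q\<^sub>2\<^sub>,\<^sub>1\<close> (\<open>Delta_2_spans\<close>).\<close>

section \<open>Frobenius over a finite field\<close>

lemma card_field_ge2: "2 \<le> CARD('a::{field,finite})"
proof -
  have "card {0::'a, 1} \<le> CARD('a)" by (rule card_mono) auto
  then show ?thesis by simp
qed

lemma pow_card: "(a::'a::{field,finite}) ^ CARD('a) = a"
proof (cases "a = 0")
  case False
  have "a * (\<Prod>y\<in>UNIV-{0}. a * y) = a * (a ^ (CARD('a) - 1) * \<Prod>(UNIV-{0}))"
    by (simp add: prod.distrib)
  also have "\<dots> = a ^ Suc (CARD('a) - 1) * \<Prod>(UNIV-{0})" by (simp only: power_Suc mult.assoc)
  also have "Suc (CARD('a) - 1) = CARD('a)" using card_field_ge2[where 'a='a] by simp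
  also have "(\<Prod>y\<in>UNIV-{0}. a * y) = (\<Prod>y\<in>UNIV-{0}. y)"
    by (rule prod.reindex_bij_witness[of _ "\<lambda>y. y / a" "\<lambda>y. a * y"]) (use False in auto)
  finally show ?thesis by simp
qed (use card_field_ge2[where 'a='a] in \<open>simp add: power_0_left\<close>)

lemma pow_card_minus_1: assumes "(a::'a::{field,finite}) \<noteq> 0" shows "a ^ (CARD('a) - 1) = 1"
proof -
  have "CARD('a) = Suc (CARD('a) - 1)" using card_field_ge2[where 'a='a] by simp
  then have "a * a ^ (CARD('a) - 1) = a * 1" using pow_card[of a] by (metis power_Suc mult_1_right)
  then show ?thesis using assms by simp
qed

lemma pow_card_pow: "(a::'a::{field,finite}) ^ (CARD('a) ^ k) = a"
  by (induction k) (simp_all add: power_mult pow_card)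

text \<open>The order \<open>q\<close> of the field need not be prime. The polynomial \<open>(1 + X)\<^sup>q - X\<^sup>q - 1\<close> has degree less
  than \<open>q\<close> and vanishes on the whole field, so its coefficients vanish.\<close>

lemma binom_card_eq_0:
  assumes "0 < k" "k < CARD('a)"
  shows "of_nat (CARD('a) choose k) = (0::'a::{field,finite})"
proof -
  let ?q = "CARD('a)"
  let ?p = "[:1, 1:] ^ ?q - Polynomial.monom 1 ?q - 1 :: 'a poly"
  have co: "poly.coeff ([:1, 1:] ^ ?q :: 'a poly) i = of_nat (?q choose i)" for i
    by (cases "i \<le> ?q") (auto simp: coeff_linear_poly_power coeff_eq_0 degree_linear_power binomial_eq_0)
  have "?p = 0"
  proof (rule ccontr)
    assume nz: "?p \<noteq> 0"
    have "poly ?p x = 0" for x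
      using pow_card[of "1 + x"] pow_card[of x] by (simp add: poly_monom)
    then have "{x. poly ?p x = 0} = UNIV" by auto
    then have "?q \<le> degree ?p" using card_poly_roots_bound[OF nz] by simp
    moreover have "degree ?p < ?q"
    proof (rule degree_lessI)
      show "?p \<noteq> 0 \<or> 0 < ?q" by simp
      show "\<forall>k\<ge>?q. poly.coeff ?p k = 0"
        using card_field_ge2[where 'a='a] by (auto simp: co binomial_eq_0)
    qed
    ultimately show False by simp
  qed
  then have "poly.coeff ?p k = 0" by simp
  then show ?thesis using assms by (simp add: co)
qed

lemma frobenius_add:
  fixes h :: "'a::{field,finite} \<Rightarrow> 'b::comm_ring_1"
  assumes "comm_ring_hom h"
  shows "(x + y :: 'b) ^ (CARD('a) ^ k) = x ^ (CARD('a) ^ k) + y ^ (CARD('a) ^ k)"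
proof (induction k)
  case (Suc k)
  interpret comm_ring_hom h by fact
  have z: "of_nat (CARD('a) choose i) = (0::'b)" if "i \<in> {..CARD('a)} - {0, CARD('a)}" for i
  proof -
    have "h (of_nat (CARD('a) choose i)) = of_nat (CARD('a) choose i)" by (rule hom_of_nat)
    moreover have "of_nat (CARD('a) choose i) = (0::'a)" by (rule binom_card_eq_0) (use that in auto)
    ultimately show ?thesis by simp
  qed
  have *: "(x + y) ^ CARD('a) = x ^ CARD('a) + y ^ CARD('a)" for x y :: 'b
  proof -
    have "(x + y) ^ CARD('a) = (\<Sum>i\<le>CARD('a). of_nat (CARD('a) choose i) * x ^ i * y ^ (CARD('a) - i))"
      by (rule binomial_ring)
    also have "\<dots> = (\<Sum>i\<in>{0, CARD('a)}. of_nat (CARD('a) choose i) * x ^ i * y ^ (CARD('a) - i))"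
      by (intro sum.mono_neutral_right ballI) (use z in auto)
    finally show ?thesis using card_field_ge2[where 'a='a] by (simp add: add.commute)
  qed
  show ?case by (simp add: power_mult mult.commute[of "CARD('a)"] Suc *)
qed simp

section \<open>Substitutions\<close>

definition subs :: "(nat \<Rightarrow> 'a::comm_ring_1 mpol) \<Rightarrow> 'a mpol \<Rightarrow> 'a mpol" where
  "subs = msubst Const"

interpretation Const: comm_ring_hom Const by (rule comm_ring_hom_Const)

interpretation subs: comm_ring_hom "subs \<sigma>" for \<sigma> :: "nat \<Rightarrow> 'a::comm_ring_1 mpol"
  by unfold_locales
    (simp_all add: subs_def msubst_add[OF comm_ring_hom_Const] msubst_mult[OF comm_ring_hom_Const]
      msubst_1[OF comm_ring_hom_Const] msubst_0[OF comm_ring_hom_Const])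

lemma subs_Const [simp]: "subs \<sigma> (Const c) = Const c"
  by (simp add: subs_def msubst_Const[OF comm_ring_hom_Const])

lemma subs_Var [simp]: "subs \<sigma> (Var i) = \<sigma> i"
  by (simp add: subs_def msubst_Var[OF comm_ring_hom_Const])

lemma Var_power: "(Var i :: 'a::comm_ring_1 mpol) ^ k = Poly_Mapping.single (Poly_Mapping.single i k) 1"
proof (induction k)
  case (Suc k)
  have "Poly_Mapping.single i (Suc k) = Poly_Mapping.single i 1 + Poly_Mapping.single i k"
    by (simp flip: single_add)
  then show ?case using Suc by (simp add: Var_def mult_single)
qed simp

lemma mpol_induct [case_names Const Var add mult]:
  assumes C: "\<And>c. P (Const c :: 'a::comm_ring_1 mpol)" and V: "\<And>i. P (Var i)"
    and A: "\<And>p r. P p \<Longrightarrow> P r \<Longrightarrow> P (p + r)" and M: "\<And>p r. P p \<Longrightarrow> P r \<Longrightarrow> P (p * r)"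
  shows "P p"
proof (induction p rule: poly_mapping_single_induct)
  case (single t c)
  have "P (Poly_Mapping.single t 1 :: 'a mpol)" for t :: "nat \<Rightarrow>\<^sub>0 nat"
  proof (induction t rule: poly_mapping_single_induct)
    case (single i k)
    have "P (Var i ^ k)"
    proof (induction k)
      case 0 then show ?case using C[of 1] by simp
    next
      case (Suc k) then show ?case using M[OF V] by simp
    qed
    then show ?case by (simp add: Var_power)
  next
    case (sum f g)
    then show ?case using M[of "Poly_Mapping.single f 1" "Poly_Mapping.single g 1"] by (simp add: mult_single)
  qed
  from M[OF C[of c] this[of t]] show ?case by (simp add: Const_def mult_single)
qed (rule A)

lemma hom_ext:
  fixes \<phi> \<psi> :: "'a::comm_ring_1 mpol \<Rightarrow> 'b::comm_ring_1"
  assumes "comm_ring_hom \<phi>" "comm_ring_hom \<psi>"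
    and "\<And>c. \<phi> (Const c) = \<psi> (Const c)" "\<And>i. \<phi> (Var i) = \<psi> (Var i)"
  shows "\<phi> p = \<psi> p"
proof -
  interpret a: comm_ring_hom \<phi> by fact
  interpret b: comm_ring_hom \<psi> by fact
  show ?thesis
    by (induction p rule: mpol_induct) (simp_all add: assms a.hom_add a.hom_mult b.hom_add b.hom_mult)
qed

lemma subs_subs: "subs \<sigma> (subs \<tau> p) = subs (\<lambda>i. subs \<sigma> (\<tau> i)) p"
  by (induction p rule: mpol_induct) (simp_all add: subs.hom_add subs.hom_mult)

lemma subs_id: "subs Var p = p"
  by (induction p rule: mpol_induct) (simp_all add: subs.hom_add subs.hom_mult)

lemma mfrob: "(p + r :: 'a::{field,finite} mpol) ^ (CARD('a) ^ k) = p ^ (CARD('a) ^ k) + r ^ (CARD('a) ^ k)"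
  by (rule frobenius_add[OF comm_ring_hom_Const])

lemma mfrob1: "(p + r :: 'a::{field,finite} mpol) ^ CARD('a) = p ^ CARD('a) + r ^ CARD('a)"
  using mfrob[of p r 1] by simp

lemma Const_pow: "(Const c :: 'a::{field,finite} mpol) ^ (CARD('a) ^ k) = Const c"
  by (simp add: pow_card_pow flip: Const.hom_power)

lemma Const_pow1: "(Const c :: 'a::{field,finite} mpol) ^ CARD('a) = Const c"
  using Const_pow[of c 1] by simp

lemma mfrob_Const: "(Const c * p :: 'a::{field,finite} mpol) ^ (CARD('a) ^ k) = Const c * p ^ (CARD('a) ^ k)"
  by (simp add: power_mult_distrib Const_pow)

lemma mfrob_uminus: "(- p :: 'a::{field,finite} mpol) ^ (CARD('a) ^ k) = - (p ^ (CARD('a) ^ k))"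
  using mfrob[of p "-p" k] by (simp add: power_0_left eq_neg_iff_add_eq_0 add.commute)

lemma mfrob_diff: "(p - r :: 'a::{field,finite} mpol) ^ (CARD('a) ^ k) = p ^ (CARD('a) ^ k) - r ^ (CARD('a) ^ k)"
  using mfrob[of p "-r" k] by (simp add: mfrob_uminus)

lemma mfrob_sum: "(\<Sum>i\<in>A. (f i :: 'a::{field,finite} mpol)) ^ (CARD('a) ^ k) = (\<Sum>i\<in>A. f i ^ (CARD('a) ^ k))"
  by (induction A rule: infinite_finite_induct) (simp_all add: mfrob power_0_left)

section \<open>Polynomials in the first \<open>n\<close> variables\<close>

abbreviation Sn :: "nat \<Rightarrow> 'a::{field,finite} mpol set" where
  "Sn n \<equiv> carrier (Sring n)"

lemma Sn_iff: "p \<in> Sn n \<longleftrightarrow> (\<forall>t\<in>Poly_Mapping.keys p. Poly_Mapping.keys t \<subseteq> {1..n})"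
  by (simp add: Sring_def)

lemma Sn_0 [simp, intro]: "0 \<in> Sn n" by (simp add: Sn_iff)
lemma Sn_Const [simp, intro]: "Const c \<in> Sn n" by (simp add: Sn_iff Const_def)
lemma Sn_1 [simp, intro]: "1 \<in> Sn n" using Sn_Const[of 1] by simp
lemma Sn_Var [intro]: "1 \<le> i \<Longrightarrow> i \<le> n \<Longrightarrow> Var i \<in> Sn n" by (simp add: Sn_iff Var_def)
lemma Sn_add [intro]: "p \<in> Sn n \<Longrightarrow> r \<in> Sn n \<Longrightarrow> p + r \<in> Sn n"
  unfolding Sn_iff using Poly_Mapping.keys_add[of p r] by blast
lemma Sn_mult [intro]: assumes "p \<in> Sn n" "r \<in> Sn n" shows "p * r \<in> Sn n"
  unfolding Sn_iff
proof
  fix t assume "t \<in> Poly_Mapping.keys (p * r)"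
  then obtain a b where "t = a + b" "a \<in> Poly_Mapping.keys p" "b \<in> Poly_Mapping.keys r"
    using keys_mult[of p r] by blast
  then show "Poly_Mapping.keys t \<subseteq> {1..n}"
    using assms Poly_Mapping.keys_add[of a b] unfolding Sn_iff by blast
qed
lemma Sn_uminus [intro]: "p \<in> Sn n \<Longrightarrow> - p \<in> Sn n" by (simp add: Sn_iff)
lemma Sn_diff [intro]: "p \<in> Sn n \<Longrightarrow> r \<in> Sn n \<Longrightarrow> p - r \<in> Sn n"
  using Sn_add[OF _ Sn_uminus, of p n r] by simp
lemma Sn_power [intro]: "p \<in> Sn n \<Longrightarrow> p ^ k \<in> Sn n" by (induction k) auto
lemma Sn_sum [intro]: "(\<And>i. i \<in> A \<Longrightarrow> f i \<in> Sn n) \<Longrightarrow> sum f A \<in> Sn n"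
  by (induction A rule: infinite_finite_induct) auto
lemma Sn_prod [intro]: "(\<And>i. i \<in> A \<Longrightarrow> f i \<in> Sn n) \<Longrightarrow> prod f A \<in> Sn n"
  by (induction A rule: infinite_finite_induct) auto

lemma Sn_mono: "p \<in> Sn n \<Longrightarrow> n \<le> k \<Longrightarrow> p \<in> Sn k"
  unfolding Sn_iff by fastforce

lemma subs_cong:
  assumes "p \<in> Sn n" "\<And>i. 1 \<le> i \<Longrightarrow> i \<le> n \<Longrightarrow> \<sigma> i = \<tau> i"
  shows "subs \<sigma> p = subs \<tau> p"
  unfolding subs_def msubst_def monom_eval_def
  by (intro sum.cong prod.cong arg_cong2[where f="(*)"] refl arg_cong2[where f="(^)"] assms(2))
     (use assms(1) in \<open>force simp: Sn_iff\<close>)+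

lemma subs_ident: "p \<in> Sn n \<Longrightarrow> (\<And>i. 1 \<le> i \<Longrightarrow> i \<le> n \<Longrightarrow> \<sigma> i = Var i) \<Longrightarrow> subs \<sigma> p = p"
  using subs_cong[of p n \<sigma> Var] by (simp add: subs_id)

lemma subs_in_Sn:
  assumes "p \<in> Sn n" "\<And>i. 1 \<le> i \<Longrightarrow> i \<le> n \<Longrightarrow> \<sigma> i \<in> Sn k"
  shows "subs \<sigma> p \<in> Sn k"
  unfolding subs_def msubst_def monom_eval_def
  by (intro Sn_sum Sn_mult Sn_Const Sn_prod Sn_power assms(2))
     (use assms(1) in \<open>force simp: Sn_iff\<close>)+

text \<open>Setting all variables but the first \<open>n\<close> to zero is a retraction onto the polynomials in the first
  \<open>n\<close> variables; what is fixed by it lies there.\<close>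

lemma truncate_in_Sn: "subs (\<lambda>i. if 1 \<le> i \<and> i \<le> n then Var i else 0) p \<in> (Sn n :: 'a::{field,finite} mpol set)"
  unfolding subs_def msubst_def monom_eval_def
  by (intro Sn_sum Sn_mult Sn_Const Sn_prod Sn_power) auto

lemma Sn_quotient:
  assumes "g * l = N" "l \<in> Sn n" "N \<in> Sn n" "l \<noteq> 0"
  shows "g \<in> Sn n"
proof -
  let ?\<pi> = "\<lambda>i. if 1 \<le> i \<and> i \<le> n then Var i else (0 :: 'a mpol)"
  have fix_Sn: "subs ?\<pi> p = p" if "p \<in> Sn n" for p :: "'a mpol" by (rule subs_ident[OF that]) auto
  have "subs ?\<pi> g * subs ?\<pi> l = g * l" using fix_Sn[OF assms(3)] by (simp only: assms(1) subs.hom_mult[symmetric])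
  then have "subs ?\<pi> g * l = g * l" by (simp only: fix_Sn[OF assms(2)])
  then have "subs ?\<pi> g = g" using mult_right_cancel[OF assms(4)] by blast
  moreover have "subs ?\<pi> g \<in> Sn n"
    by (rule truncate_in_Sn)
  ultimately show ?thesis by simp
qed

section \<open>Divisibility by products of linear forms\<close>

lemma dvd_diff_subs: "Var k - r dvd p - subs (Var(k := r)) p"
proof (induction p rule: mpol_induct)
  case (add p s)
  have "p + s - subs (Var(k := r)) (p + s) = (p - subs (Var(k := r)) p) + (s - subs (Var(k := r)) s)"
    by (simp add: subs.hom_add algebra_simps)
  then show ?case using add by (metis dvd_add)
next
  case (mult p s)
  have "p * s - subs (Var(k := r)) (p * s)
      = (p - subs (Var(k := r)) p) * s + subs (Var(k := r)) p * (s - subs (Var(k := r)) s)"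
    by (simp add: subs.hom_mult algebra_simps)
  then show ?case using mult by (metis dvd_add dvd_mult dvd_mult2)
qed auto

lemma dvd_if_subs_0: "subs (Var(k := r)) p = 0 \<Longrightarrow> Var k - r dvd p"
  using dvd_diff_subs[of k r p] by simp

text \<open>A polynomial that vanishes on each of several distinct hyperplanes \<open>x\<^sub>k = r\<close> is divisible by the
  product of their equations: by substitution, each equation divides the cofactor of the
  previous ones.\<close>

lemma prod_forms_dvd:
  fixes p :: "'a::{field,finite} mpol"
  assumes "finite J"
    and "\<And>j. j \<in> J \<Longrightarrow> subs (Var(k j := r j)) p = 0"
    and "\<And>i j. i \<in> J \<Longrightarrow> j \<in> J \<Longrightarrow> i \<noteq> j \<Longrightarrow> subs (Var(k i := r i)) (Var (k j) - r j) \<noteq> 0"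
  shows "(\<Prod>j\<in>J. Var (k j) - r j) dvd p"
  using assms
proof (induction J rule: finite_induct)
  case (insert i J)
  then obtain v where v: "p = (\<Prod>j\<in>J. Var (k j) - r j) * v" by (auto elim: dvdE)
  have "subs (Var(k i := r i)) p = 0" by (rule insert.prems(1)) simp
  then have "(\<Prod>j\<in>J. subs (Var(k i := r i)) (Var (k j) - r j)) * subs (Var(k i := r i)) v = 0"
    by (simp add: v subs.hom_mult subs.hom_prod)
  moreover have "(\<Prod>j\<in>J. subs (Var(k i := r i)) (Var (k j) - r j)) \<noteq> 0"
    unfolding prod_zero_iff[OF insert.hyps(1)] using insert.prems(2) insert.hyps by (metis insertI1 insertI2)
  ultimately have "Var (k i) - r i dvd v" by (intro dvd_if_subs_0) simp
  then show ?case unfolding v using insert.hyps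
    by (simp add: mult.commute mult_dvd_mono)
qed simp

section \<open>The ideal generated by the powers of the variables\<close>

text \<open>Membership in the monomial ideal, tested on monomials; it makes sense for
  polynomials in any variables.\<close>

definition in_ideal :: "nat \<Rightarrow> nat \<Rightarrow> 'a::{field,finite} mpol \<Rightarrow> bool" where
  "in_ideal m n u \<longleftrightarrow> (\<forall>t\<in>Poly_Mapping.keys u. \<exists>i\<in>{1..n}. CARD('a) ^ m \<le> Poly_Mapping.lookup t i)"

lemma in_ideal_0 [simp, intro]: "in_ideal m n 0" by (simp add: in_ideal_def)
lemma in_ideal_add [intro]: "in_ideal m n u \<Longrightarrow> in_ideal m n v \<Longrightarrow> in_ideal m n (u + v)"
  unfolding in_ideal_def using Poly_Mapping.keys_add[of u v] by blast
lemma in_ideal_uminus [intro]: "in_ideal m n u \<Longrightarrow> in_ideal m n (- u)" by (simp add: in_ideal_def)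
lemma in_ideal_diff [intro]: "in_ideal m n u \<Longrightarrow> in_ideal m n v \<Longrightarrow> in_ideal m n (u - v)"
  using in_ideal_add[OF _ in_ideal_uminus, of m n u v] by simp
lemma in_ideal_mult [intro]: assumes "in_ideal m n u" shows "in_ideal m n (u * v)"
  unfolding in_ideal_def
proof
  fix t assume "t \<in> Poly_Mapping.keys (u * v)"
  then obtain a b where "t = a + b" "a \<in> Poly_Mapping.keys u"
    using keys_mult[of u v] by blast
  then show "\<exists>i\<in>{1..n}. CARD('a) ^ m \<le> Poly_Mapping.lookup t i"
    using assms unfolding in_ideal_def by (metis lookup_add trans_le_add1)
qed
lemma in_ideal_mult2 [intro]: "in_ideal m n u \<Longrightarrow> in_ideal m n (v * u)" by (metis in_ideal_mult mult.commute)
lemma in_ideal_sum [intro]: "(\<And>i. i \<in> A \<Longrightarrow> in_ideal m n (f i)) \<Longrightarrow> in_ideal m n (sum f A)"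
  by (induction A rule: infinite_finite_induct) auto
lemma in_ideal_Var: "1 \<le> i \<Longrightarrow> i \<le> n \<Longrightarrow> in_ideal m n ((Var i :: 'a::{field,finite} mpol) ^ (CARD('a) ^ m))"
  unfolding in_ideal_def Var_power by (auto intro!: bexI[of _ i])
lemma in_ideal_mono: "in_ideal b n u \<Longrightarrow> m \<le> b \<Longrightarrow> n \<le> k \<Longrightarrow> in_ideal m k u"
  unfolding in_ideal_def using card_field_ge2[where 'a='a]
  by (metis atLeastAtMost_iff le_trans one_le_numeral power_increasing)
lemma in_ideal_trans: "in_ideal m n (u - v) \<Longrightarrow> in_ideal m n (v - w) \<Longrightarrow> in_ideal m n (u - w)"
  using in_ideal_add[of m n "u - v" "v - w"] by simp

lemma poly_mapping_eq_sum_single: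
  fixes u :: "'c \<Rightarrow>\<^sub>0 'd::comm_monoid_add"
  shows "(\<Sum>t\<in>Poly_Mapping.keys u. Poly_Mapping.single t (Poly_Mapping.lookup u t)) = u"
proof (rule poly_mapping_eqI)
  fix k
  have 1: "Poly_Mapping.lookup (\<Sum>t\<in>Poly_Mapping.keys u. Poly_Mapping.single t (Poly_Mapping.lookup u t)) k
        = (\<Sum>t\<in>Poly_Mapping.keys u. Poly_Mapping.lookup (Poly_Mapping.single t (Poly_Mapping.lookup u t)) k)"
    by (rule lookup_sum)
  have 2: "\<dots> = (\<Sum>t\<in>Poly_Mapping.keys u. if k = t then Poly_Mapping.lookup u t else 0)"
    by (rule sum.cong) (simp_all add: lookup_single when_def)
  have 3: "\<dots> = (if k \<in> Poly_Mapping.keys u then Poly_Mapping.lookup u k else 0)"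
      by (rule sum.delta'[OF finite_keys])
  show "Poly_Mapping.lookup (\<Sum>t\<in>Poly_Mapping.keys u. Poly_Mapping.single t (Poly_Mapping.lookup u t)) k
        = Poly_Mapping.lookup u k" using 1 2 3 by (simp add: in_keys_iff)
qed

lemma in_ideal_induct:
  assumes "in_ideal m n u"
    and gen: "\<And>i p. 1 \<le> i \<Longrightarrow> i \<le> n \<Longrightarrow> P ((Var i :: 'a::{field,finite} mpol) ^ (CARD('a) ^ m) * p)"
    and zero: "P 0" and add: "\<And>u v. P u \<Longrightarrow> P v \<Longrightarrow> P (u + v)"
  shows "P u"
proof -
  have mon: "P (Poly_Mapping.single t (Poly_Mapping.lookup u t))" if "t \<in> Poly_Mapping.keys u" for t
  proof -
    obtain i where i: "i \<in> {1..n}" "CARD('a) ^ m \<le> Poly_Mapping.lookup t i"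
      using assms(1) \<open>t \<in> Poly_Mapping.keys u\<close> unfolding in_ideal_def by blast
    let ?s = "Poly_Mapping.single i (CARD('a) ^ m)"
    have "?s + (t - ?s) = t"
      by (rule poly_mapping_eqI) (use i in \<open>auto simp: lookup_add lookup_minus lookup_single when_def\<close>)
    then have "Poly_Mapping.single t (Poly_Mapping.lookup u t)
        = Var i ^ (CARD('a) ^ m) * Poly_Mapping.single (t - ?s) (Poly_Mapping.lookup u t)"
      by (simp add: Var_power mult_single)
    then show ?thesis using gen[of i] i by simp
  qed
  have "P (\<Sum>t\<in>A. Poly_Mapping.single t (Poly_Mapping.lookup u t))" if "A \<subseteq> Poly_Mapping.keys u" for A
    using that
  proof (induction A rule: infinite_finite_induct)
    case (insert t A)
    then show ?case by (simp add: add mon)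
  qed (simp_all add: zero)
  from this[OF order_refl] show ?thesis by (simp add: poly_mapping_eq_sum_single)
qed

(* The index 1 of the first variable is kept as a numeral. *)
declare One_nat_def [simp del]

section \<open>Linear substitutions and the general linear group\<close>

definition lin_forms :: "nat \<Rightarrow> 'a::{field,finite} mpol set" where
  "lin_forms n = {\<Sum>i = 1..n. Const (c i) * Var i | c. True}"

lemma lin_forms_sum [intro]: "(\<Sum>i = 1..n. Const (c i) * Var i) \<in> lin_forms n" by (auto simp: lin_forms_def)

lemma lin_forms_add [intro]: assumes "p \<in> lin_forms n" "r \<in> lin_forms n" shows "p + r \<in> lin_forms n"
proof -
  obtain c d where "p = (\<Sum>i = 1..n. Const (c i) * Var i)" "r = (\<Sum>i = 1..n. Const (d i) * Var i)"
    using assms by (auto simp: lin_forms_def)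
  then have "p + r = (\<Sum>i = 1..n. Const (c i + d i) * Var i)"
    by (simp add: sum.distrib Const.hom_add distrib_right)
  then show ?thesis by auto
qed

lemma lin_forms_scale [intro]: assumes "p \<in> lin_forms n" shows "Const a * p \<in> lin_forms n"
proof -
  obtain c where "p = (\<Sum>i = 1..n. Const (c i) * Var i)" using assms by (auto simp: lin_forms_def)
  then have "Const a * p = (\<Sum>i = 1..n. Const (a * c i) * Var i)"
    by (simp add: sum_distrib_left Const.hom_mult mult.assoc)
  then show ?thesis by auto
qed

lemma lin_forms_0 [intro]: "0 \<in> lin_forms n"
  using lin_forms_sum[of "\<lambda>_. 0" n] by simp

lemma lin_forms_Var [intro]: assumes "1 \<le> i" "i \<le> n" shows "Var i \<in> lin_forms n"
proof -
  have "(\<Sum>j = 1..n. Const (if j = i then 1 else 0) * Var j) = (\<Sum>j = 1..n. if j = i then Var j else (0::'a mpol))"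
    by (rule sum.cong) auto
  also have "\<dots> = Var i" using assms by simp
  finally show ?thesis using lin_forms_sum[of "\<lambda>j. if j = i then 1 else 0 :: 'a" n] by simp
qed

lemma lin_forms_uminus [intro]: "p \<in> lin_forms n \<Longrightarrow> - p \<in> lin_forms n"
  using lin_forms_scale[of p n "-1"] by (simp add: Const.hom_uminus)

lemma lin_forms_diff [intro]: "p \<in> lin_forms n \<Longrightarrow> r \<in> lin_forms n \<Longrightarrow> p - r \<in> lin_forms n"
  using lin_forms_add[OF _ lin_forms_uminus, of p n r] by simp

lemma lin_forms_sum' [intro]: "(\<And>i. i \<in> A \<Longrightarrow> f i \<in> lin_forms n) \<Longrightarrow> sum f A \<in> lin_forms n"
  by (induction A rule: infinite_finite_induct) auto

lemma lin_forms_Sn: "p \<in> lin_forms n \<Longrightarrow> p \<in> Sn n" by (auto simp: lin_forms_def intro!: Sn_sum Sn_mult Sn_Var)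

lemma subs_lin_forms: assumes "p \<in> lin_forms n" "\<And>i. 1 \<le> i \<Longrightarrow> i \<le> n \<Longrightarrow> \<sigma> i \<in> lin_forms k" shows "subs \<sigma> p \<in> lin_forms k"
  using assms by (auto simp: lin_forms_def[of n] subs.hom_sum subs.hom_mult intro!: lin_forms_sum' lin_forms_scale)

lemma lookup_lin_forms:
  assumes "1 \<le> k" "k \<le> n"
  shows "Poly_Mapping.lookup (\<Sum>i = 1..n. Const (c i) * Var i) (Poly_Mapping.single k 1) = c k"
proof -
  have "Poly_Mapping.lookup (Const (c i) * Var i) (Poly_Mapping.single k 1) = (if i = k then c i else 0)" for i
  proof -
    have "Poly_Mapping.single i (1::nat) = Poly_Mapping.single k 1 \<longleftrightarrow> i = k"
      by (metis lookup_single_eq lookup_single_not_eq zero_neq_one)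
    then show ?thesis by (simp add: Const_def Var_def mult_single lookup_single when_def)
  qed
  then show ?thesis using assms by (simp add: lookup_sum)
qed

lemma lin_forms_pow: "(\<Sum>i = 1..n. Const (c i) * Var i :: 'a::{field,finite} mpol) ^ (CARD('a) ^ k)
   = (\<Sum>i = 1..n. Const (c i) * Var i ^ (CARD('a) ^ k))"
  by (simp add: mfrob_sum mfrob_Const)

lemma in_ideal_lin_forms: "p \<in> lin_forms n \<Longrightarrow> in_ideal m n ((p :: 'a::{field,finite} mpol) ^ (CARD('a) ^ m))"
  by (auto simp: lin_forms_def lin_forms_pow intro!: in_ideal_sum in_ideal_mult2 in_ideal_Var)

text \<open>By additivity of Frobenius linear forms can be substituted for the variables.\<close>

lemma in_ideal_subs:
  assumes "in_ideal m n u" "\<And>i. 1 \<le> i \<Longrightarrow> i \<le> n \<Longrightarrow> in_ideal m k ((\<sigma> i :: 'a::{field,finite} mpol) ^ (CARD('a) ^ m))"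
  shows "in_ideal m k (subs \<sigma> u)"
  using assms(1)
  by (rule in_ideal_induct) (auto simp: subs.hom_mult subs.hom_power subs.hom_add intro: in_ideal_mult assms(2))

definition image_form :: "nat \<Rightarrow> 'a::{field,finite} mat \<Rightarrow> nat \<Rightarrow> 'a mpol" where
  "image_form n g j = (\<Sum>i = 1..n. Const (g $$ (i - 1, j - 1)) * Var i)"

lemma lin_subst_subs: "lin_subst n g = subs (image_form n g)"
  by (simp add: lin_subst_def subs_def image_form_def[abs_def])

lemma image_form_lin_forms [simp, intro]: "image_form n g j \<in> lin_forms n" by (auto simp: image_form_def)

lemma image_form_mult:
  assumes A: "A \<in> carrier_mat n n" and B: "B \<in> carrier_mat n n" and j: "1 \<le> j" "j \<le> n"
  shows "image_form n (A * B) j = subs (image_form n A) (image_form n B j)"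
proof -
  have e: "(A * B) $$ (k - 1, j - 1) = (\<Sum>i = 1..n. A $$ (k - 1, i - 1) * B $$ (i - 1, j - 1))"
    if "k \<in> {1..n}" for k
  proof -
    have "(A * B) $$ (k - 1, j - 1) = (\<Sum>l = 0..<n. A $$ (k - 1, l) * B $$ (l, j - 1))"
      using A B j that by (auto simp: scalar_prod_def)
    also have "\<dots> = (\<Sum>i = 1..n. A $$ (k - 1, i - 1) * B $$ (i - 1, j - 1))"
      by (rule sum.reindex_bij_witness[of _ "\<lambda>i. i - 1" Suc]) auto
    finally show ?thesis .
  qed
  have "image_form n (A * B) j = (\<Sum>k = 1..n. \<Sum>i = 1..n. Const (A $$ (k - 1, i - 1) * B $$ (i - 1, j - 1)) * Var k)"
    unfolding image_form_def by (rule sum.cong) (auto simp: e Const.hom_sum sum_distrib_right)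
  also have "\<dots> = (\<Sum>i = 1..n. \<Sum>k = 1..n. Const (A $$ (k - 1, i - 1) * B $$ (i - 1, j - 1)) * Var k)"
    by (rule sum.swap)
  also have "\<dots> = subs (image_form n A) (image_form n B j)"
    by (simp add: image_form_def subs.hom_sum subs.hom_mult sum_distrib_left Const.hom_mult mult_ac)
  finally show ?thesis .
qed

lemma image_form_one: assumes "1 \<le> j" "j \<le> n" shows "image_form n (1\<^sub>m n) j = Var j"
proof -
  have "image_form n (1\<^sub>m n) j = (\<Sum>i = 1..n. if i = j then Var i else 0)"
    unfolding image_form_def by (rule sum.cong) (use assms in auto)
  then show ?thesis using assms by simp
qed

lemma GL_inverse:
  assumes "g \<in> GL n"
  obtains h where "h \<in> carrier_mat n n" "g \<in> carrier_mat n n" "g * h = 1\<^sub>m n" "h * g = 1\<^sub>m n"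
proof -
  have g: "g \<in> carrier_mat n n" using assms by (simp add: GL_def)
  obtain h where h: "g * h = 1\<^sub>m (dim_row g)" "h * g = 1\<^sub>m (dim_row h)"
    using assms unfolding GL_def invertible_mat_def inverts_mat_def by blast
  have "dim_col (g * h) = n" "dim_col (h * g) = dim_row h" using h g by auto
  then have "h \<in> carrier_mat n n" using g by auto
  then show ?thesis using that g h by auto
qed

lemma GL_intro:
  assumes "g \<in> carrier_mat n n" "h \<in> carrier_mat n n" "h * g = 1\<^sub>m n"
  shows "g \<in> GL n"
proof -
  have "g * h = 1\<^sub>m n" using mat_mult_left_right_inverse[OF assms(2,1,3)] .
  then show ?thesis using assms unfolding GL_def invertible_mat_def inverts_mat_def
    by (auto intro!: exI[of _ h])
qed

lemma lin_subst_of_subst: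
  assumes s: "\<And>i. 1 \<le> i \<Longrightarrow> i \<le> n \<Longrightarrow> \<sigma> i \<in> lin_forms n" and t: "\<And>i. 1 \<le> i \<Longrightarrow> i \<le> n \<Longrightarrow> \<tau> i \<in> lin_forms n"
    and inv: "\<And>i. 1 \<le> i \<Longrightarrow> i \<le> n \<Longrightarrow> subs \<tau> (\<sigma> i) = Var i"
  obtains g :: "'a::{field,finite} mat" where "g \<in> GL n" "\<And>u. u \<in> Sn n \<Longrightarrow> lin_subst n g u = subs \<sigma> u"
proof -
  define M where "M \<sigma> = mat n n (\<lambda>(i, j). Poly_Mapping.lookup (\<sigma> (Suc j)) (Poly_Mapping.single (Suc i) 1))"
    for \<sigma> :: "nat \<Rightarrow> 'a mpol"
  have M: "image_form n (M \<sigma>) j = \<sigma> j" if j: "1 \<le> j" "j \<le> n" and L: "\<sigma> j \<in> lin_forms n" for \<sigma> :: "nat \<Rightarrow> 'a mpol" and j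
  proof -
    obtain c where c: "\<sigma> j = (\<Sum>i = 1..n. Const (c i) * Var i)" using L by (auto simp: lin_forms_def)
    have "M \<sigma> $$ (i - 1, j - 1) = c i" if i: "i \<in> {1..n}" for i
    proof -
      have "M \<sigma> $$ (i - 1, j - 1) = Poly_Mapping.lookup (\<sigma> j) (Poly_Mapping.single i 1)"
        using i j by (auto simp: M_def)
      then show ?thesis using i unfolding c by (subst (asm) lookup_lin_forms) auto
    qed
    then show ?thesis unfolding image_form_def c by (intro sum.cong) auto
  qed
  have car: "M \<sigma> \<in> carrier_mat n n" for \<sigma> by (simp add: M_def)
  have lfp: "image_form n (M \<tau> * M \<sigma>) j = Var j" if "1 \<le> j" "j \<le> n" for j
  proof -
    have "image_form n (M \<tau> * M \<sigma>) j = subs (image_form n (M \<tau>)) (\<sigma> j)"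
      using image_form_mult[OF car car that] M[of j \<sigma>, OF that s[OF that]] by simp
    also have "\<dots> = subs \<tau> (\<sigma> j)"
      by (rule subs_cong[OF lin_forms_Sn[OF s[OF that]]]) (use M t in auto)
    finally show ?thesis using inv that by simp
  qed
  have "M \<tau> * M \<sigma> = 1\<^sub>m n"
  proof (rule eq_matI)
    fix i j assume ij: "i < dim_row (1\<^sub>m n)" "j < dim_col (1\<^sub>m n)"
    have co: "Poly_Mapping.lookup (image_form n A (Suc j)) (Poly_Mapping.single (Suc i) 1) = A $$ (i, j)" for A :: "'a mat"
      unfolding image_form_def by (subst lookup_lin_forms) (use ij in auto)
    have "image_form n (M \<tau> * M \<sigma>) (Suc j) = image_form n (1\<^sub>m n) (Suc j)"
      using ij by (simp add: lfp image_form_one)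
    then show "(M \<tau> * M \<sigma>) $$ (i, j) = 1\<^sub>m n $$ (i, j)" by (metis co)
  qed (auto simp: M_def)
  then have "M \<sigma> \<in> GL n" by (rule GL_intro[OF car car])
  moreover have "lin_subst n (M \<sigma>) u = subs \<sigma> u" if "u \<in> Sn n" for u
    unfolding lin_subst_subs by (rule subs_cong[OF that]) (use M s in auto)
  ultimately show ?thesis using that by blast
qed

abbreviation swap :: "nat \<Rightarrow> nat \<Rightarrow> nat \<Rightarrow> 'a::{field,finite} mpol" where
  "swap i j \<equiv> Var(i := Var j, j := Var i)"

text \<open>Gaussian elimination on the columns of the substitution matrix: an invertible linear
  substitution is a composite of transpositions, scalings of \<open>x\<^sub>1\<close> and transvections
  \<open>x\<^sub>1 \<mapsto> x\<^sub>1 + c x\<^sub>2\<close>. The set \<open>Z\<close> is meant to be an ideal stable under linear substitutions.\<close>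

lemma invariant_if_elementary:
  fixes u :: "'a::{field,finite} mpol"
  assumes n: "2 \<le> n" and u: "u \<in> Sn n"
    and Z0: "0 \<in> Z" and Zadd: "\<And>p r. p \<in> Z \<Longrightarrow> r \<in> Z \<Longrightarrow> p + r \<in> Z"
    and Zsb: "\<And>\<sigma> p. (\<And>i. 1 \<le> i \<Longrightarrow> i \<le> n \<Longrightarrow> \<sigma> i \<in> lin_forms n) \<Longrightarrow> p \<in> Z \<Longrightarrow> subs \<sigma> p \<in> Z"
    and sw: "\<And>i j. 1 \<le> i \<Longrightarrow> i \<le> n \<Longrightarrow> 1 \<le> j \<Longrightarrow> j \<le> n \<Longrightarrow> i \<noteq> j \<Longrightarrow> subs (swap i j) u - u \<in> Z"
    and sc: "\<And>c. c \<noteq> 0 \<Longrightarrow> subs (Var(1 := Const c * Var 1)) u - u \<in> Z"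
    and tr: "\<And>c. subs (Var(1 := Var 1 + Const c * Var 2)) u - u \<in> Z"
    and g: "g \<in> GL n"
  shows "lin_subst n g u - u \<in> Z"
proof -
  define lin where "lin \<sigma> \<longleftrightarrow> (\<forall>i. 1 \<le> i \<longrightarrow> i \<le> n \<longrightarrow> \<sigma> i \<in> lin_forms n)" for \<sigma> :: "nat \<Rightarrow> 'a mpol"
  define good where "good \<sigma> \<longleftrightarrow> subs \<sigma> u - u \<in> Z" for \<sigma> :: "nat \<Rightarrow> 'a mpol"
  have cong: "good \<sigma>" if "good \<tau>" "\<And>i. 1 \<le> i \<Longrightarrow> i \<le> n \<Longrightarrow> \<sigma> i = \<tau> i" for \<sigma> \<tau>
    using that subs_cong[OF u, of \<sigma> \<tau>] by (simp add: good_def)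
  have comp: "good (\<lambda>i. subs \<sigma> (\<tau> i))" if "good \<sigma>" "good \<tau>" "lin \<sigma>" for \<sigma> \<tau>
  proof -
    have "subs (\<lambda>i. subs \<sigma> (\<tau> i)) u - u = subs \<sigma> (subs \<tau> u - u) + (subs \<sigma> u - u)"
      by (simp add: subs_subs subs.hom_minus)
    then show ?thesis using that Zsb[of \<sigma> "subs \<tau> u - u"] unfolding good_def lin_def by (metis Zadd)
  qed
  have gsw: "good (swap i j)" if "1 \<le> i" "i \<le> n" "1 \<le> j" "j \<le> n" for i j
  proof (cases "i = j")
    case True
    then have "swap i j = (Var :: nat \<Rightarrow> 'a mpol)" by auto
    then show ?thesis by (simp add: good_def subs_id Z0)
  qed (use sw that in \<open>simp add: good_def\<close>)
  have lsw: "lin (swap i j)" if "1 \<le> i" "i \<le> n" "1 \<le> j" "j \<le> n" for i j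
    using that by (auto simp: lin_def)
  \<comment> \<open>Conjugate the given transvections by transpositions.\<close>
  have gtr: "good (Var(1 := Var 1 + Const c * Var j))" if "2 \<le> j" "j \<le> n" for c j
  proof (cases "j = 2")
    case True then show ?thesis using tr[of c] by (simp add: good_def del: fun_upd_apply)
  next
    case False
    have "good (\<lambda>i. subs (swap 2 j) (subs (Var(1 := Var 1 + Const c * Var 2)) (swap 2 j i)))"
      using that n by (intro comp gsw lsw) (auto simp: good_def tr lin_def intro!: lin_forms_add lin_forms_scale lin_forms_Var)
    then show ?thesis
      by (rule cong) (use that False in \<open>auto simp: subs.hom_add subs.hom_mult\<close>)
  qed
  have g1: "good (Var(1 := Const a * Var 1 + (\<Sum>i\<in>F. Const (c i) * Var i)))"
    if "finite F" "F \<subseteq> {2..n}" "a \<noteq> 0" for F a c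
    using that
  proof (induction F rule: finite_induct)
    case empty then show ?case using sc[of a] by (simp add: good_def del: fun_upd_apply)
  next
    case (insert j F)
    have j: "2 \<le> j" "j \<le> n" using insert.prems by auto
    let ?\<tau> = "Var(1 := Var 1 + Const (c j / a) * Var j)"
    have "good (\<lambda>i. subs ?\<tau> ((Var(1 := Const a * Var 1 + (\<Sum>i\<in>F. Const (c i) * Var i))) i))"
      using insert j n by (intro comp gtr) (auto simp: lin_def intro!: lin_forms_add lin_forms_scale lin_forms_Var)
    then show ?case
    proof (rule cong)
      have "subs ?\<tau> (\<Sum>i\<in>F. Const (c i) * Var i) = (\<Sum>i\<in>F. Const (c i) * Var i)"
        unfolding subs.hom_sum by (rule sum.cong) (use insert.prems in \<open>auto simp: subs.hom_mult\<close>)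
      moreover have "Const a * Const (c j / a) = Const (c j)"
        using insert.prems by (simp flip: Const.hom_mult)
      ultimately show "(Var(1 := Const a * Var 1 + (\<Sum>i\<in>insert j F. Const (c i) * Var i))) i
          = subs ?\<tau> ((Var(1 := Const a * Var 1 + (\<Sum>i\<in>F. Const (c i) * Var i))) i)"
        if "1 \<le> i" "i \<le> n" for i
        using insert.hyps j by (auto simp: subs.hom_add subs.hom_mult distrib_left mult.assoc[symmetric] add_ac)
    qed
  qed
  have split: "(\<Sum>i = 1..n. Const (c i) * Var i) = Const (c p) * Var p + (\<Sum>i\<in>{1..n}-{p}. Const (c i) * Var i)"
    if "1 \<le> p" "p \<le> n" for c :: "nat \<Rightarrow> 'a" and p
    using that by (subst sum.remove[of _ p]) auto
  \<comment> \<open>Any invertible change of a single variable is conjugate to one of the first variable.\<close>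
  have gT: "good (Var(p := (\<Sum>i = 1..n. Const (c i) * Var i)))" if p: "1 \<le> p" "p \<le> n" and "c p \<noteq> 0" for p c
  proof -
    let ?s = "swap 1 p :: nat \<Rightarrow> 'a mpol"
    let ?d = "c(1 := c p, p := c 1)"
    let ?l = "\<Sum>i = 1..n. Const (?d i) * Var i"
    have l: "subs ?s ?l = (\<Sum>i = 1..n. Const (c i) * Var i)"
    proof -
      have "subs ?s ?l = (\<Sum>i = 1..n. Const (?d i) * ?s i)" by (simp add: subs.hom_sum subs.hom_mult)
      also have "\<dots> = (\<Sum>i = 1..n. Const (c i) * Var i)"
        by (rule sum.reindex_bij_witness[of _ "id(1 := p, p := 1)" "id(1 := p, p := 1)"])
           (use p n in \<open>auto split: if_splits\<close>)
      finally show ?thesis .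
    qed
    have sp: "?l = Const (?d 1) * Var 1 + (\<Sum>i\<in>{1..n}-{1}. Const (?d i) * Var i)"
      by (rule split) (use n in auto)
    have "good (Var(1 := ?l))"
      unfolding sp by (rule g1) (use that n in auto)
    then have "good (\<lambda>i. subs ?s (subs (Var(1 := ?l)) (?s i)))"
      using p n by (intro comp gsw lsw) (auto simp: lin_def)
    then show ?thesis
    proof (rule cong)
      fix i
      show "(Var(p := (\<Sum>i = 1..n. Const (c i) * Var i))) i = subs ?s (subs (Var(1 := ?l)) (?s i))"
        using l by (cases "p = 1") (auto simp: fun_upd_def)
    qed
  qed
  \<comment> \<open>Induction on the number \<open>k\<close> of columns that are not yet standard, with \<open>\<tau>\<close> the inverse substitution.\<close>
  have main: "good \<sigma>" if "lin \<sigma>" "lin \<tau>" "\<And>i. 1 \<le> i \<Longrightarrow> i \<le> n \<Longrightarrow> subs \<tau> (\<sigma> i) = Var i"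
    "\<And>i. 1 \<le> i \<Longrightarrow> i \<le> n - k \<Longrightarrow> \<sigma> i = Var i" "k \<le> n" for k \<sigma> \<tau>
    using that
  proof (induction k arbitrary: \<sigma> \<tau>)
    case 0
    then have "subs \<sigma> u = u" by (intro subs_ident[OF u]) auto
    then show ?case by (simp add: good_def Z0)
  next
    case (Suc k)
    define p where "p = n - k"
    have p: "1 \<le> p" "p \<le> n" and low: "\<And>i. 1 \<le> i \<Longrightarrow> i < p \<Longrightarrow> \<sigma> i = Var i"
      using Suc.prems by (auto simp: p_def)
    obtain c where c: "\<sigma> p = (\<Sum>i = 1..n. Const (c i) * Var i)"
      using Suc.prems(1) p unfolding lin_def lin_forms_def by blast
    \<comment> \<open>Otherwise column \<open>p\<close> would depend on the columns before it.\<close>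
    have "\<exists>i. p \<le> i \<and> i \<le> n \<and> c i \<noteq> 0"
    proof (rule ccontr)
      assume no: "\<not> ?thesis"
      have "Var p = subs \<tau> (\<sigma> p)" using Suc.prems(3) p by simp
      also have "\<dots> = (\<Sum>i = 1..n. Const (c i) * \<tau> i)" by (simp add: c subs.hom_sum subs.hom_mult)
      also have "\<dots> = (\<Sum>i = 1..n. Const (c i) * Var i)"
      proof (rule sum.cong)
        fix i assume i: "i \<in> {1..n}"
        show "Const (c i) * \<tau> i = Const (c i) * Var i"
        proof (cases "i < p")
          case True
          then show ?thesis using Suc.prems(3)[of i] low[of i] i by simp
        qed (use no i in auto)
      qed simp
      finally have "Poly_Mapping.lookup (Var p :: 'a mpol) (Poly_Mapping.single p 1) = c p"
        using lookup_lin_forms[OF p] by metis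
      then show False using no p by (auto simp: Var_def)
    qed
    then obtain i0 where i0: "p \<le> i0" "i0 \<le> n" "c i0 \<noteq> 0" by blast
    \<comment> \<open>Bring the pivot to row \<open>p\<close>; \<open>?T\<close> changes \<open>x\<^sub>p\<close> into the resulting form, and \<open>?B\<close> is its inverse.\<close>
    let ?s = "swap i0 p :: nat \<Rightarrow> 'a mpol"
    let ?d = "c(i0 := c p, p := c i0)"
    let ?l = "\<Sum>i = 1..n. Const (?d i) * Var i"
    have l: "subs ?s (\<sigma> p) = ?l"
    proof -
      have "subs ?s (\<sigma> p) = (\<Sum>i = 1..n. Const (c i) * ?s i)" by (simp add: c subs.hom_sum subs.hom_mult)
      also have "\<dots> = ?l"
        by (rule sum.reindex_bij_witness[of _ "id(i0 := p, p := i0)" "id(i0 := p, p := i0)"])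
           (use p i0 in \<open>auto split: if_splits\<close>)
      finally show ?thesis .
    qed
    let ?r = "\<Sum>i\<in>{1..n}-{p}. Const (?d i) * Var i"
    let ?T = "Var(p := ?l)"
    let ?b = "Const (inverse (?d p)) * (Var p - ?r)"
    let ?B = "Var(p := ?b)"
    have lr: "?l = Const (?d p) * Var p + ?r" by (rule split[OF p])
    have dp: "Const (inverse (?d p)) * Const (?d p) = 1" "Const (?d p) * Const (inverse (?d p)) = 1"
      using i0 by (simp_all flip: Const.hom_mult)
    have fixr: "subs (Var(p := z)) ?r = ?r" for z
      unfolding subs.hom_sum by (rule sum.cong) (auto simp: subs.hom_mult)
    have TB: "subs ?T ?b = Var p"
    proof -
      have "subs ?T ?b = Const (inverse (?d p)) * (?l - ?r)"
        by (simp add: subs.hom_mult subs.hom_minus fixr del: fun_upd_apply) simp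
      also have "\<dots> = (Const (inverse (?d p)) * Const (?d p)) * Var p" unfolding lr by simp
      finally show ?thesis using dp by simp
    qed
    have BT: "subs ?B ?l = Var p"
    proof -
      have "subs ?B ?l = Const (?d p) * ?b + ?r"
        unfolding lr by (simp add: subs.hom_mult subs.hom_add fixr del: fun_upd_apply) simp
      also have "\<dots> = (Const (?d p) * Const (inverse (?d p))) * (Var p - ?r) + ?r" by (simp only: mult.assoc)
      finally show ?thesis using dp by simp
    qed
    have linT: "lin ?T" and linB: "lin ?B" and lins: "lin ?s"
      using p i0 unfolding lin_def by (auto intro!: lin_forms_scale lin_forms_diff lin_forms_sum')
    let ?\<sigma> = "\<lambda>i. subs ?B (subs ?s (\<sigma> i))"
    let ?\<tau> = "\<lambda>i. subs \<tau> (subs ?s (?T i))"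
    have TBid: "subs ?T (subs ?B z) = z" if "z \<in> lin_forms n" for z
      unfolding subs_subs by (rule subs_ident[OF lin_forms_Sn[OF that]]) (use TB in auto)
    have ssid: "subs ?s (subs ?s z) = z" if "z \<in> lin_forms n" for z
      unfolding subs_subs by (rule subs_ident[OF lin_forms_Sn[OF that]]) auto
    have sLF: "\<sigma> i \<in> lin_forms n" "subs ?s (\<sigma> i) \<in> lin_forms n" "?\<sigma> i \<in> lin_forms n" if "1 \<le> i" "i \<le> n" for i
    proof -
      show 1: "\<sigma> i \<in> lin_forms n" using Suc.prems(1) that by (simp add: lin_def)
      then show 2: "subs ?s (\<sigma> i) \<in> lin_forms n" by (rule subs_lin_forms) (use lins in \<open>simp add: lin_def\<close>)
      then show "?\<sigma> i \<in> lin_forms n" by (rule subs_lin_forms) (use linB in \<open>simp add: lin_def\<close>)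
    qed
    have g\<sigma>: "good ?\<sigma>"
    proof (rule Suc.IH)
      show "lin ?\<sigma>" using sLF by (simp add: lin_def)
      show "lin ?\<tau>" unfolding lin_def
        using linT lins Suc.prems(2) unfolding lin_def by (blast intro: subs_lin_forms)
      show "k \<le> n" using Suc.prems by simp
      fix i :: nat assume i: "1 \<le> i"
      show "subs ?\<tau> (?\<sigma> i) = Var i" if "i \<le> n"
      proof -
        have "subs ?\<tau> (?\<sigma> i) = subs \<tau> (subs ?s (subs ?T (subs ?B (subs ?s (\<sigma> i)))))" by (simp add: subs_subs)
        then show ?thesis using TBid ssid sLF[OF i that] Suc.prems(3)[OF i that] by simp
      qed
      show "?\<sigma> i = Var i" if "i \<le> n - k"
      proof (cases "i = p")
        case True then show ?thesis using l BT by simp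
      next
        case False
        then have "i < p" using that by (simp add: p_def)
        then show ?thesis using low[of i] i i0 by simp
      qed
    qed
    have "good ?T" using gT[OF p, of ?d] i0 by simp
    from comp[OF this g\<sigma> linT] have gT\<sigma>: "good (\<lambda>i. subs ?T (?\<sigma> i))" .
    have "good ?s" using gsw i0 p by simp
    from comp[OF this gT\<sigma> lins] have "good (\<lambda>i. subs ?s (subs ?T (?\<sigma> i)))" .
    then show ?case
      by (rule cong) (use TBid ssid sLF in simp)
  qed
  obtain h where h: "h \<in> carrier_mat n n" "g \<in> carrier_mat n n" "h * g = 1\<^sub>m n" using GL_inverse[OF g] by metis
  have inv: "subs (image_form n h) (image_form n g i) = Var i" if "1 \<le> i" "i \<le> n" for i
    using image_form_mult[OF h(1,2) that] by (simp add: h(3) image_form_one that)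
  have "good (image_form n g)"
    by (rule main[of _ "image_form n h" n]) (use inv in \<open>auto simp: lin_def\<close>)
  then show ?thesis by (simp add: good_def lin_subst_subs)
qed

section \<open>Invariance modulo the ideal\<close>

definition invar :: "nat \<Rightarrow> nat \<Rightarrow> 'a::{field,finite} mpol \<Rightarrow> bool" where
  "invar m n u \<longleftrightarrow> (\<forall>g\<in>GL n. in_ideal m n (lin_subst n g u - u))"

lemma in_ideal_lin_subst: "in_ideal m n u \<Longrightarrow> in_ideal m n (lin_subst n g u)"
  unfolding lin_subst_subs by (rule in_ideal_subs) (auto intro: in_ideal_lin_forms)

lemma invar_if_in_ideal: "in_ideal m n u \<Longrightarrow> invar m n u"
  by (auto simp: invar_def intro: in_ideal_lin_subst)

lemma invar_add: assumes "invar m n u" "invar m n v" shows "invar m n (u + v)"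
  unfolding invar_def
proof
  fix g :: "'a mat" assume "g \<in> GL n"
  moreover have "lin_subst n g (u + v) - (u + v) = (lin_subst n g u - u) + (lin_subst n g v - v)"
    by (simp add: lin_subst_subs subs.hom_add)
  ultimately show "in_ideal m n (lin_subst n g (u + v) - (u + v))" using assms by (metis invar_def in_ideal_add)
qed

lemma invar_uminus: assumes "invar m n u" shows "invar m n (- u)"
  unfolding invar_def
proof
  fix g :: "'a mat" assume "g \<in> GL n"
  moreover have "lin_subst n g (- u) - (- u) = - (lin_subst n g u - u)"
    by (simp add: lin_subst_subs subs.hom_uminus)
  ultimately show "in_ideal m n (lin_subst n g (- u) - (- u))" using assms by (metis invar_def in_ideal_uminus)
qed

lemma invar_diff: "invar m n u \<Longrightarrow> invar m n v \<Longrightarrow> invar m n (u - v)"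
  using invar_add[OF _ invar_uminus, of m n u v] by simp

lemma invar_mult:
  assumes "invar m n u" "\<And>g. g \<in> GL n \<Longrightarrow> lin_subst n g r = r"
  shows "invar m n (r * u)"
  unfolding invar_def
proof
  fix g :: "'a mat" assume g: "g \<in> GL n"
  then have "lin_subst n g (r * u) - r * u = r * (lin_subst n g u - u)"
    using assms(2)[OF g] by (simp add: lin_subst_subs subs.hom_mult right_diff_distrib)
  then show "in_ideal m n (lin_subst n g (r * u) - r * u)" using assms(1) g by (auto simp: invar_def)
qed

lemma invar_Const: "invar m n u \<Longrightarrow> invar m n (Const c * u)"
  by (rule invar_mult) (simp_all add: lin_subst_subs)

lemma invar_mono: "invar b n u \<Longrightarrow> m \<le> b \<Longrightarrow> invar m n u"
  unfolding invar_def by (blast intro: in_ideal_mono)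

lemma invar_subst:
  assumes "invar m n u" "u \<in> Sn n" "\<And>i. 1 \<le> i \<Longrightarrow> i \<le> n \<Longrightarrow> \<sigma> i \<in> lin_forms n"
    "\<And>i. 1 \<le> i \<Longrightarrow> i \<le> n \<Longrightarrow> \<tau> i \<in> lin_forms n" "\<And>i. 1 \<le> i \<Longrightarrow> i \<le> n \<Longrightarrow> subs \<tau> (\<sigma> i) = Var i"
  shows "in_ideal m n (subs \<sigma> u - u)"
  using lin_subst_of_subst[OF assms(3-5)] assms(1,2) unfolding invar_def by metis

lemma invar_swap:
  assumes "invar m n u" "u \<in> Sn n" "1 \<le> i" "i \<le> n" "1 \<le> j" "j \<le> n"
  shows "in_ideal m n (subs (swap i j) u - u)"
  by (rule invar_subst[OF assms(1,2), of _ "swap i j"]) (use assms in auto)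

lemma invar_if_elementary:
  fixes u :: "'a::{field,finite} mpol"
  assumes "2 \<le> n" "u \<in> Sn n"
    "\<And>i j. 1 \<le> i \<Longrightarrow> i \<le> n \<Longrightarrow> 1 \<le> j \<Longrightarrow> j \<le> n \<Longrightarrow> i \<noteq> j \<Longrightarrow> in_ideal m n (subs (swap i j) u - u)"
    "\<And>c. c \<noteq> 0 \<Longrightarrow> in_ideal m n (subs (Var(1 := Const c * Var 1)) u - u)"
    "\<And>c. in_ideal m n (subs (Var(1 := Var 1 + Const c * Var 2)) u - u)"
  shows "invar m n u"
  unfolding invar_def
proof
  fix g :: "'a mat" assume g: "g \<in> GL n"
  have "lin_subst n g u - u \<in> {p. in_ideal m n p}"
    by (rule invariant_if_elementary[OF assms(1,2) _ _ _ _ _ _ g])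
       (use assms(3-) in \<open>auto intro: in_ideal_subs in_ideal_lin_forms\<close>)
  then show "in_ideal m n (lin_subst n g u - u)" by simp
qed

section \<open>Steenrod operations\<close>

definition total_steenrod :: "'a::{field,finite} mpol \<Rightarrow> 'a mpol poly" where
  "total_steenrod = msubst (\<lambda>c. [:Const c:]) (\<lambda>j. [:Var j, Var j ^ CARD('a):])"

lemma steenrod_total_steenrod: "steenrod i u = poly.coeff (total_steenrod u) i" by (simp add: steenrod_def total_steenrod_def)

interpretation total_steenrod: comm_ring_hom total_steenrod
  by unfold_locales
    (simp_all add: total_steenrod_def msubst_add[OF comm_ring_hom_pCons_Const] msubst_mult[OF comm_ring_hom_pCons_Const]
      msubst_1[OF comm_ring_hom_pCons_Const] msubst_0[OF comm_ring_hom_pCons_Const])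

lemma total_steenrod_Const [simp]: "total_steenrod (Const c) = [:Const c:]"
  by (simp add: total_steenrod_def msubst_Const[OF comm_ring_hom_pCons_Const])

lemma total_steenrod_Var [simp]: "total_steenrod (Var j :: 'a::{field,finite} mpol) = [:Var j, Var j ^ CARD('a):]"
  by (simp add: total_steenrod_def msubst_Var[OF comm_ring_hom_pCons_Const])

text \<open>The total operation commutes with a substitution as soon as it acts on the substituted
  polynomials as it does on variables, which holds for linear forms.\<close>

definition steenrod_linear :: "'a::{field,finite} mpol \<Rightarrow> bool" where
  "steenrod_linear p \<longleftrightarrow> total_steenrod p = [:p, p ^ CARD('a):]"

lemma steenrod_linear_Var [simp, intro]: "steenrod_linear (Var j)" by (simp add: steenrod_linear_def)
lemma steenrod_linear_0 [simp, intro]: "steenrod_linear 0" using card_field_ge2 by (simp add: steenrod_linear_def power_0_left)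
lemma steenrod_linear_add [intro]: "steenrod_linear p \<Longrightarrow> steenrod_linear r \<Longrightarrow> steenrod_linear (p + r)" by (simp add: steenrod_linear_def total_steenrod.hom_add mfrob1)
lemma steenrod_linear_scale [intro]: "steenrod_linear p \<Longrightarrow> steenrod_linear (Const c * p)"
  by (simp add: steenrod_linear_def total_steenrod.hom_mult power_mult_distrib Const_pow1)
lemma steenrod_linear_lin_forms: "p \<in> lin_forms n \<Longrightarrow> steenrod_linear p"
proof -
  have "steenrod_linear (\<Sum>i\<in>A. Const (c i) * Var i)" for A :: "nat set" and c
    by (induction A rule: infinite_finite_induct) (auto intro!: steenrod_linear_add steenrod_linear_scale)
  then show "p \<in> lin_forms n \<Longrightarrow> steenrod_linear p" by (auto simp: lin_forms_def)
qed

lemma map_poly_comm_ring_hom_subs: "comm_ring_hom (map_poly (subs \<sigma>))"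
  by unfold_locales
    (auto intro!: poly_eqI simp: coeff_map_poly coeff_mult subs.hom_add subs.hom_mult subs.hom_sum coeff_1)

lemma total_steenrod_subs: assumes "\<And>i. steenrod_linear (\<sigma> i)" shows "total_steenrod (subs \<sigma> u) = map_poly (subs \<sigma>) (total_steenrod u)"
proof -
  interpret mp: comm_ring_hom "map_poly (subs \<sigma>)" by (rule map_poly_comm_ring_hom_subs)
  have 1: "comm_ring_hom (\<lambda>u. total_steenrod (subs \<sigma> u))"
    by unfold_locales (simp_all add: subs.hom_add subs.hom_mult total_steenrod.hom_add total_steenrod.hom_mult)
  have 2: "comm_ring_hom (\<lambda>u. map_poly (subs \<sigma>) (total_steenrod u))"
    by unfold_locales (simp_all add: total_steenrod.hom_add total_steenrod.hom_mult mp.hom_add mp.hom_mult)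
  show ?thesis
    by (rule hom_ext[OF 1 2]) (use assms in \<open>simp_all add: steenrod_linear_def map_poly_pCons subs.hom_power\<close>)
qed

lemma steenrod_subs: assumes "\<And>i. steenrod_linear (\<sigma> i)" shows "steenrod k (subs \<sigma> u) = subs \<sigma> (steenrod k u)"
  unfolding steenrod_total_steenrod total_steenrod_subs[OF assms] by (simp add: coeff_map_poly)

lemma steenrod_lin_subst: "steenrod k (lin_subst n g u) = lin_subst n g (steenrod k u)"
  unfolding lin_subst_subs by (rule steenrod_subs) (auto intro: steenrod_linear_lin_forms)

lemma steenrod_diff: "steenrod k (u - v) = steenrod k u - steenrod k v"
  by (simp add: steenrod_total_steenrod total_steenrod.hom_minus)

lemma steenrod_Sn: assumes "u \<in> Sn n" shows "steenrod k u \<in> Sn n"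
proof -
  let ?\<pi> = "\<lambda>i. if 1 \<le> i \<and> i \<le> n then Var i else (0 :: 'a mpol)"
  have "subs ?\<pi> u = u" by (rule subs_ident[OF assms]) auto
  then have e: "steenrod k u = subs ?\<pi> (steenrod k u)" using steenrod_subs[of ?\<pi> k u] by simp
  have S: "subs ?\<pi> p \<in> Sn n" for p
    by (rule truncate_in_Sn)
  show ?thesis by (subst e) (rule S)
qed

lemma steenrod_power_Var:
  "\<exists>v. steenrod k ((Var i :: 'a::{field,finite} mpol) ^ N * p) = Var i ^ N * v"
proof -
  have e: "total_steenrod (Var i :: 'a mpol) = Polynomial.smult (Var i) [:1, Var i ^ (CARD('a) - 1):]"
    using card_field_ge2[where 'a='a] by (simp flip: power_Suc)
  have "total_steenrod (Var i ^ N * p) = total_steenrod (Var i) ^ N * total_steenrod p"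
    by (simp add: total_steenrod.hom_mult total_steenrod.hom_power del: total_steenrod_Var)
  also have "\<dots> = Polynomial.smult (Var i ^ N) ([:1, Var i ^ (CARD('a) - 1):] ^ N * total_steenrod p)"
    unfolding e by (simp add: smult_power del: smult_pCons)
  finally have "total_steenrod (Var i ^ N * p) = Polynomial.smult (Var i ^ N) ([:1, Var i ^ (CARD('a) - 1):] ^ N * total_steenrod p)" .
  then show ?thesis by (auto simp: steenrod_total_steenrod)
qed

lemma in_ideal_steenrod: "in_ideal m n u \<Longrightarrow> in_ideal m n (steenrod k u)"
proof (erule in_ideal_induct)
  fix i p assume i: "1 \<le> i" "i \<le> n"
  obtain v where "steenrod k ((Var i :: 'a mpol) ^ (CARD('a) ^ m) * p) = Var i ^ (CARD('a) ^ m) * v"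
    using steenrod_power_Var by blast
  then show "in_ideal m n (steenrod k ((Var i :: 'a mpol) ^ (CARD('a) ^ m) * p))" using in_ideal_Var[OF i] by auto
qed (auto simp: steenrod_add steenrod_total_steenrod total_steenrod.hom_add)

lemma invar_steenrod: "invar m n u \<Longrightarrow> invar m n (steenrod k u)"
  unfolding invar_def by (metis in_ideal_steenrod steenrod_diff steenrod_lin_subst)

lemma steenrod_Cartan': "steenrod i (f * g) = steenrod i f * g + (\<Sum>a<i. steenrod a f * steenrod (i - a) g)"
  by (simp add: steenrod_Cartan steenrod_0 lessThan_Suc_atMost[symmetric] add.commute)

section \<open>The form \<open>x y\<^sup>q - x\<^sup>q y\<close>\<close>

text \<open>Both sides are monic of degree \<open>q\<close> in \<open>Y\<close> and vanish at the \<open>q\<close> multiples of \<open>X\<close>.\<close>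

lemma prod_translates:
  fixes X Y :: "'a::{field,finite} mpol"
  shows "(\<Prod>c\<in>UNIV. Y - Const c * X) = Y ^ CARD('a) - X ^ (CARD('a) - 1) * Y"
proof (cases "X = 0")
  case True
  then show ?thesis using card_field_ge2[where 'a='a] by (simp add: power_0_left)
next
  case False
  let ?q = "CARD('a)"
  let ?p = "\<Prod>c\<in>UNIV. [:- Const c * X, 1:]"
  let ?r = "Polynomial.monom 1 ?q - Polynomial.smult (X ^ (?q - 1)) [:0, 1:]"
  have q: "2 \<le> ?q" by (rule card_field_ge2)
  have inj: "inj (\<lambda>c. Const c * X)"
  proof (rule injI)
    fix c d :: 'a assume "Const c * X = Const d * X"
    then have "Const c = (Const d :: 'a mpol)" using False by simp
    then show "c = d" by (metis Const_def lookup_single_eq)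
  qed
  have "?p = ?r"
  proof (rule poly_eqI_degree_lead_coeff[where n = ?q and A = "range (\<lambda>c. Const c * X)"])
    have "lead_coeff ?p = 1" by (simp add: lead_coeff_prod)
    moreover have deg: "degree ?p = ?q" by (subst degree_prod_eq_sum_degree) auto
    ultimately show "poly.coeff ?p ?q = poly.coeff ?r ?q" using q by (simp add: coeff_pCons split: nat.split)
    show "?q \<le> card (range (\<lambda>c. Const c * X))" using card_image[OF inj] by simp
    show "degree ?p \<le> ?q" using deg by simp
    show "degree ?r \<le> ?q"
      using q by (intro degree_diff_le) (auto simp: degree_monom_eq intro: order_trans[OF degree_smult_le])
    fix z assume "z \<in> range (\<lambda>c. Const c * X)"
    then obtain c where z: "z = Const c * X" by auto
    have "X * X ^ (?q - 1) = X ^ ?q" using q by (simp flip: power_Suc)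
    then have "poly ?r z = 0"
      unfolding z by (simp add: poly_monom power_mult_distrib Const_pow1 mult.left_commute)
    moreover have "poly ?p z = 0" unfolding z by (auto simp: poly_prod)
    ultimately show "poly ?p z = poly ?r z" by simp
  qed
  then have "poly ?p Y = poly ?r Y" by simp
  then show ?thesis by (simp add: poly_prod poly_monom)
qed

text \<open>The Moore determinant of two elements.\<close>

definition L2 :: "'a::{field,finite} mpol \<Rightarrow> 'a mpol \<Rightarrow> 'a mpol" where
  "L2 p r = p * r ^ CARD('a) - p ^ CARD('a) * r"

lemma L2_lin: "L2 (Const a * p + Const b * r) (Const c * p + Const d * r) = Const (a * d - b * c) * L2 p r"
  by (simp add: L2_def mfrob1 power_mult_distrib Const_pow1 Const.hom_minus Const.hom_mult algebra_simps)

lemma subs_L2: "subs \<sigma> (L2 p r) = L2 (subs \<sigma> p) (subs \<sigma> r)"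
  by (simp add: L2_def subs.hom_minus subs.hom_mult subs.hom_power)

lemma L2_0 [simp]: "L2 0 p = 0" "L2 p 0 = 0"
  using card_field_ge2[where 'a='a] by (simp_all add: L2_def power_0_left)
lemma L2_scale: "L2 p (Const c * p) = 0" using L2_lin[of 1 p 0 0 c 0] by simp

lemma L2_Sn: "p \<in> Sn n \<Longrightarrow> r \<in> Sn n \<Longrightarrow> L2 p r \<in> Sn n"
  by (simp add: L2_def Sn_diff Sn_mult Sn_power)

lemma L2_prod: "L2 p r = p * (\<Prod>c\<in>UNIV. r - Const c * p)"
proof -
  have e: "p ^ CARD('a) = p * p ^ (CARD('a) - 1)"
    using card_field_ge2[where 'a='a] by (simp flip: power_Suc)
  show ?thesis unfolding L2_def prod_translates right_diff_distrib
    by (simp add: mult.assoc[symmetric] e[symmetric])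
qed

lemma Var_nz [simp]: "Var i \<noteq> (0 :: 'a::{field,finite} mpol)"
  by (metis Var_def lookup_single_eq lookup_zero zero_neq_one)

lemma Const_eq_iff [simp]: "Const c = Const d \<longleftrightarrow> c = d"
  by (metis Const_def lookup_single_eq)

lemma Var_ne_Const_Var: "i \<noteq> j \<Longrightarrow> Var j \<noteq> Const c * (Var i :: 'a::{field,finite} mpol)"
proof
  assume "i \<noteq> j" "Var j = Const c * (Var i :: 'a mpol)"
  then have "subs (Var(i := 0)) (Var j) = subs (Var(i := 0)) (Const c * (Var i :: 'a mpol))" by simp
  then show False using \<open>i \<noteq> j\<close> by (simp add: subs.hom_mult)
qed

lemma L2_dvd:
  assumes "i \<noteq> j" "subs (Var(i := 0)) E = 0" "\<And>c. subs (Var(j := Const c * Var i)) E = 0"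
  shows "L2 (Var i) (Var j) dvd (E :: 'a::{field,finite} mpol)"
proof -
  let ?k = "\<lambda>c. case c of None \<Rightarrow> i | Some c \<Rightarrow> j"
  let ?r = "\<lambda>c. case c of None \<Rightarrow> 0 | Some c \<Rightarrow> Const c * Var i"
  have "(\<Prod>c\<in>insert None (Some ` (UNIV :: 'a set)). Var (?k c) - ?r c) dvd E"
  proof (rule prod_forms_dvd)
    fix c d :: "'a option"
    assume "c \<noteq> d"
    have "Const b * Var i \<noteq> Const a * (Var i :: 'a mpol)" if "a \<noteq> b" for a b using that by simp
    then show "subs (Var(?k c := ?r c)) (Var (?k d) - ?r d) \<noteq> 0"
      using assms(1) \<open>c \<noteq> d\<close> Var_ne_Const_Var[OF assms(1)]
      by (auto split: option.splits simp: subs.hom_minus subs.hom_mult)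
  qed (use assms in \<open>auto split: option.splits\<close>)
  moreover have "(\<Prod>c\<in>insert None (Some ` (UNIV :: 'a set)). Var (?k c) - ?r c) = L2 (Var i) (Var j)"
    by (simp add: L2_prod prod.reindex)
  ultimately show ?thesis by simp
qed

lemma L2_Var_nz: "i \<noteq> j \<Longrightarrow> L2 (Var i) (Var j) \<noteq> (0 :: 'a::{field,finite} mpol)"
  using Var_ne_Const_Var[of i j] by (auto simp: L2_prod)

text \<open>The form is the product of the lines through the rational points. Steenrod operations commute
  with the substitutions that cut out these lines, so they preserve vanishing on them.\<close>

lemma L2_dvd_steenrod:
  assumes "i \<noteq> j" shows "L2 (Var i) (Var j) dvd steenrod k (L2 (Var i) (Var j) :: 'a::{field,finite} mpol)"
proof (rule L2_dvd[OF assms])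
  show "subs (Var(i := 0)) (steenrod k (L2 (Var i) (Var j) :: 'a mpol)) = 0"
    using assms by (subst steenrod_subs[symmetric]) (auto simp: subs_L2 steenrod_total_steenrod)
  show "subs (Var(j := Const c * Var i)) (steenrod k (L2 (Var i) (Var j) :: 'a mpol)) = 0" for c
    using assms by (subst steenrod_subs[symmetric]) (auto simp: subs_L2 steenrod_total_steenrod L2_scale)
qed

section \<open>The invariants killed by the form\<close>

text \<open>The polynomials whose classes form the subspace for \<open>k = 1\<close>; see \<open>F_1\<close>.\<close>

definition B1 :: "nat \<Rightarrow> nat \<Rightarrow> 'a::{field,finite} mpol set" where
  "B1 m n = {u \<in> Sn n. invar m n u \<and> in_ideal m n (L2 (Var 1) (Var 2) * u)}"

lemma B1_add: "u \<in> B1 m n \<Longrightarrow> v \<in> B1 m n \<Longrightarrow> u + v \<in> B1 m n"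
  by (auto simp: B1_def distrib_left intro!: invar_add)
lemma B1_mult:
  assumes "u \<in> B1 m n" "r \<in> Sn n" "\<And>g. g \<in> GL n \<Longrightarrow> lin_subst n g r = r"
  shows "r * u \<in> B1 m n"
proof -
  have "in_ideal m n (r * (L2 (Var 1) (Var 2) * u))" using assms(1) by (auto simp: B1_def)
  then have "in_ideal m n (L2 (Var 1) (Var 2) * (r * u))" by (simp only: mult.left_commute)
  then show ?thesis using assms unfolding B1_def by (auto intro!: invar_mult Sn_mult)
qed
lemma B1_Const: "u \<in> B1 m n \<Longrightarrow> Const c * u \<in> B1 m n"
  by (rule B1_mult) (auto simp: lin_subst_subs)
lemma B1_in_ideal: "u \<in> Sn n \<Longrightarrow> in_ideal m n u \<Longrightarrow> u \<in> B1 m n"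
  by (auto simp: B1_def intro: invar_if_in_ideal)
lemma B1_0: "0 \<in> B1 m n" by (rule B1_in_ideal) auto
lemma B1_sum: "(\<And>i. i \<in> A \<Longrightarrow> f i \<in> B1 m n) \<Longrightarrow> sum f A \<in> B1 m n"
  by (induction A rule: infinite_finite_induct) (auto simp: B1_0 B1_add)
lemma B1_diff: "u \<in> B1 m n \<Longrightarrow> v \<in> B1 m n \<Longrightarrow> u - v \<in> B1 m n"
  using B1_add[OF _ B1_Const[of v m n "-1"], of u] by (simp add: Const.hom_uminus)

text \<open>Invariance moves the pair of variables \<open>1, 2\<close> to any other pair.\<close>

lemma B1_pair:
  assumes u: "(u :: 'a::{field,finite} mpol) \<in> B1 m n" and n: "2 \<le> n"
    and ij: "1 \<le> i" "i \<le> n" "1 \<le> j" "j \<le> n" "i \<noteq> j"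
  shows "in_ideal m n (L2 (Var i) (Var j) * u)"
proof -
  have step: "in_ideal m n (subs (swap a b) l * u)" if "in_ideal m n (l * u)" "1 \<le> a" "a \<le> n" "1 \<le> b" "b \<le> n" for a b l
  proof -
    have 1: "in_ideal m n (subs (swap a b) (l * u))"
      by (rule in_ideal_subs[OF that(1)]) (use that in \<open>auto intro!: in_ideal_lin_forms\<close>)
    have 2: "in_ideal m n (subs (swap a b) l * (subs (swap a b) u - u))"
      using u that by (intro in_ideal_mult2 invar_swap) (auto simp: B1_def)
    have "subs (swap a b) l * u = subs (swap a b) (l * u) - subs (swap a b) l * (subs (swap a b) u - u)"
      by (simp add: subs.hom_mult algebra_simps)
    then show ?thesis using in_ideal_diff[OF 1 2] by simp
  qed
  define k where "k = (if i = 2 then 1 else 2 :: nat)"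
  have 0: "in_ideal m n (L2 (Var 1) (Var 2) * u)" using u by (simp add: B1_def)
  have 1: "in_ideal m n (L2 (Var i) (Var k) * u)"
  proof (cases "i = 1")
    case True then show ?thesis using 0 by (simp add: k_def)
  next
    case False
    then show ?thesis using step[OF 0, of 1 i] ij n by (cases "i = 2") (simp_all add: subs_L2 k_def)
  qed
  show ?thesis
  proof (cases "j = k")
    case True then show ?thesis using 1 by simp
  next
    case False
    have "i \<noteq> k" "1 \<le> k" "k \<le> n" using n by (auto simp: k_def)
    then show ?thesis using step[OF 1, of k j] ij False by (simp add: subs_L2)
  qed
qed

text \<open>By the Cartan formula \<open>L \<P>\<^sup>k(u)\<close> differs from \<open>\<P>\<^sup>k(L u)\<close> by terms \<open>\<P>\<^sup>a(u) \<P>\<^sup>k\<^sup>-\<^sup>a(L)\<close> with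
  \<open>a < k\<close>, and \<open>L\<close> divides the second factor, so induction applies.\<close>

lemma B1_steenrod:
  assumes u: "u \<in> B1 m n" shows "steenrod k u \<in> B1 m n"
proof -
  let ?L = "L2 (Var 1) (Var 2) :: 'a mpol"
  have "in_ideal m n (?L * steenrod k u)"
  proof (induction k rule: less_induct)
    case (less k)
    have "steenrod k (u * ?L) = steenrod k u * ?L + (\<Sum>a<k. steenrod a u * steenrod (k - a) ?L)"
      by (rule steenrod_Cartan')
    then have e: "?L * steenrod k u = steenrod k (?L * u) - (\<Sum>a<k. steenrod a u * steenrod (k - a) ?L)"
      by (simp add: mult.commute)
    have "in_ideal m n (steenrod a u * steenrod (k - a) ?L)" if "a < k" for a
    proof -
      obtain v where "steenrod (k - a) ?L = ?L * v" using L2_dvd_steenrod[of 1 2 "k - a"] by (auto elim: dvdE)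
      then have e': "steenrod a u * steenrod (k - a) ?L = v * (?L * steenrod a u)" by (simp only: mult_ac)
      show ?thesis unfolding e' by (rule in_ideal_mult2[OF less[OF that]])
    qed
    then show ?case unfolding e using u by (auto simp: B1_def intro!: in_ideal_diff in_ideal_sum in_ideal_steenrod)
  qed
  then show ?thesis using u by (auto simp: B1_def intro: steenrod_Sn invar_steenrod)
qed

section \<open>Homogeneous parts of products of truncated geometric series\<close>

text \<open>The \<open>q\<close>-analogue of \<open>m\<close>.\<close>

definition qnum :: "nat \<Rightarrow> nat \<Rightarrow> nat" where "qnum q m = (\<Sum>i<m. q ^ i)"

lemma qnum_eq: "1 \<le> q \<Longrightarrow> (q - 1) * qnum q m = q ^ m - 1"
proof (induction m)
  case (Suc m)
  then have "(q - 1) * qnum q (Suc m) = q ^ m - 1 + (q - 1) * q ^ m" by (simp add: qnum_def distrib_left)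
  also have "\<dots> = q ^ Suc m - 1" using Suc.prems by (simp add: diff_mult_distrib)
  finally show ?case .
qed (simp add: qnum_def)

lemma qnum_Suc: "qnum q (Suc m) = qnum q m + q ^ m" by (simp add: qnum_def)
lemma qnum_Suc2: "qnum q (Suc m) = 1 + q * qnum q m"
  unfolding qnum_def sum.lessThan_Suc_shift by (simp add: sum_distrib_left)
lemma qnum_mono: "a \<le> b \<Longrightarrow> qnum q a \<le> qnum q b"
  unfolding qnum_def by (rule sum_mono2) auto
lemma qnum_0 [simp]: "qnum q 0 = 0" by (simp add: qnum_def)

text \<open>The polynomial \<open>(t\<^sup>M - z\<^sup>M) / (t - z)\<close> in \<open>t\<close>.\<close>

definition trunc_geom :: "nat \<Rightarrow> 'a::{field,finite} mpol \<Rightarrow> 'a mpol poly" where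
  "trunc_geom M z = (\<Sum>j<M. [:z:] ^ (M - Suc j) * [:0, 1:] ^ j)"

lemma trunc_geom_eq: "([:0, 1:] - [:z:]) * trunc_geom M z = [:0, 1:] ^ M - [:z:] ^ M"
proof (cases M)
  case (Suc k)
  show ?thesis unfolding trunc_geom_def Suc diff_power_eq_sum by (simp add: mult.commute)
qed (simp add: trunc_geom_def)

lemma coeff_trunc_geom: "poly.coeff (trunc_geom M z) l = (if l < M then z ^ (M - Suc l) else 0)"
proof -
  have "[:z:] ^ a * [:0, 1:] ^ j = Polynomial.monom (z ^ a) j" for a j
    by (simp add: poly_const_pow monom_altdef)
  then show ?thesis unfolding trunc_geom_def coeff_sum by simp
qed

text \<open>The coefficient is taken at \<open>t\<close> to the power \<open>M - 1 - e\<close> so that for a single variable it is the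
  \<open>e\<close>-th power of \<open>x\<^sub>1\<^sup>q\<^sup>-\<^sup>1\<close>.\<close>

definition Phi :: "nat \<Rightarrow> nat set \<Rightarrow> nat \<Rightarrow> 'a::{field,finite} mpol" where
  "Phi m I e = poly.coeff (\<Prod>i\<in>I. trunc_geom (qnum (CARD('a)) m) (Var i ^ (CARD('a) - 1))) (qnum (CARD('a)) m - Suc e)"

lemma map_poly_trunc_geom: "map_poly (subs \<sigma>) (trunc_geom M z) = trunc_geom M (subs \<sigma> z)"
  by (rule poly_eqI) (simp add: coeff_map_poly coeff_trunc_geom subs.hom_power)

lemma map_poly_subs_prod: "map_poly (subs \<sigma>) (\<Prod>i\<in>I. f i) = (\<Prod>i\<in>I. map_poly (subs \<sigma>) (f i))"
proof -
  interpret mp: comm_ring_hom "map_poly (subs \<sigma>)" by (rule map_poly_comm_ring_hom_subs)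
  show ?thesis by (rule mp.hom_prod)
qed

lemma subs_Phi: "subs \<sigma> (Phi m I e :: 'a::{field,finite} mpol)
  = poly.coeff (\<Prod>i\<in>I. trunc_geom (qnum (CARD('a)) m) (\<sigma> i ^ (CARD('a) - 1))) (qnum (CARD('a)) m - Suc e)"
proof -
  have "subs \<sigma> (Phi m I e :: 'a mpol) = poly.coeff (map_poly (subs \<sigma>)
      (\<Prod>i\<in>I. trunc_geom (qnum (CARD('a)) m) (Var i ^ (CARD('a) - 1)))) (qnum (CARD('a)) m - Suc e)"
    by (simp add: Phi_def coeff_map_poly)
  then show ?thesis by (simp add: map_poly_subs_prod map_poly_trunc_geom subs.hom_power)
qed

lemma subs_Phi_perm:
  assumes "inj_on \<pi> I" "\<And>i. i \<in> I \<Longrightarrow> \<sigma> i = Var (\<pi> i)"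
  shows "subs \<sigma> (Phi m I e) = Phi m (\<pi> ` I) e"
  unfolding subs_Phi unfolding Phi_def prod.reindex[OF assms(1)] using assms(2) by simp

lemma Phi_Sn: assumes "I \<subseteq> {1..n}" shows "Phi m I e \<in> Sn n"
proof -
  let ?\<pi> = "\<lambda>i. if 1 \<le> i \<and> i \<le> n then Var i else (0 :: 'a mpol)"
  have "subs ?\<pi> (Phi m I e) = Phi m (id ` I) e"
    by (rule subs_Phi_perm) (use assms in auto)
  then have e: "Phi m I e = subs ?\<pi> (Phi m I e)" by simp
  have S: "subs ?\<pi> p \<in> Sn n" for p
    by (rule truncate_in_Sn)
  show ?thesis by (subst e) (rule S)
qed

text \<open>With \<open>a\<^sub>i = x\<^sub>i\<^sup>q\<^sup>-\<^sup>1\<close> and \<open>g\<^sub>i\<close> the factor of index \<open>i\<close>, multiply by \<open>a\<^sub>j - a\<^sub>i = (t - a\<^sub>i) - (t - a\<^sub>j)\<close> and use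
  \<open>(t - a\<^sub>i) g\<^sub>i = t\<^sup>M - a\<^sub>i\<^sup>M\<close>; the terms with \<open>t\<^sup>M\<close> do not contribute to the coefficient taken. This is
  also the recursion that the delta operator satisfies.\<close>

lemma Phi_recursion:
  assumes I: "finite I" "i \<in> I" "j \<in> I" "i \<noteq> j" and m: "1 \<le> m"
  shows "L2 (Var i) (Var j) * Phi m I e
    = Var j ^ (CARD('a) ^ m) * (Var i * Phi m (I - {j}) e)
    - Var i ^ (CARD('a) ^ m) * (Var j * (Phi m (I - {i}) e :: 'a::{field,finite} mpol))"
proof -
  let ?q = "CARD('a)" let ?M = "qnum ?q m"
  define a where "a i = (Var i :: 'a mpol) ^ (?q - 1)" for i
  define g where "g i = trunc_geom ?M (a i)" for i
  have q: "2 \<le> ?q" by (rule card_field_ge2)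
  have M: "?M > 0" using m by (cases m) (simp_all add: qnum_Suc2)
  define R where "R = (\<Prod>l\<in>I - {i} - {j}. g l)"
  have PI: "(\<Prod>l\<in>I. g l) = g i * g j * R"
    using I by (simp add: R_def prod.remove[of I i] prod.remove[of "I - {i}" j] mult.assoc)
  have Pi: "(\<Prod>l\<in>I - {i}. g l) = g j * R"
    using I by (simp add: R_def prod.remove[of "I - {i}" j])
  have "I - {j} - {i} = I - {i} - {j}" by auto
  then have Pj: "(\<Prod>l\<in>I - {j}. g l) = g i * R"
    using I by (simp add: R_def prod.remove[of "I - {j}" i])
  let ?t = "[:0, 1:] :: 'a mpol poly"
  have "([:a j:] - [:a i:]) * (g i * g j * R)
      = ((?t - [:a i:]) * g i) * (g j * R) - ((?t - [:a j:]) * g j) * (g i * R)"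
    by (simp add: algebra_simps del: mult_pCons_left mult_pCons_right diff_pCons)
  also have "\<dots> = ?t ^ ?M * ((g j - g i) * R) + [:a j:] ^ ?M * (g i * R) - [:a i:] ^ ?M * (g j * R)"
    unfolding g_def trunc_geom_eq by (simp add: algebra_simps)
  finally have E: "Polynomial.smult (a j - a i) (g i * g j * R)
      = ?t ^ ?M * ((g j - g i) * R) + Polynomial.smult (a j ^ ?M) (g i * R) - Polynomial.smult (a i ^ ?M) (g j * R)"
    by (simp add: poly_const_pow)
  \<comment> \<open>The coefficient taken lies below \<open>t\<^sup>M\<close>.\<close>
  have low: "poly.coeff (?t ^ ?M * p) (?M - Suc e) = 0" for p
  proof -
    have "?t ^ ?M = Polynomial.monom 1 ?M" by (simp add: monom_altdef)
    then show ?thesis using M by (simp add: coeff_monom_mult)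
  qed
  have A: "(a j - a i) * Phi m I e = a j ^ ?M * Phi m (I - {j}) e - a i ^ ?M * Phi m (I - {i}) e"
    using arg_cong[OF E, of "\<lambda>p. poly.coeff p (?M - Suc e)"]
    unfolding Phi_def a_def[symmetric] g_def[symmetric] PI Pi Pj by (simp add: low)
  have B: "L2 (Var i) (Var j) = Var i * Var j * (a j - a i)"
    using q by (simp add: L2_def a_def algebra_simps flip: power_Suc power_Suc2)
  have C: "Var l * a l ^ ?M = Var l ^ (?q ^ m)" for l
  proof -
    have "(?q - 1) * ?M = ?q ^ m - 1" using qnum_eq[of ?q m] q by simp
    then show ?thesis using q by (simp add: a_def flip: power_mult power_Suc)
  qed
  have "L2 (Var i) (Var j) * Phi m I e = Var i * Var j * ((a j - a i) * Phi m I e)"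
    by (simp only: B mult.assoc)
  also have "\<dots> = (Var j * a j ^ ?M) * (Var i * Phi m (I - {j}) e) - (Var i * a i ^ ?M) * (Var j * Phi m (I - {i}) e)"
    unfolding A by (simp add: algebra_simps)
  finally show ?thesis by (simp only: C)
qed

lemma Phi_cong: "(\<And>i. i \<in> I \<Longrightarrow> \<sigma> i = \<tau> i) \<Longrightarrow> subs \<sigma> (Phi m I e) = subs \<tau> (Phi m I e)"
  by (simp add: subs_Phi cong: prod.cong)

lemma Phi_fix: "(\<And>i. i \<in> I \<Longrightarrow> \<sigma> i = Var i) \<Longrightarrow> subs \<sigma> (Phi m I e) = Phi m I e"
  using Phi_cong[of I \<sigma> Var] by (simp add: subs_id)

text \<open>Every exponent of \<open>x\<^sub>i\<close> is divisible by \<open>q - 1\<close>, and \<open>c\<^sup>q\<^sup>-\<^sup>1 = 1\<close> for nonzero \<open>c\<close>. The factor \<open>x\<^sub>i\<close>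
  makes the identity hold for \<open>c = 0\<close> as well.\<close>

lemma Phi_homogeneous:
  assumes "i \<in> I"
  shows "subs (Var(i := Const c * p)) (Var i * Phi m I e) = Const c * (subs (Var(i := p)) (Var i * Phi m I e) :: 'a::{field,finite} mpol)"
proof (cases "c = 0")
  case False
  have "(Const c * p) ^ (CARD('a) - 1) = p ^ (CARD('a) - 1)"
    by (simp add: power_mult_distrib pow_card_minus_1[OF False] flip: Const.hom_power)
  then have "subs (Var(i := Const c * p)) (Phi m I e) = subs (Var(i := p)) (Phi m I e)"
    unfolding subs_Phi by (intro arg_cong2[where f = poly.coeff] prod.cong) auto
  then show ?thesis by (simp add: subs.hom_mult mult.assoc)
qed (simp add: subs.hom_mult)

text \<open>By the recursion \<open>L \<cdot> Phi\<close> is a combination of \<open>h\<^sub>1\<close> and \<open>h\<^sub>2\<close>. On each rational line of the plane of \<open>x\<^sub>1, x\<^sub>2\<close> both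
  restrict to the same homogeneous function, so \<open>E\<close>, the change of \<open>h\<^sub>1\<close> minus \<open>c h\<^sub>2\<close>, vanishes on these
  lines and is divisible by \<open>L\<close>. The change of \<open>L \<cdot> Phi\<close> is \<open>x\<^sub>2\<close> to the power \<open>q\<^sup>m\<close> times \<open>E\<close>; cancel \<open>L\<close>.\<close>

lemma Phi_transvection:
  assumes n: "2 \<le> n" and m: "1 \<le> m"
  shows "in_ideal m n (subs (Var(1 := Var 1 + Const c * Var 2)) (Phi m {1..n} e) - (Phi m {1..n} e :: 'a::{field,finite} mpol))"
proof -
  let ?I = "{1..n}" let ?Q = "CARD('a) ^ m"
  let ?\<tau> = "Var(1 := Var 1 + Const c * Var 2) :: nat \<Rightarrow> 'a mpol"
  define h1 :: "'a mpol" where "h1 = Var 1 * Phi m (?I - {2}) e"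
  define h2 :: "'a mpol" where "h2 = Var 2 * Phi m (?I - {1}) e"
  let ?P = "Phi m ?I e :: 'a mpol" let ?L = "L2 (Var 1) (Var 2) :: 'a mpol"
  have rec: "?L * ?P = Var 2 ^ ?Q * h1 - Var 1 ^ ?Q * h2"
    unfolding h1_def h2_def using n m by (intro Phi_recursion) auto
  have h12: "subs (Var(1 := Var 2)) h1 = h2"
  proof -
    have "subs (Var(1 := Var 2)) (Phi m (?I - {2}) e :: 'a mpol) = Phi m (id(1 := 2) ` (?I - {2})) e"
      by (rule subs_Phi_perm) (auto simp: inj_on_def)
    moreover have "id(1 := 2) ` (?I - {2}) = ?I - {1}" using n by (auto simp: image_iff)
    ultimately show ?thesis by (simp add: h1_def h2_def subs.hom_mult)
  qed
  have h21: "subs (Var(2 := Var 1)) h2 = h1"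
  proof -
    have "subs (Var(2 := Var 1)) (Phi m (?I - {1}) e :: 'a mpol) = Phi m (id(2 := 1) ` (?I - {1})) e"
      by (rule subs_Phi_perm) (auto simp: inj_on_def)
    moreover have "id(2 := 1) ` (?I - {1}) = ?I - {2}" using n by (auto simp: image_iff)
    ultimately show ?thesis by (simp add: h1_def h2_def subs.hom_mult)
  qed
  have h2_fix: "subs \<sigma> h2 = h2" if "\<And>i. i \<noteq> 1 \<Longrightarrow> \<sigma> i = Var i" for \<sigma>
    unfolding h2_def subs.hom_mult using that by (subst Phi_fix) auto
  have h1_cong: "subs \<sigma> h1 = subs \<sigma>' h1" if "\<And>i. i \<noteq> 2 \<Longrightarrow> \<sigma> i = \<sigma>' i" for \<sigma> \<sigma>'
    unfolding h1_def subs.hom_mult using that Phi_cong[of "?I - {2}" \<sigma> \<sigma>'] by simp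
  have h1_hom: "subs (Var(1 := Const d * p)) h1 = Const d * subs (Var(1 := p)) h1" for d p
    unfolding h1_def using n by (intro Phi_homogeneous) auto
  have h2_hom: "subs (Var(2 := Const d * p)) h2 = Const d * subs (Var(2 := p)) h2" for d p
    unfolding h2_def using n by (intro Phi_homogeneous) auto
  define E where "E = subs ?\<tau> h1 - h1 - Const c * h2"
  have "?L dvd E"
  proof (rule L2_dvd)
    show "(1::nat) \<noteq> 2" by simp
    have "subs (Var(1 := 0)) (subs ?\<tau> h1) = subs (Var(1 := Const c * Var 2)) h1"
      unfolding subs_subs by (rule h1_cong) (simp add: subs.hom_add subs.hom_mult)
    moreover have "subs (Var(1 := 0)) h1 = 0" by (simp add: h1_def subs.hom_mult)
    moreover have "subs (Var(1 := 0)) h2 = h2" by (rule h2_fix) simp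
    ultimately show "subs (Var(1 := 0)) E = 0"
      by (simp only: E_def subs.hom_minus subs.hom_mult subs_Const h1_hom h12) simp
    fix d
    have "subs (Var(2 := Const d * Var 1)) (subs ?\<tau> h1) = subs (Var(1 := Const (1 + c * d) * Var 1)) h1"
      unfolding subs_subs by (rule h1_cong) (auto simp: subs.hom_add subs.hom_mult Const.hom_add Const.hom_mult algebra_simps)
    also have "\<dots> = Const (1 + c * d) * h1"
      unfolding h1_hom using h1_cong[of "Var(1 := Var 1)" Var] by (simp add: subs_id)
    finally have 1: "subs (Var(2 := Const d * Var 1)) (subs ?\<tau> h1) = Const (1 + c * d) * h1" .
    have 2: "subs (Var(2 := Const d * Var 1)) h1 = h1"
      using h1_cong[of "Var(2 := Const d * Var 1)" Var] by (simp add: subs_id)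
    show "subs (Var(2 := Const d * Var 1)) E = 0"
      by (simp only: E_def subs.hom_minus subs.hom_mult subs_Const 1 2 h2_hom h21)
         (simp add: Const.hom_add Const.hom_mult algebra_simps)
  qed
  then obtain v where v: "E = ?L * v" by (auto elim: dvdE)
  have "subs ?\<tau> ?L = ?L"
    using L2_lin[of 1 "Var 1" c "Var 2" 0 1] by (simp add: subs_L2)
  then have "?L * subs ?\<tau> ?P = subs ?\<tau> (?L * ?P)" by (simp add: subs.hom_mult)
  also have "\<dots> = Var 2 ^ ?Q * subs ?\<tau> h1 - (Var 1 ^ ?Q + Const c * Var 2 ^ ?Q) * h2"
    unfolding rec subs.hom_minus subs.hom_mult subs.hom_power using h2_fix[of ?\<tau>]
    by (simp add: mfrob mfrob_Const)
  finally have "?L * (subs ?\<tau> ?P - ?P) = Var 2 ^ ?Q * E"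
    unfolding right_diff_distrib rec E_def by (simp add: algebra_simps)
  then have "?L * (subs ?\<tau> ?P - ?P) = ?L * (Var 2 ^ ?Q * v)" by (simp add: v mult.left_commute)
  then have "subs ?\<tau> ?P - ?P = Var 2 ^ ?Q * v"
    using mult_left_cancel[OF L2_Var_nz[of 1 2]] by auto
  then show ?thesis using n by (simp only:) (intro in_ideal_mult in_ideal_Var, auto)
qed

lemma Phi_B1:
  assumes n: "2 \<le> n" and m: "1 \<le> m"
  shows "Phi m {1..n} e \<in> (B1 m n :: 'a::{field,finite} mpol set)"
proof -
  have S: "Phi m {1..n} e \<in> Sn n" by (rule Phi_Sn) simp
  have "invar m n (Phi m {1..n} e :: 'a mpol)"
  proof (rule invar_if_elementary[OF n S])
    fix i j :: nat assume ij: "1 \<le> i" "i \<le> n" "1 \<le> j" "j \<le> n" "i \<noteq> j"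
    have "subs (swap i j) (Phi m {1..n} e :: 'a mpol) = Phi m (id(i := j, j := i) ` {1..n}) e"
      by (rule subs_Phi_perm) (use ij in \<open>auto simp: inj_on_def\<close>)
    moreover have "id(i := j, j := i) ` {1..n} = {1..n}" using ij by (auto simp: image_iff)
    ultimately show "in_ideal m n (subs (swap i j) (Phi m {1..n} e :: 'a mpol) - Phi m {1..n} e)" by simp
  next
    fix c :: 'a assume c: "c \<noteq> 0"
    have "subs (Var(1 := Const c * Var 1)) (Phi m {1..n} e :: 'a mpol) = subs Var (Phi m {1..n} e)"
      unfolding subs_Phi
      by (intro arg_cong2[where f = poly.coeff] prod.cong)
         (auto simp: power_mult_distrib pow_card_minus_1[OF c] simp flip: Const.hom_power)
    then show "in_ideal m n (subs (Var(1 := Const c * Var 1)) (Phi m {1..n} e :: 'a mpol) - Phi m {1..n} e)"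
      by (simp add: subs_id)
  qed (rule Phi_transvection[OF n m])
  moreover have "in_ideal m n (L2 (Var 1) (Var 2) * (Phi m {1..n} e :: 'a mpol))"
    using n m by (subst Phi_recursion) (auto intro!: in_ideal_diff in_ideal_mult in_ideal_Var)
  ultimately show ?thesis using S by (simp add: B1_def)
qed

definition Top :: "nat \<Rightarrow> nat \<Rightarrow> 'a::{field,finite} mpol" where
  "Top m n = (\<Prod>i = 1..n. Var i ^ (CARD('a) ^ m - 1))"

lemma Top_B1:
  assumes n: "2 \<le> n"
  shows "Top m n \<in> (B1 m n :: 'a::{field,finite} mpol set)"
proof -
  let ?Q = "CARD('a) ^ m" let ?N = "?Q - 1"
  let ?T = "Top m n :: 'a mpol"
  have Q: "?Q > 0" using card_field_ge2[where 'a='a] by simp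
  have up: "z ^ ?N * z = z ^ ?Q" for z :: "'a mpol" using Q by (simp flip: power_Suc2)
  define R :: "'a mpol" where "R = (\<Prod>i\<in>{1..n} - {1} - {2}. Var i ^ ?N)"
  have T: "?T = Var 1 ^ ?N * (Var 2 ^ ?N * R)"
    unfolding Top_def R_def using n by (subst prod.remove[of _ 1], simp, simp, subst prod.remove[of _ 2]) auto
  have S: "?T \<in> Sn n" unfolding Top_def by (intro Sn_prod Sn_power Sn_Var) auto
  have "invar m n ?T"
  proof (rule invar_if_elementary[OF n S])
    fix i j :: nat assume ij: "1 \<le> i" "i \<le> n" "1 \<le> j" "j \<le> n" "i \<noteq> j"
    have "subs (swap i j) ?T = ?T"
      unfolding Top_def subs.hom_prod subs.hom_power subs_Var
      by (rule prod.reindex_bij_witness[of _ "id(i := j, j := i)" "id(i := j, j := i)"]) (use ij in auto)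
    then show "in_ideal m n (subs (swap i j) ?T - ?T)" by simp
  next
    fix c :: 'a assume c: "c \<noteq> 0"
    have "c * c ^ ?N = c * 1" using pow_card_pow[of c m] Q by (simp flip: power_Suc)
    then have "c ^ ?N = 1" using c by simp
    then have "subs (Var(1 := Const c * Var 1)) ?T = ?T"
      unfolding Top_def subs.hom_prod subs.hom_power subs_Var
      by (intro prod.cong) (auto simp: power_mult_distrib simp flip: Const.hom_power)
    then show "in_ideal m n (subs (Var(1 := Const c * Var 1)) ?T - ?T)" by simp
  next
    fix c :: 'a
    let ?\<tau> = "Var(1 := Var 1 + Const c * Var 2) :: nat \<Rightarrow> 'a mpol"
    have "subs ?\<tau> R = R" unfolding R_def subs.hom_prod by (rule prod.cong) (auto simp: subs.hom_power)
    then have "subs ?\<tau> ?T - ?T = ((Var 1 + Const c * Var 2) ^ ?N - Var 1 ^ ?N) * (Var 2 ^ ?N * R)"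
      unfolding T by (simp add: subs.hom_mult subs.hom_power left_diff_distrib)
    also have "(Var 1 + Const c * Var 2) ^ ?N - Var 1 ^ ?N = (Const c * Var 2) * (\<Sum>i<?N. Var 1 ^ (?N - Suc i) * (Var 1 + Const c * Var 2) ^ i)"
      by (subst power_diff_sumr2) simp
    finally have "subs ?\<tau> ?T - ?T = (Var 2 ^ ?N * Var 2) * (Const c * (\<Sum>i<?N. Var 1 ^ (?N - Suc i) * (Var 1 + Const c * Var 2) ^ i) * R)"
      by (simp add: mult_ac del: fun_upd_apply)
    then show "in_ideal m n (subs ?\<tau> ?T - ?T)" unfolding up using n by (simp only:) (intro in_ideal_mult in_ideal_Var, auto)
  qed
  moreover have "L2 (Var 1) (Var 2) * ?T = (Var 1 ^ ?N * Var 1) * ((Var 2 ^ CARD('a) - Var 1 ^ (CARD('a) - 1) * Var 2) * (Var 2 ^ ?N * R))"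
  proof -
    have "Var 1 ^ CARD('a) = Var 1 * (Var 1 :: 'a mpol) ^ (CARD('a) - 1)"
      using card_field_ge2[where 'a='a] by (simp flip: power_Suc)
    then have "L2 (Var 1) (Var 2) = Var 1 * (Var 2 ^ CARD('a) - (Var 1 :: 'a mpol) ^ (CARD('a) - 1) * Var 2)"
      by (simp add: L2_def algebra_simps)
    then show ?thesis unfolding T by (simp add: mult_ac)
  qed
  then have "in_ideal m n (L2 (Var 1) (Var 2) * ?T)" unfolding up using n by (simp only:) (intro in_ideal_mult in_ideal_Var, auto)
  ultimately show ?thesis using S by (simp add: B1_def)
qed

section \<open>Coefficients of the invariants\<close>

lemma lookup_Const_mult: "Poly_Mapping.lookup (Const c * u) t = c * Poly_Mapping.lookup u t"
proof (induction u rule: poly_mapping_single_induct)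
  case (single s d) then show ?case by (simp add: Const_def mult_single lookup_single when_def)
next
  case (sum f g) then show ?case by (simp add: distrib_left lookup_add)
qed

lemma lookup_single_mult:
  "Poly_Mapping.lookup (Poly_Mapping.single s c * u) (s + t) = c * Poly_Mapping.lookup (u :: 'a::comm_ring_1 mpol) t"
proof (induction u rule: poly_mapping_single_induct)
  case (single s d) then show ?case by (simp add: mult_single lookup_single when_def)
next
  case (sum f g) then show ?case by (simp add: distrib_left lookup_add)
qed

lemma lookup_single_mult_0:
  assumes "\<And>t. g \<noteq> s + t"
  shows "Poly_Mapping.lookup (Poly_Mapping.single s c * (u :: 'a::comm_ring_1 mpol)) g = 0"
proof (rule ccontr)
  assume "\<not> ?thesis"
  then have "g \<in> Poly_Mapping.keys (Poly_Mapping.single s c * u)" by (simp add: in_keys_iff)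
  then obtain a b where "g = a + b" "a \<in> Poly_Mapping.keys (Poly_Mapping.single s c)"
    using keys_mult[of "Poly_Mapping.single s c" u] by blast
  then show False using assms by (auto split: if_splits)
qed

lemma subs_single: "subs \<sigma> (Poly_Mapping.single t c) = Const c * monom_eval \<sigma> t"
  by (simp add: subs_def msubst_single[OF comm_ring_hom_Const])

lemma monom_eval_upd:
  "monom_eval (Var(i := p)) t = p ^ Poly_Mapping.lookup t i
    * Poly_Mapping.single (t - Poly_Mapping.single i (Poly_Mapping.lookup t i)) (1 :: 'a::comm_ring_1)"
proof -
  let ?k = "Poly_Mapping.lookup t i"
  let ?s = "t - Poly_Mapping.single i ?k"
  have t: "t = Poly_Mapping.single i ?k + ?s"
    by (rule poly_mapping_eqI) (auto simp: lookup_add lookup_minus lookup_single when_def)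
  have "monom_eval (Var(i := p)) t = monom_eval (Var(i := p)) (Poly_Mapping.single i ?k) * monom_eval (Var(i := p)) ?s"
    by (subst t) (rule monom_eval_add)
  moreover have "monom_eval (Var(i := p)) ?s = monom_eval Var ?s"
    unfolding monom_eval_def
    by (rule prod.cong) (auto simp: in_keys_iff lookup_minus lookup_single)
  moreover have "monom_eval Var ?s = (Poly_Mapping.single ?s 1 :: 'a mpol)"
    using subs_single[of Var ?s "1 :: 'a"] by (simp add: subs_id)
  ultimately show ?thesis by simp
qed

lemma lookup_scale:
  "Poly_Mapping.lookup (subs (Var(i := Const c * Var i)) u) t
    = c ^ Poly_Mapping.lookup t i * Poly_Mapping.lookup (u :: 'a::comm_ring_1 mpol) t"
proof (induction u rule: poly_mapping_single_induct)
  case (single s d)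
  let ?k = "Poly_Mapping.lookup s i"
  have s: "Poly_Mapping.single i ?k + (s - Poly_Mapping.single i ?k) = s"
    by (rule poly_mapping_eqI) (auto simp: lookup_add lookup_minus lookup_single when_def)
  have "subs (Var(i := Const c * Var i)) (Poly_Mapping.single s d)
      = Const (c ^ ?k * d) * (Var i ^ ?k * Poly_Mapping.single (s - Poly_Mapping.single i ?k) 1)"
    by (simp add: subs_single monom_eval_upd power_mult_distrib Const.hom_mult Const.hom_power mult_ac)
  also have "\<dots> = Poly_Mapping.single s (c ^ ?k * d)"
    by (simp add: Var_power mult_single s Const_def)
  finally show ?case by (simp add: lookup_single when_def del: fun_upd_apply)
next
  case (sum f g) then show ?case by (simp add: subs.hom_add lookup_add distrib_left)
qed

text \<open>The remainder of \<open>k\<close> modulo \<open>q - 1\<close> has the same property, but a nonzero polynomial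
  \<open>X\<^sup>r - 1\<close> with \<open>r < q - 1\<close> has fewer than \<open>q - 1\<close> roots.\<close>

lemma card_minus_1_dvd:
  assumes "\<And>c :: 'a::{field,finite}. c \<noteq> 0 \<Longrightarrow> c ^ k = 1"
  shows "(CARD('a) - 1) dvd k"
proof -
  let ?q = "CARD('a)" let ?r = "k mod (?q - 1)"
  have q: "2 \<le> ?q" by (rule card_field_ge2)
  have r: "c ^ ?r = 1" if "c \<noteq> 0" for c :: 'a
  proof -
    have "c ^ k = (c ^ (?q - 1)) ^ (k div (?q - 1)) * c ^ ?r"
      by (simp flip: power_mult power_add)
    then show ?thesis using assms[OF that] pow_card_minus_1[OF that] by simp
  qed
  have "?r = 0"
  proof (rule ccontr)
    assume nz: "?r \<noteq> 0"
    let ?p = "Polynomial.monom 1 ?r - 1 :: 'a poly"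
    have "poly.coeff ?p ?r = 1" using nz by (simp add: coeff_1)
    then have p: "?p \<noteq> 0" by (metis coeff_0 zero_neq_one)
    have "card (UNIV - {0 :: 'a}) \<le> card {x. poly ?p x = 0}"
      using r by (intro card_mono poly_roots_finite[OF p]) (auto simp: poly_monom)
    also have "\<dots> \<le> degree ?p" by (rule card_poly_roots_bound[OF p])
    also have "\<dots> \<le> ?r" by (rule degree_diff_le) (auto simp: degree_monom_eq)
    also have "\<dots> < ?q - 1" using q by simp
    finally show False by (simp add: card_Diff_singleton)
  qed
  then show ?thesis by (simp add: dvd_eq_mod_eq_0)
qed

lemma of_nat_card_pow: "1 \<le> m \<Longrightarrow> of_nat (CARD('a) ^ m - 1) = (- 1 :: 'a::{field,finite})"
proof -
  assume m: "1 \<le> m"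
  have "of_nat (CARD('a) choose 1) = (0 :: 'a)"
    by (rule binom_card_eq_0) (use card_field_ge2[where 'a='a] in auto)
  then have "of_nat CARD('a) = (0 :: 'a)" by (simp only: choose_one)
  then have "of_nat (CARD('a) ^ m) = (0 :: 'a)" using m by (simp add: power_0_left)
  then show ?thesis using card_field_ge2[where 'a='a] by (simp add: of_nat_diff)
qed

text \<open>Extracting a coefficient after \<open>x\<^sub>i \<mapsto> x\<^sub>i + x\<^sub>j\<close> from the monomials of degree at most \<open>N\<close>
  in \<open>x\<^sub>i\<close>, at exponent \<open>N - 1\<close> of \<open>x\<^sub>i\<close>: only two monomials contribute.\<close>

lemma lookup_transvection_monomial:
  fixes t a :: "nat \<Rightarrow>\<^sub>0 nat"
  assumes ij: "i \<noteq> j" and N: "1 \<le> N" and a: "Poly_Mapping.lookup a i = N" and t: "Poly_Mapping.lookup t i \<le> N"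
  defines "b \<equiv> a - Poly_Mapping.single i 1 + Poly_Mapping.single j 1"
  shows "Poly_Mapping.lookup (subs (Var(i := Var i + Var j)) (Poly_Mapping.single t (d :: 'a::comm_ring_1))) b
    = (if t = b then d else if t = a then of_nat N * d else 0)"
proof -
  let ?k = "Poly_Mapping.lookup t i"
  let ?s = "t - Poly_Mapping.single i ?k"
  let ?r = "\<lambda>l. Poly_Mapping.single i l + Poly_Mapping.single j (?k - l) + ?s"
  have bi: "Poly_Mapping.lookup b i = N - 1"
    using ij a by (simp add: b_def lookup_add lookup_minus lookup_single when_def)
  have bN: "b + Poly_Mapping.single i 1 = a + Poly_Mapping.single j 1"
    using a N by (intro poly_mapping_eqI) (auto simp: b_def lookup_add lookup_minus lookup_single when_def)
  have rk: "?r ?k = t"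
    by (rule poly_mapping_eqI) (auto simp: lookup_add lookup_minus lookup_single when_def)
  have "(Var i + Var j) ^ ?k * Poly_Mapping.single ?s (1 :: 'a)
      = (\<Sum>l\<le>?k. Poly_Mapping.single (?r l) (of_nat (?k choose l)))"
    unfolding binomial_ring sum_distrib_right
  proof (rule sum.cong)
    fix l
    have e: "(of_nat (?k choose l) :: 'a mpol) = Const (of_nat (?k choose l))" by (simp add: Const.hom_of_nat)
    show "of_nat (?k choose l) * Var i ^ l * Var j ^ (?k - l) * Poly_Mapping.single ?s (1 :: 'a)
        = Poly_Mapping.single (?r l) (of_nat (?k choose l))"
      unfolding e Const_def Var_power mult_single by simp
  qed simp
  then have L: "Poly_Mapping.lookup (subs (Var(i := Var i + Var j)) (Poly_Mapping.single t d)) b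
      = d * (\<Sum>l\<le>?k. if ?r l = b then of_nat (?k choose l) else 0)"
    by (simp add: subs_single monom_eval_upd lookup_Const_mult lookup_sum lookup_single when_def)
  have ri: "l = N - 1" if "?r l = b" for l
    using arg_cong[OF that, of "\<lambda>x. Poly_Mapping.lookup x i"] ij bi
    by (simp add: lookup_add lookup_minus lookup_single when_def)
  have ta: "t \<noteq> a \<or> ?k = N" using a by auto
  have ab: "a \<noteq> b" using a bi N by auto
  consider "?k < N - 1" | "?k = N - 1" | "?k = N" using t by linarith
  then show ?thesis
  proof cases
    case 1
    then have "?r l \<noteq> b" if "l \<le> ?k" for l using ri[of l] that by auto
    moreover have "t \<noteq> b" "t \<noteq> a" using 1 bi a by auto
    ultimately show ?thesis unfolding L by simp
  next
    case 2
    have "(\<Sum>l\<le>?k. if ?r l = b then of_nat (?k choose l) else (0::'a)) = (\<Sum>l\<le>?k. if l = ?k then (if t = b then 1 else 0) else 0)"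
    proof (rule sum.cong)
      fix l show "(if ?r l = b then of_nat (?k choose l) else (0::'a)) = (if l = ?k then (if t = b then 1 else 0) else 0)"
      proof (cases "l = ?k")
        case True then show ?thesis using rk by simp
      next
        case False then have "?r l \<noteq> b" using ri[of l] 2 by metis
        then show ?thesis using False by (simp only: if_False)
      qed
    qed simp
    moreover have "t \<noteq> a" using 2 a N by auto
    ultimately show ?thesis unfolding L by simp
  next
    case 3
    have rN: "?r (N - 1) = b \<longleftrightarrow> t = a"
    proof -
      have "?r (N - 1) + Poly_Mapping.single i 1 = t + Poly_Mapping.single j 1"
        using 3 N ij by (intro poly_mapping_eqI) (auto simp: lookup_add lookup_minus lookup_single when_def)
      then show ?thesis using bN by (metis add_right_cancel)
    qed
    have "(\<Sum>l\<le>?k. if ?r l = b then of_nat (?k choose l) else (0::'a))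
        = (\<Sum>l\<le>?k. if l = N - 1 then (if t = a then of_nat (N choose (N - 1)) else 0) else 0)"
    proof (rule sum.cong)
      fix l show "(if ?r l = b then of_nat (?k choose l) else (0::'a))
          = (if l = N - 1 then (if t = a then of_nat (N choose (N - 1)) else 0) else 0)"
      proof (cases "l = N - 1")
        case True then show ?thesis using rN 3 a by simp
      next
        case False then have "?r l \<noteq> b" using ri[of l] by metis
        then show ?thesis using False by (simp only: if_False)
      qed
    qed simp
    also have "\<dots> = (if t = a then of_nat N else 0)"
      using 3 N binomial_symmetric[of 1 N] by (simp add: choose_one)
    finally show ?thesis unfolding L using 3 bi ab N by (auto simp: mult.commute)
  qed
qed

lemma lookup_in_ideal:
  assumes "in_ideal m n (w :: 'a::{field,finite} mpol)" "\<And>i. 1 \<le> i \<Longrightarrow> i \<le> n \<Longrightarrow> Poly_Mapping.lookup t i < CARD('a) ^ m"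
  shows "Poly_Mapping.lookup w t = 0"
proof (rule ccontr)
  assume "\<not> ?thesis"
  then have "t \<in> Poly_Mapping.keys w" by (simp add: in_keys_iff)
  then show False using assms unfolding in_ideal_def by (metis atLeastAtMost_iff not_le)
qed

lemma reduced_representative:
  fixes u :: "'a::{field,finite} mpol"
  assumes "u \<in> Sn n"
  obtains v where "v \<in> Sn n" "in_ideal m n (u - v)"
    "\<And>t. Poly_Mapping.lookup v t = (if \<exists>i\<in>{1..n}. CARD('a) ^ m \<le> Poly_Mapping.lookup t i then 0 else Poly_Mapping.lookup u t)"
proof -
  let ?bad = "\<lambda>t. \<exists>i\<in>{1..n}. CARD('a) ^ m \<le> Poly_Mapping.lookup t i"
  let ?A = "{t \<in> Poly_Mapping.keys u. \<not> ?bad t}"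
  define v where "v = (\<Sum>t\<in>?A. Poly_Mapping.single t (Poly_Mapping.lookup u t))"
  have L: "Poly_Mapping.lookup v t = (if ?bad t then 0 else Poly_Mapping.lookup u t)" for t
  proof -
    have "Poly_Mapping.lookup v t = (\<Sum>s\<in>?A. if t = s then Poly_Mapping.lookup u s else 0)"
      unfolding v_def lookup_sum by (rule sum.cong) (auto simp: lookup_single when_def)
    also have "\<dots> = (if t \<in> ?A then Poly_Mapping.lookup u t else 0)"
      by (rule sum.delta') simp
    finally show ?thesis by (auto simp: in_keys_iff)
  qed
  have "Poly_Mapping.keys v \<subseteq> Poly_Mapping.keys u" by (auto simp: in_keys_iff L split: if_splits)
  then have "v \<in> Sn n" using assms unfolding Sn_iff by blast
  moreover have "in_ideal m n (u - v)"
    unfolding in_ideal_def by (auto simp: in_keys_iff lookup_minus L split: if_splits)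
  ultimately show ?thesis using that L by blast
qed

context
  fixes m n :: nat and v :: "'a::{field,finite} mpol"
  assumes n: "2 \<le> n" and m: "1 \<le> m" and v: "v \<in> B1 m n"
    and red0: "\<forall>t\<in>Poly_Mapping.keys v. \<forall>i\<in>{1..n}. Poly_Mapping.lookup t i < CARD('a) ^ m"
begin

lemma red: "t \<in> Poly_Mapping.keys v \<Longrightarrow> 1 \<le> i \<Longrightarrow> i \<le> n \<Longrightarrow> Poly_Mapping.lookup t i < CARD('a) ^ m"
  using red0 by simp

lemma vSn: "v \<in> Sn n" and viv: "invar m n v" using v by (auto simp: B1_def)

text \<open>Scaling \<open>x\<^sub>i\<close> by \<open>c\<close> multiplies the coefficient of \<open>t\<close> by a power of \<open>c\<close>; on monomials
  outside the ideal invariance is equality of coefficients.\<close>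

lemma exponent_dvd:
  assumes t: "t \<in> Poly_Mapping.keys v" and i: "1 \<le> i" "i \<le> n"
  shows "(CARD('a) - 1) dvd Poly_Mapping.lookup t i"
proof (rule card_minus_1_dvd)
  fix c :: 'a assume c: "c \<noteq> 0"
  have "Const c * Const (inverse c) = (1 :: 'a mpol)" "Const (inverse c) * Const c = (1 :: 'a mpol)"
    using c by (simp_all flip: Const.hom_mult)
  then have "in_ideal m n (subs (Var(i := Const c * Var i)) v - v)"
    by (intro invar_subst[OF viv vSn, of _ "Var(i := Const (inverse c) * Var i)"])
       (use i in \<open>auto simp: subs.hom_mult intro!: lin_forms_scale\<close>)
  then have "Poly_Mapping.lookup (subs (Var(i := Const c * Var i)) v - v) t = 0"
    by (rule lookup_in_ideal) (rule red[OF t])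
  then have "c ^ Poly_Mapping.lookup t i * Poly_Mapping.lookup v t = Poly_Mapping.lookup v t"
    by (simp add: lookup_minus lookup_scale del: fun_upd_apply)
  then show "c ^ Poly_Mapping.lookup t i = 1" using t by (simp add: in_keys_iff)
qed

text \<open>The coefficient of \<open>x\<^sub>i\<^sup>N\<^sup>-\<^sup>1 x\<^sub>j\<^sup>b\<^sup>+\<^sup>1\<close> after \<open>x\<^sub>i \<mapsto> x\<^sub>i + x\<^sub>j\<close> detects the coefficient of
  \<open>x\<^sub>i\<^sup>N x\<^sub>j\<^sup>b\<close> for \<open>N = q\<^sup>m - 1\<close>, because \<open>N = -1\<close> in the field.\<close>

lemma exponent_max_all:
  assumes a: "a \<in> Poly_Mapping.keys v" and i: "1 \<le> i" "i \<le> n" and j: "1 \<le> j" "j \<le> n"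
    and ai: "Poly_Mapping.lookup a i = CARD('a) ^ m - 1"
  shows "Poly_Mapping.lookup a j = CARD('a) ^ m - 1"
proof (rule ccontr)
  let ?Q = "CARD('a) ^ m" let ?N = "?Q - 1"
  assume aj: "Poly_Mapping.lookup a j \<noteq> ?N"
  then have ij: "i \<noteq> j" using ai by auto
  have "CARD('a) ^ 1 \<le> ?Q" using m card_field_ge2[where 'a='a] by (intro power_increasing) auto
  then have N: "1 \<le> ?N" using card_field_ge2[where 'a='a] by simp
  define b where "b = a - Poly_Mapping.single i 1 + Poly_Mapping.single j 1"
  let ?\<sigma> = "Var(i := Var i + Var j) :: nat \<Rightarrow> 'a mpol"
  have "in_ideal m n (subs ?\<sigma> v - v)"
    by (rule invar_subst[OF viv vSn, of _ "Var(i := Var i - Var j)"])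
       (use i j ij in \<open>auto simp: subs.hom_add intro!: lin_forms_add lin_forms_diff lin_forms_Var\<close>)
  moreover have "Poly_Mapping.lookup b l < ?Q" if "1 \<le> l" "l \<le> n" for l
    using red[OF a that] aj red[OF a j]
    by (auto simp: b_def lookup_add lookup_minus lookup_single when_def)
  ultimately have "Poly_Mapping.lookup (subs ?\<sigma> v - v) b = 0" by (rule lookup_in_ideal)
  moreover have "Poly_Mapping.lookup (subs ?\<sigma> v) b = Poly_Mapping.lookup v b + of_nat ?N * Poly_Mapping.lookup v a"
  proof -
    have ab: "a \<noteq> b"
    proof
      assume "a = b"
      from arg_cong[OF this, of "\<lambda>x. Poly_Mapping.lookup x i"] show False
        using ai N ij by (simp add: b_def lookup_add lookup_minus lookup_single when_def)
    qed
    have "subs ?\<sigma> v = (\<Sum>t\<in>Poly_Mapping.keys v. subs ?\<sigma> (Poly_Mapping.single t (Poly_Mapping.lookup v t)))"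
      using arg_cong[OF poly_mapping_eq_sum_single[of v], of "subs ?\<sigma>"] by (simp only: subs.hom_sum)
    then have "Poly_Mapping.lookup (subs ?\<sigma> v) b = (\<Sum>t\<in>Poly_Mapping.keys v.
        if t = b then Poly_Mapping.lookup v t else if t = a then of_nat ?N * Poly_Mapping.lookup v t else 0)"
      unfolding b_def
      by (simp only: lookup_sum)
         (intro sum.cong lookup_transvection_monomial[OF ij N ai] refl, use red[OF _ i] in fastforce)
    also have "\<dots> = (\<Sum>t\<in>Poly_Mapping.keys v. (if t = b then Poly_Mapping.lookup v t else 0)
        + (if t = a then of_nat ?N * Poly_Mapping.lookup v t else 0))"
      by (rule sum.cong) (use ab in auto)
    also have "\<dots> = Poly_Mapping.lookup v b + of_nat ?N * Poly_Mapping.lookup v a"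
      using a by (simp add: sum.distrib in_keys_iff)
    finally show ?thesis .
  qed
  ultimately have "(of_nat ?N :: 'a) * Poly_Mapping.lookup v a = 0" by (simp add: lookup_minus del: fun_upd_apply)
  then show False using a by (simp add: of_nat_card_pow[OF m] in_keys_iff)
qed

text \<open>Comparing coefficients in \<open>(x\<^sub>1 x\<^sub>j\<^sup>q - x\<^sub>1\<^sup>q x\<^sub>j) v \<in> I\<close>: the weight \<open>q - 1\<close> can be moved from \<open>x\<^sub>1\<close> to \<open>x\<^sub>j\<close>.\<close>

lemma coefficient_shift:
  fixes t :: "nat \<Rightarrow>\<^sub>0 nat"
  assumes j: "2 \<le> j" "j \<le> n" and t: "\<forall>i\<in>{1..n}. Poly_Mapping.lookup t i < CARD('a) ^ m - 1"
    and tj: "Poly_Mapping.lookup t j + CARD('a) < CARD('a) ^ m"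
  shows "Poly_Mapping.lookup t 1 = 0 \<Longrightarrow> Poly_Mapping.lookup v t = 0"
    and "CARD('a) - 1 \<le> Poly_Mapping.lookup t 1 \<Longrightarrow> Poly_Mapping.lookup v t
      = Poly_Mapping.lookup v (t - Poly_Mapping.single 1 (CARD('a) - 1) + Poly_Mapping.single j (CARD('a) - 1))"
proof -
  let ?q = "CARD('a)"
  have q: "2 \<le> ?q" by (rule card_field_ge2)
  define s1 where "s1 = Poly_Mapping.single 1 1 + Poly_Mapping.single j ?q"
  define s2 where "s2 = Poly_Mapping.single 1 ?q + Poly_Mapping.single j 1"
  have L: "L2 (Var 1) (Var j) = Poly_Mapping.single s1 1 - (Poly_Mapping.single s2 1 :: 'a mpol)"
    unfolding L2_def Var_power s1_def s2_def by (simp add: Var_def mult_single)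
  have "in_ideal m n (L2 (Var 1) (Var j) * v)" by (rule B1_pair[OF v n]) (use n j in auto)
  moreover have "Poly_Mapping.lookup (s1 + t) i < ?q ^ m" if "1 \<le> i" "i \<le> n" for i
    using bspec[OF t, of i] that tj j by (auto simp: s1_def lookup_add lookup_single when_def)
  ultimately have "Poly_Mapping.lookup (L2 (Var 1) (Var j) * v) (s1 + t) = 0" by (rule lookup_in_ideal)
  then have E: "Poly_Mapping.lookup v t = Poly_Mapping.lookup (Poly_Mapping.single s2 1 * v) (s1 + t)"
    by (simp add: L left_diff_distrib lookup_minus lookup_single_mult)
  show "Poly_Mapping.lookup v t = 0" if "Poly_Mapping.lookup t 1 = 0"
    unfolding E
  proof (rule lookup_single_mult_0, rule notI)
    fix t' assume "s1 + t = s2 + t'"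
    from arg_cong[OF this, of "\<lambda>x. Poly_Mapping.lookup x 1"] show False
      using that j q by (simp add: s1_def s2_def lookup_add lookup_single when_def)
  qed
  show "Poly_Mapping.lookup v t = Poly_Mapping.lookup v (t - Poly_Mapping.single 1 (?q - 1) + Poly_Mapping.single j (?q - 1))"
    if "?q - 1 \<le> Poly_Mapping.lookup t 1"
  proof -
    have "s1 + t = s2 + (t - Poly_Mapping.single 1 (?q - 1) + Poly_Mapping.single j (?q - 1))"
      using that j q
      by (intro poly_mapping_eqI) (auto simp: s1_def s2_def lookup_add lookup_minus lookup_single when_def)
    then show ?thesis unfolding E by (simp add: lookup_single_mult)
  qed
qed

end

text \<open>The exponents at which the coefficients of an element of \<open>B1\<close> are read off; together with
  the top exponent they determine the element.\<close>

definition canonical_exponent :: "nat \<Rightarrow> nat set \<Rightarrow> nat \<Rightarrow> nat \<Rightarrow> nat \<Rightarrow>\<^sub>0 nat" where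
  "canonical_exponent q J M e = Poly_Mapping.single 1 ((q - 1) * e) + (\<Sum>i\<in>J. Poly_Mapping.single i ((q - 1) * (M - 1)))"

lemma lookup_canonical_exponent:
  "finite J \<Longrightarrow> 1 \<notin> J \<Longrightarrow> Poly_Mapping.lookup (canonical_exponent q J M e) i
    = (if i = 1 then (q - 1) * e else if i \<in> J then (q - 1) * (M - 1) else 0)"
  by (auto simp: canonical_exponent_def lookup_add lookup_sum lookup_single when_def)

definition top_exponent :: "nat \<Rightarrow> nat \<Rightarrow> nat \<Rightarrow>\<^sub>0 nat" where
  "top_exponent n N = (\<Sum>i = 1..n. Poly_Mapping.single i N)"

lemma lookup_top_exponent: "Poly_Mapping.lookup (top_exponent n N) i = (if 1 \<le> i \<and> i \<le> n then N else 0)"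
  by (auto simp: top_exponent_def lookup_sum lookup_single when_def)

lemma N_eq: "CARD('a::{field,finite}) ^ m - 1 = (CARD('a) - 1) * qnum (CARD('a)) m"
  using qnum_eq[of "CARD('a)" m] card_field_ge2[where 'a='a] by simp

lemma qnum_pos: "1 \<le> m \<Longrightarrow> 0 < qnum q m" by (cases m) (simp_all add: qnum_Suc2)

text \<open>Moving weight from \<open>x\<^sub>1\<close> to the other variables ends at a canonical exponent, or
  at an exponent without \<open>x\<^sub>1\<close>, whose coefficient vanishes. Exponents with an entry \<open>q\<^sup>m - 1\<close> are
  excluded beforehand, as all their entries must be maximal.\<close>

lemma B1_reduced_zero:
  fixes v :: "'a::{field,finite} mpol"
  assumes n: "2 \<le> n" and m: "1 \<le> m" and v: "v \<in> B1 m n"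
    and red0: "\<forall>t\<in>Poly_Mapping.keys v. \<forall>i\<in>{1..n}. Poly_Mapping.lookup t i < CARD('a) ^ m"
    and can0: "\<And>e. e < qnum (CARD('a)) m \<Longrightarrow> Poly_Mapping.lookup v (canonical_exponent (CARD('a)) {2..n} (qnum (CARD('a)) m) e) = 0"
    and top0: "Poly_Mapping.lookup v (top_exponent n (CARD('a) ^ m - 1)) = 0"
  shows "v = 0"
proof (rule ccontr)
  assume "v \<noteq> 0"
  let ?q = "CARD('a)" let ?M = "qnum ?q m" let ?N = "?q ^ m - 1"
  have q: "2 \<le> ?q" by (rule card_field_ge2)
  have M: "0 < ?M" by (rule qnum_pos[OF m])
  have N: "?N = (?q - 1) * ?M" by (rule N_eq)
  have Q: "?q ^ m = ?N + 1" using q by simp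
  note red = red[OF n m v red0] and dv = exponent_dvd[OF n m v red0] and mx = exponent_max_all[OF n m v red0]
  have out: "Poly_Mapping.lookup t i = 0" if "t \<in> Poly_Mapping.keys v" "\<not> (1 \<le> i \<and> i \<le> n)" for t i
  proof -
    have "v \<in> Sn n" using v by (simp add: B1_def)
    then have "Poly_Mapping.keys t \<subseteq> {1..n}" using that(1) by (simp add: Sn_iff)
    then show ?thesis using that(2) by (metis atLeastAtMost_iff in_keys_iff subsetD)
  qed
  have small: "\<exists>d<?M. Poly_Mapping.lookup t i = (?q - 1) * d" if t: "t \<in> Poly_Mapping.keys v" and i: "1 \<le> i" "i \<le> n" for t i
  proof -
    have "Poly_Mapping.lookup t i \<noteq> ?N"
    proof
      assume ti: "Poly_Mapping.lookup t i = ?N"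
      have "t = top_exponent n ?N"
        by (rule poly_mapping_eqI) (use mx[OF t i _ _ ti] out[OF t] in \<open>auto simp: lookup_top_exponent\<close>)
      then show False using top0 t by (simp add: in_keys_iff)
    qed
    moreover obtain d where d: "Poly_Mapping.lookup t i = (?q - 1) * d" using dv[OF t i] by (auto elim: dvdE)
    ultimately have "(?q - 1) * d < (?q - 1) * ?M" using red[OF t i] Q N by linarith
    then show ?thesis using d q by auto
  qed
  \<comment> \<open>The measure is the weight still missing in the variables other than \<open>x\<^sub>1\<close>.\<close>
  have "t \<notin> Poly_Mapping.keys v" for t
  proof (induction "\<Sum>j = 2..n. (?q - 1) * (?M - 1) - Poly_Mapping.lookup t j" arbitrary: t rule: less_induct)
    case less
    show ?case
    proof
      assume t: "t \<in> Poly_Mapping.keys v"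
      have bd: "Poly_Mapping.lookup t i \<le> (?q - 1) * (?M - 1)" if "1 \<le> i" "i \<le> n" for i
        using small[OF t that] by auto
      have "(?q - 1) * (?M - 1) + (?q - 1) = (?q - 1) * Suc (?M - 1)" by simp
      also have "Suc (?M - 1) = ?M" using M by simp
      finally have MN: "(?q - 1) * (?M - 1) + (?q - 1) = ?N" by (simp only: N)
      obtain e where e: "e < ?M" "Poly_Mapping.lookup t 1 = (?q - 1) * e" using small[OF t, of 1] n by auto
      show False
      proof (cases "\<forall>j. 2 \<le> j \<and> j \<le> n \<longrightarrow> Poly_Mapping.lookup t j = (?q - 1) * (?M - 1)")
        case True
        have "t = canonical_exponent ?q {2..n} ?M e"
        proof (rule poly_mapping_eqI)
          fix i
          show "Poly_Mapping.lookup t i = Poly_Mapping.lookup (canonical_exponent ?q {2..n} ?M e) i"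
            using True e out[OF t, of i] by (cases "i = 1") (auto simp: lookup_canonical_exponent)
        qed
        then show False using can0[OF e(1)] t by (simp add: in_keys_iff)
      next
        case False
        then obtain j where j: "2 \<le> j" "j \<le> n" "Poly_Mapping.lookup t j \<noteq> (?q - 1) * (?M - 1)" by blast
        obtain d where d: "d < ?M" "Poly_Mapping.lookup t j = (?q - 1) * d" using small[OF t, of j] j by auto
        then have "d \<noteq> ?M - 1" using j by auto
        then have dM: "d + 1 \<le> ?M - 1" using d by linarith
        have "(?q - 1) * d + (?q - 1) = (?q - 1) * (d + 1)" by (simp add: distrib_left)
        also have "\<dots> \<le> (?q - 1) * (?M - 1)" using dM by (rule mult_le_mono2)
        finally have tj: "Poly_Mapping.lookup t j + (?q - 1) \<le> (?q - 1) * (?M - 1)" using d by simp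
        have lt: "\<forall>i\<in>{1..n}. Poly_Mapping.lookup t i < ?N"
        proof
          fix i assume "i \<in> {1..n}"
          then show "Poly_Mapping.lookup t i < ?N" using bd[of i] MN q by simp
        qed
        have tjq: "Poly_Mapping.lookup t j + ?q < ?q ^ m" using tj MN q Q by linarith
        note shift = coefficient_shift[OF n m v red0 j(1,2) lt tjq]
        show False
        proof (cases "e = 0")
          case True
          then show False using shift(1) e t by (simp add: in_keys_iff)
        next
          case False
          then have e1: "?q - 1 \<le> Poly_Mapping.lookup t 1" using e by simp
          let ?t = "t - Poly_Mapping.single 1 (?q - 1) + Poly_Mapping.single j (?q - 1)"
          have "?t \<in> Poly_Mapping.keys v" using shift(2)[OF e1] t by (simp add: in_keys_iff)
          moreover have "?t \<notin> Poly_Mapping.keys v"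
          proof (rule less.hyps, rule sum_strict_mono_ex1)
            show "\<forall>i\<in>{2..n}. (?q - 1) * (?M - 1) - Poly_Mapping.lookup ?t i \<le> (?q - 1) * (?M - 1) - Poly_Mapping.lookup t i"
              by (auto simp: lookup_add lookup_minus lookup_single when_def)
            show "\<exists>i\<in>{2..n}. (?q - 1) * (?M - 1) - Poly_Mapping.lookup ?t i < (?q - 1) * (?M - 1) - Poly_Mapping.lookup t i"
            proof (rule bexI[of _ j])
              have "Poly_Mapping.lookup ?t j = Poly_Mapping.lookup t j + (?q - 1)"
                using j by (simp add: lookup_add lookup_minus lookup_single when_def)
              then show "(?q - 1) * (?M - 1) - Poly_Mapping.lookup ?t j < (?q - 1) * (?M - 1) - Poly_Mapping.lookup t j"
                using tj q by linarith
            qed (use j in simp)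
          qed simp
          ultimately show False by blast
        qed
      qed
    qed
  qed
  then have "Poly_Mapping.keys v = {}" by blast
  then show False using \<open>v \<noteq> 0\<close> by simp
qed

lemma keys_Phi:
  assumes "t \<in> Poly_Mapping.keys (Phi m I e :: 'a::{field,finite} mpol)" "j \<notin> I"
  shows "Poly_Mapping.lookup t j = 0"
proof (rule ccontr)
  assume "Poly_Mapping.lookup t j \<noteq> 0"
  then have "Poly_Mapping.lookup (subs (Var(j := Const 0 * Var j)) (Phi m I e :: 'a mpol)) t = 0"
    by (simp add: lookup_scale del: Const.hom_zero fun_upd_apply)
  moreover have "subs (Var(j := Const 0 * Var j)) (Phi m I e :: 'a mpol) = Phi m I e"
    by (rule Phi_fix) (use assms in auto)
  ultimately show False using assms by (simp add: in_keys_iff del: fun_upd_apply)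
qed

lemma Phi_insert:
  assumes "finite I" "j \<notin> I" "e < qnum (CARD('a)) m"
  shows "(Phi m (insert j I) e :: 'a::{field,finite} mpol)
    = (\<Sum>l\<le>qnum (CARD('a)) m - Suc e. Var j ^ ((CARD('a) - 1) * (qnum (CARD('a)) m - Suc l)) * Phi m I (e + l))"
proof -
  let ?M = "qnum (CARD('a)) m"
  have "(Phi m (insert j I) e :: 'a mpol) = (\<Sum>l\<le>?M - Suc e. poly.coeff (trunc_geom ?M (Var j ^ (CARD('a) - 1))) l
      * poly.coeff (\<Prod>i\<in>I. trunc_geom ?M (Var i ^ (CARD('a) - 1))) (?M - Suc e - l))"
    using assms by (simp add: Phi_def coeff_mult)
  also have "\<dots> = (\<Sum>l\<le>?M - Suc e. Var j ^ ((CARD('a) - 1) * (?M - Suc l)) * Phi m I (e + l))"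
  proof (rule sum.cong)
    fix l assume "l \<in> {..?M - Suc e}"
    then have "l < ?M" "?M - Suc e - l = ?M - Suc (e + l)" using assms(3) by auto
    then show "poly.coeff (trunc_geom ?M (Var j ^ (CARD('a) - 1))) l
        * poly.coeff (\<Prod>i\<in>I. trunc_geom ?M (Var i ^ (CARD('a) - 1))) (?M - Suc e - l)
      = Var j ^ ((CARD('a) - 1) * (?M - Suc l)) * (Phi m I (e + l) :: 'a mpol)"
      by (simp add: coeff_trunc_geom Phi_def power_mult)
  qed simp
  finally show ?thesis .
qed

text \<open>A monomial with exponent \<open>k\<close> of \<open>x\<^sub>j\<close>, where \<open>k\<close> is at least \<open>(q - 1)(M - 1)\<close>, can only come from
  the term \<open>l = 0\<close> of the sum in \<open>Phi_insert\<close>.\<close>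

lemma lookup_Phi_insert:
  fixes s :: "nat \<Rightarrow>\<^sub>0 nat"
  assumes I: "finite I" "j \<notin> I" and e: "e < qnum (CARD('a)) m" and s: "Poly_Mapping.lookup s j = 0"
    and k: "(CARD('a) - 1) * (qnum (CARD('a)) m - 1) \<le> k"
  shows "Poly_Mapping.lookup (Phi m (insert j I) e :: 'a::{field,finite} mpol) (Poly_Mapping.single j k + s)
    = (if k = (CARD('a) - 1) * (qnum (CARD('a)) m - 1) then Poly_Mapping.lookup (Phi m I e :: 'a mpol) s else 0)"
proof -
  let ?q = "CARD('a)" let ?M = "qnum ?q m"
  let ?k = "\<lambda>l. (?q - 1) * (?M - Suc l)"
  have q: "2 \<le> ?q" by (rule card_field_ge2)
  have T: "Poly_Mapping.lookup (Var j ^ ?k l * (Phi m I (e + l) :: 'a mpol)) (Poly_Mapping.single j k + s)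
      = (if l = 0 then (if k = ?k 0 then Poly_Mapping.lookup (Phi m I e :: 'a mpol) s else 0) else 0)" if l: "l < ?M" for l
  proof -
    have "?M - Suc l \<le> ?M - 1" by linarith
    then have kl: "?k l \<le> k" using k by (meson mult_le_mono2 order_trans)
    have "Poly_Mapping.single j k + s = Poly_Mapping.single j (?k l) + (Poly_Mapping.single j (k - ?k l) + s)"
      using kl by (intro poly_mapping_eqI) (auto simp: lookup_add lookup_single when_def)
    then have 1: "Poly_Mapping.lookup (Var j ^ ?k l * (Phi m I (e + l) :: 'a mpol)) (Poly_Mapping.single j k + s)
        = Poly_Mapping.lookup (Phi m I (e + l) :: 'a mpol) (Poly_Mapping.single j (k - ?k l) + s)"
      by (simp only: Var_power lookup_single_mult mult_1)
    show ?thesis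
    proof (cases "k = ?k l")
      case True
      then have "?k 0 \<le> ?k l" using k by (simp add: One_nat_def)
      then have "?M - Suc 0 \<le> ?M - Suc l" using q by simp
      then have "l = 0" using l by linarith
      then show ?thesis unfolding 1 using True by simp
    next
      case False
      have "Poly_Mapping.lookup (Phi m I (e + l) :: 'a mpol) (Poly_Mapping.single j (k - ?k l) + s) = 0"
      proof (rule ccontr)
        assume "\<not> ?thesis"
        then have "Poly_Mapping.single j (k - ?k l) + s \<in> Poly_Mapping.keys (Phi m I (e + l) :: 'a mpol)" by (simp add: in_keys_iff)
        from keys_Phi[OF this I(2)] show False using False kl s by (simp add: lookup_add)
      qed
      then show ?thesis unfolding 1 using False by (cases "l = 0") auto
    qed
  qed
  have "Poly_Mapping.lookup (Phi m (insert j I) e :: 'a mpol) (Poly_Mapping.single j k + s)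
      = (\<Sum>l\<le>?M - Suc e. if l = 0 then (if k = ?k 0 then Poly_Mapping.lookup (Phi m I e :: 'a mpol) s else 0) else 0)"
    unfolding Phi_insert[OF I e] lookup_sum using e by (intro sum.cong refl T) auto
  then show ?thesis by (simp add: One_nat_def)
qed

lemma lookup_Phi_canonical_exponent:
  assumes "finite J" "1 \<notin> J" "e < qnum (CARD('a)) m"
  shows "Poly_Mapping.lookup (Phi m (insert 1 J) e :: 'a::{field,finite} mpol) (canonical_exponent (CARD('a)) J (qnum (CARD('a)) m) e')
    = (if e = e' then 1 else 0)"
  using assms(1,2)
proof (induction J rule: finite_induct)
  case empty
  let ?q = "CARD('a)" let ?M = "qnum ?q m"
  have "?M - Suc (?M - Suc e) = e" "?M - Suc e < ?M" using assms(3) by auto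
  then have "(Phi m {1} e :: 'a mpol) = (Var 1 ^ (?q - 1)) ^ e" by (simp add: Phi_def coeff_trunc_geom)
  also have "\<dots> = Var 1 ^ ((?q - 1) * e)" by (simp add: power_mult)
  finally have "(Phi m {1} e :: 'a mpol) = Poly_Mapping.single (Poly_Mapping.single 1 ((?q - 1) * e)) 1"
    by (simp add: Var_power)
  moreover have "Poly_Mapping.single (1::nat) ((?q - 1) * e) = Poly_Mapping.single 1 ((?q - 1) * e') \<longleftrightarrow> e = e'"
    using card_field_ge2[where 'a='a] by (auto dest!: arg_cong[of _ _ "\<lambda>x. Poly_Mapping.lookup x 1"])
  ultimately show ?case by (simp add: canonical_exponent_def lookup_single when_def)
next
  case (insert j J)
  let ?q = "CARD('a)" let ?M = "qnum ?q m"
  have c: "canonical_exponent ?q (insert j J) ?M e' = Poly_Mapping.single j ((?q - 1) * (?M - 1)) + canonical_exponent ?q J ?M e'"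
    using insert.hyps by (simp add: canonical_exponent_def ac_simps)
  have "Poly_Mapping.lookup (canonical_exponent ?q J ?M e') j = 0"
    using insert.hyps insert.prems by (auto simp: lookup_canonical_exponent)
  then have "Poly_Mapping.lookup (Phi m (insert j (insert 1 J)) e :: 'a mpol) (canonical_exponent ?q (insert j J) ?M e')
      = Poly_Mapping.lookup (Phi m (insert 1 J) e :: 'a mpol) (canonical_exponent ?q J ?M e')"
    unfolding c by (subst lookup_Phi_insert) (use insert assms(3) in auto)
  then show ?case using insert by (simp add: insert_commute)
qed

lemma lookup_Phi_top_exponent:
  assumes n: "2 \<le> n" and m: "1 \<le> m" and e: "e < qnum (CARD('a)) m"
  shows "Poly_Mapping.lookup (Phi m {1..n} e :: 'a::{field,finite} mpol) (top_exponent n (CARD('a) ^ m - 1)) = 0"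
proof -
  let ?q = "CARD('a)" let ?M = "qnum ?q m"
  define s where "s = top_exponent n (?q ^ m - 1) - Poly_Mapping.single 2 (?q ^ m - 1)"
  have I: "insert 2 ({1..n} - {2}) = {1..n}" using n by auto
  have t: "Poly_Mapping.single 2 (?q ^ m - 1) + s = top_exponent n (?q ^ m - 1)"
    using n by (intro poly_mapping_eqI) (auto simp: s_def lookup_add lookup_minus lookup_top_exponent lookup_single when_def)
  have k: "(?q - 1) * (?M - 1) < ?q ^ m - 1"
    unfolding N_eq using qnum_pos[OF m, of ?q] card_field_ge2[where 'a='a] by simp
  have "Poly_Mapping.lookup (Phi m (insert 2 ({1..n} - {2})) e :: 'a mpol) (Poly_Mapping.single 2 (?q ^ m - 1) + s) = 0"
    using n k e by (subst lookup_Phi_insert) (auto simp: s_def lookup_minus lookup_top_exponent)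
  then show ?thesis by (simp only: I t)
qed

lemma Top_single: "(Top m n :: 'a::{field,finite} mpol) = Poly_Mapping.single (top_exponent n (CARD('a) ^ m - 1)) 1"
proof -
  have "(\<Prod>i\<in>A. Var i ^ N :: 'a mpol) = Poly_Mapping.single (\<Sum>i\<in>A. Poly_Mapping.single i N) 1" for A N
    by (induction A rule: infinite_finite_induct) (simp_all add: Var_power mult_single)
  then show ?thesis by (simp add: Top_def top_exponent_def)
qed

text \<open>The \<open>Phi\<close> and the top monomial are dual to the canonical exponents and the top exponent.
  After the subtraction of the right combination, all these coefficients vanish.\<close>

theorem B1_span:
  fixes u :: "'a::{field,finite} mpol"
  assumes n: "2 \<le> n" and m: "1 \<le> m" and u: "u \<in> B1 m n"
  obtains c b where "in_ideal m n (u - (\<Sum>e<qnum (CARD('a)) m. Const (c e) * Phi m {1..n} e) - Const b * Top m n)"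
proof -
  let ?q = "CARD('a)" let ?M = "qnum ?q m" let ?t = "top_exponent n (?q ^ m - 1)"
  let ?canonical_exponent = "canonical_exponent ?q {2..n} ?M"
  have q: "2 \<le> ?q" by (rule card_field_ge2)
  have M: "0 < ?M" by (rule qnum_pos[OF m])
  have Q: "?q ^ m = (?q - 1) * ?M + 1" using N_eq[of m, where 'a='a] q by (metis Suc_eq_plus1 Suc_pred add.commute le_add_diff_inverse2 nat_less_le one_le_numeral one_le_power order_trans)
  have n1: "{1..n} = insert 1 {2..n}" using n by auto
  define c where "c e = Poly_Mapping.lookup u (?canonical_exponent e)" for e
  define b where "b = Poly_Mapping.lookup u ?t"
  define w where "w = u - (\<Sum>e<?M. Const (c e) * Phi m {1..n} e) - Const b * Top m n"
  have wB: "w \<in> B1 m n"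
    unfolding w_def by (intro B1_diff B1_sum B1_Const u Phi_B1 Top_B1 n m)
  then obtain v where v: "v \<in> Sn n" "in_ideal m n (w - v)"
    "\<And>t. Poly_Mapping.lookup v t = (if \<exists>i\<in>{1..n}. ?q ^ m \<le> Poly_Mapping.lookup t i then 0 else Poly_Mapping.lookup w t)"
    using reduced_representative[of w n m] by (auto simp: B1_def)
  have "w - (w - v) \<in> B1 m n"
    by (intro B1_diff wB B1_in_ideal v Sn_diff) (use wB in \<open>simp add: B1_def\<close>)
  then have vB: "v \<in> B1 m n" by simp
  have "v = 0"
  proof (rule B1_reduced_zero[OF n m vB])
    show "\<forall>t\<in>Poly_Mapping.keys v. \<forall>i\<in>{1..n}. Poly_Mapping.lookup t i < ?q ^ m"
      by (auto simp: in_keys_iff v(3) not_le split: if_splits)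
    have ne: "?canonical_exponent e \<noteq> ?t" for e
    proof
      assume "?canonical_exponent e = ?t"
      from arg_cong[OF this, of "\<lambda>x. Poly_Mapping.lookup x 2"] show False
        using n Q q M by (auto simp: lookup_canonical_exponent lookup_top_exponent)
    qed
    have "Poly_Mapping.lookup w (?canonical_exponent e) = 0" if e: "e < ?M" for e
    proof -
      have "Poly_Mapping.lookup w (?canonical_exponent e) = c e - (\<Sum>e'<?M. c e' * (if e' = e then 1 else 0))
          - b * Poly_Mapping.lookup (Top m n :: 'a mpol) (?canonical_exponent e)"
        unfolding w_def n1 by (simp add: lookup_minus lookup_sum lookup_Const_mult lookup_Phi_canonical_exponent c_def)
      also have "Poly_Mapping.lookup (Top m n :: 'a mpol) (?canonical_exponent e) = 0"
        using ne[of e] by (simp add: Top_single lookup_single when_def)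
      also have "(\<Sum>e'<?M. c e' * (if e' = e then 1 else 0)) = (\<Sum>e'<?M. if e' = e then c e' else 0)"
        by (rule sum.cong) auto
      finally show ?thesis using e by simp
    qed
    then show "Poly_Mapping.lookup v (?canonical_exponent e) = 0" if "e < ?M" for e
      using that by (simp add: v(3))
    have "Poly_Mapping.lookup w ?t = 0"
      unfolding w_def using lookup_Phi_top_exponent[OF n m, where 'a='a]
      by (simp add: lookup_minus lookup_sum lookup_Const_mult b_def Top_single)
    then show "Poly_Mapping.lookup v ?t = 0" by (simp add: v(3))
  qed
  then have "in_ideal m n w" using v(2) by simp
  then show ?thesis using that unfolding w_def by blast
qed

section \<open>Dickson invariants\<close>

definition dickson_poly :: "nat \<Rightarrow> 'a::{field,finite} mpol poly" where
  "dickson_poly s = (\<Prod>l \<in> {1..s} \<rightarrow>\<^sub>E (UNIV :: 'a set). [:\<Sum>j = 1..s. Const (l j) * Var j, 1:])"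

lemma PiE_form_inj:
  assumes "l \<in> {1..s} \<rightarrow>\<^sub>E UNIV" "l' \<in> {1..s} \<rightarrow>\<^sub>E (UNIV :: 'a::{field,finite} set)"
    "(\<Sum>j = 1..s. Const (l j) * Var j) = (\<Sum>j = 1..s. Const (l' j) * (Var j :: 'a mpol))"
  shows "l = l'"
proof (rule PiE_ext[OF assms(1,2)])
  fix k assume k: "k \<in> {1..s}"
  from arg_cong[OF assms(3), of "\<lambda>p. Poly_Mapping.lookup p (Poly_Mapping.single k 1)"]
  show "l k = l' k" using lookup_lin_forms[of k s l] lookup_lin_forms[of k s l'] k by simp
qed

lemma lin_forms_PiE: "lin_forms s = (\<lambda>l. \<Sum>j = 1..s. Const (l j) * Var j) ` ({1..s} \<rightarrow>\<^sub>E (UNIV :: 'a::{field,finite} set))"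
proof -
  have "(\<Sum>j = 1..s. Const (c j) * Var j) \<in> (\<lambda>l. \<Sum>j = 1..s. Const (l j) * (Var j :: 'a mpol)) ` ({1..s} \<rightarrow>\<^sub>E UNIV)" for c
    by (rule image_eqI[of _ _ "restrict c {1..s}"]) (auto intro!: sum.cong)
  then show ?thesis unfolding lin_forms_def by blast
qed

lemma card_lin_forms: "card (lin_forms s :: 'a::{field,finite} mpol set) = CARD('a) ^ s"
  unfolding lin_forms_PiE by (subst card_image) (auto simp: inj_on_def card_PiE intro!: PiE_form_inj)

lemma dickson_poly_degree: "degree (dickson_poly s :: 'a::{field,finite} mpol poly) = CARD('a) ^ s"
  unfolding dickson_poly_def by (subst degree_prod_eq_sum_degree) (auto simp: card_PiE)

lemma dickson_poly_lead: "poly.coeff (dickson_poly s :: 'a::{field,finite} mpol poly) (CARD('a) ^ s) = 1"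
proof -
  have "lead_coeff (dickson_poly s :: 'a mpol poly) = 1" unfolding dickson_poly_def by (simp add: lead_coeff_prod)
  then show ?thesis by (simp only: dickson_poly_degree)
qed

lemma poly_dickson_poly: "poly (dickson_poly s) z = (\<Prod>l \<in> {1..s} \<rightarrow>\<^sub>E (UNIV :: 'a set). (\<Sum>j = 1..s. Const (l j) * Var j) + (z :: 'a::{field,finite} mpol))"
  by (simp add: dickson_poly_def poly_prod)

lemma dickson_poly_root: assumes "z \<in> lin_forms s" shows "poly (dickson_poly s) z = (0 :: 'a::{field,finite} mpol)"
proof -
  have "- z \<in> lin_forms s" using assms by auto
  then obtain l where "l \<in> {1..s} \<rightarrow>\<^sub>E (UNIV :: 'a set)" "- z = (\<Sum>j = 1..s. Const (l j) * Var j)"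
    unfolding lin_forms_PiE by blast
  then show ?thesis unfolding poly_dickson_poly by (auto simp: finite_PiE eq_neg_iff_add_eq_0[symmetric] intro!: prod_zero bexI[of _ l])
qed

lemma monic_eq_dickson_poly:
  fixes E :: "'a::{field,finite} mpol poly"
  assumes "degree E \<le> CARD('a) ^ s" "poly.coeff E (CARD('a) ^ s) = 1" "\<And>z. z \<in> lin_forms s \<Longrightarrow> poly E z = 0"
  shows "E = dickson_poly s"
  by (rule poly_eqI_degree_lead_coeff[where n = "CARD('a) ^ s" and A = "lin_forms s"])
     (use assms in \<open>simp_all add: dickson_poly_lead card_lin_forms dickson_poly_degree dickson_poly_root\<close>)

lemma dickson_Sn: "dickson s i \<in> Sn s"
proof -
  let ?\<pi> = "\<lambda>i. if 1 \<le> i \<and> i \<le> s then Var i else (0 :: 'a mpol)"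
  have "map_poly (subs ?\<pi>) (dickson_poly s) = (dickson_poly s :: 'a mpol poly)"
    unfolding dickson_poly_def map_poly_subs_prod
    by (rule prod.cong) (auto simp: map_poly_pCons subs.hom_sum subs.hom_mult intro!: sum.cong)
  from arg_cong[OF this, of "\<lambda>p. poly.coeff p k" for k]
  have co: "subs ?\<pi> (poly.coeff (dickson_poly s :: 'a mpol poly) k) = poly.coeff (dickson_poly s) k" for k
    by (simp add: coeff_map_poly)
  have S: "subs ?\<pi> p \<in> Sn s" for p
    by (rule truncate_in_Sn)
  have "poly.coeff (dickson_poly s :: 'a mpol poly) k \<in> Sn s" for k by (subst co[symmetric]) (rule S)
  then show ?thesis unfolding dickson_def dickson_poly_def[symmetric] by (intro Sn_mult Sn_power Sn_uminus Sn_1)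
qed

text \<open>The substitution permutes the roots of the defining polynomial.\<close>

lemma dickson_invariant:
  assumes g: "g \<in> GL n" shows "lin_subst n g (dickson n i) = (dickson n i :: 'a::{field,finite} mpol)"
proof -
  obtain h where h: "h \<in> carrier_mat n n" "g \<in> carrier_mat n n" "g * h = 1\<^sub>m n" "h * g = 1\<^sub>m n"
    by (rule GL_inverse[OF g])
  let ?\<sigma> = "subs (image_form n g)" let ?E = "map_poly ?\<sigma> (dickson_poly n)"
  have co: "poly.coeff ?E k = ?\<sigma> (poly.coeff (dickson_poly n) k)" for k by (simp add: coeff_map_poly)
  have "?E = dickson_poly n"
  proof (rule monic_eq_dickson_poly)
    show "degree ?E \<le> CARD('a) ^ n" by (rule degree_le) (simp add: co coeff_eq_0 dickson_poly_degree)
    show "poly.coeff ?E (CARD('a) ^ n) = 1" by (simp add: co dickson_poly_lead)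
    fix z :: "'a mpol" assume z: "z \<in> lin_forms n"
    define z' where "z' = subs (image_form n h) z"
    have z': "z' \<in> lin_forms n" unfolding z'_def by (rule subs_lin_forms[OF z]) simp
    have zz: "?\<sigma> z' = z" unfolding z'_def subs_subs
    proof (rule subs_ident[OF lin_forms_Sn[OF z]])
      fix i assume "1 \<le> i" "i \<le> n"
      then show "subs (image_form n g) (image_form n h i) = Var i" using image_form_mult[OF h(2,1), of i] by (simp add: h(3) image_form_one)
    qed
    have "poly ?E z = ?\<sigma> (poly (dickson_poly n) z')"
      unfolding dickson_poly_def map_poly_subs_prod poly_prod subs.hom_prod
      by (rule prod.cong) (simp_all add: map_poly_pCons zz subs.hom_add)
    then show "poly ?E z = 0" by (simp add: dickson_poly_root[OF z'])
  qed
  then have "?\<sigma> (poly.coeff (dickson_poly n) k) = poly.coeff (dickson_poly n) k" for k by (simp only: co[symmetric])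
  then show ?thesis unfolding dickson_def dickson_poly_def[symmetric] lin_subst_subs
    by (simp add: subs.hom_mult subs.hom_power subs.hom_uminus)
qed

text \<open>A monic \<open>q\<close>-polynomial of degree \<open>q\<^sup>s\<close> that vanishes at the variables vanishes at their linear
  combinations, so its coefficients are, up to sign, the Dickson invariants.\<close>

lemma dickson_eqI:
  fixes c :: "nat \<Rightarrow> 'a::{field,finite} mpol"
  assumes "\<And>k. 1 \<le> k \<Longrightarrow> k \<le> s \<Longrightarrow> Var k ^ (CARD('a) ^ s) + (\<Sum>i<s. (- 1) ^ (s - i) * c i * Var k ^ (CARD('a) ^ i)) = 0"
  shows "i < s \<Longrightarrow> dickson s i = c i"
    and "poly (dickson_poly s) z = z ^ (CARD('a) ^ s) + (\<Sum>i<s. (- 1) ^ (s - i) * c i * z ^ (CARD('a) ^ i))"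
proof -
  let ?q = "CARD('a)"
  have q: "2 \<le> ?q" by (rule card_field_ge2)
  define E where "E = Polynomial.monom 1 (?q ^ s) + (\<Sum>i<s. Polynomial.monom ((- 1) ^ (s - i) * c i) (?q ^ i))"
  have pE: "poly E z = z ^ (?q ^ s) + (\<Sum>i<s. (- 1) ^ (s - i) * c i * z ^ (?q ^ i))" for z
    by (simp add: E_def poly_monom poly_sum)
  have coE: "poly.coeff E (?q ^ j) = (if j = s then 1 else if j < s then (- 1) ^ (s - j) * c j else 0)" for j
  proof -
    have "?q ^ i = ?q ^ j \<longleftrightarrow> i = j" for i j using q by (simp add: power_inject_exp)
    then show ?thesis by (auto simp: E_def coeff_sum)
  qed
  have "E = dickson_poly s"
  proof (rule monic_eq_dickson_poly)
    show "degree E \<le> ?q ^ s"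
      unfolding E_def
    proof (intro degree_add_le degree_sum_le)
      fix i assume "i \<in> {..<s}"
      then have "?q ^ i \<le> ?q ^ s" using q by (intro power_increasing) auto
      then show "degree (Polynomial.monom ((- 1) ^ (s - i) * c i) (?q ^ i)) \<le> ?q ^ s"
        using degree_monom_le order_trans by blast
    qed (simp_all add: degree_monom_le)
    show "poly.coeff E (?q ^ s) = 1" by (simp add: coE)
    fix z :: "'a mpol" assume "z \<in> lin_forms s"
    then obtain d where z: "z = (\<Sum>k = 1..s. Const (d k) * Var k)" by (auto simp: lin_forms_def)
    have "poly E z = (\<Sum>k = 1..s. Const (d k) * Var k ^ (?q ^ s))
        + (\<Sum>i<s. \<Sum>k = 1..s. (- 1) ^ (s - i) * c i * (Const (d k) * Var k ^ (?q ^ i)))"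
      unfolding pE z lin_forms_pow by (simp add: sum_distrib_left)
    also have "\<dots> = (\<Sum>k = 1..s. Const (d k) * Var k ^ (?q ^ s))
        + (\<Sum>k = 1..s. \<Sum>i<s. (- 1) ^ (s - i) * c i * (Const (d k) * Var k ^ (?q ^ i)))"
      by (subst sum.swap) simp
    also have "\<dots> = (\<Sum>k = 1..s. Const (d k) * (Var k ^ (?q ^ s) + (\<Sum>i<s. (- 1) ^ (s - i) * c i * Var k ^ (?q ^ i))))"
      by (simp add: sum.distrib distrib_left sum_distrib_left mult_ac)
    also have "\<dots> = 0" by (rule sum.neutral) (use assms in auto)
    finally show "poly E z = 0" .
  qed
  then show "poly (dickson_poly s) z = z ^ (?q ^ s) + (\<Sum>i<s. (- 1) ^ (s - i) * c i * z ^ (?q ^ i))" using pE by metis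
  show "dickson s i = c i" if "i < s"
  proof -
    have "dickson s i = (- 1) ^ (s - i) * ((- 1) ^ (s - i) * c i)"
      unfolding dickson_def dickson_poly_def[symmetric] \<open>E = dickson_poly s\<close>[symmetric] using coE[of i] that by simp
    also have "\<dots> = ((- 1) ^ (s - i) * (- 1) ^ (s - i)) * c i" by (simp only: mult.assoc)
    finally show ?thesis by (simp flip: power_mult_distrib)
  qed
qed

lemma dickson_1: "dickson 1 0 = (Var 1 ^ (CARD('a) - 1) :: 'a::{field,finite} mpol)"
proof (rule dickson_eqI(1)[of 1 "\<lambda>_. Var 1 ^ (CARD('a) - 1)"])
  fix k :: nat assume "1 \<le> k" "k \<le> 1"
  then have "k = 1" by simp
  then show "Var k ^ (CARD('a) ^ 1) + (\<Sum>i<1. (- 1) ^ (1 - i) * Var 1 ^ (CARD('a) - 1) * Var k ^ (CARD('a) ^ i)) = (0 :: 'a mpol)"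
    using card_field_ge2[where 'a='a] by (simp flip: power_Suc2)
qed simp

text \<open>Explicit forms of \<open>Q\<^sub>2\<^sub>,\<^sub>1\<close> and \<open>Q\<^sub>2\<^sub>,\<^sub>0\<close>; see \<open>dickson_2\<close>.\<close>

definition Q21 :: "'a::{field,finite} mpol" where
  "Q21 = Var 1 ^ (CARD('a) * (CARD('a) - 1)) + (Var 2 ^ CARD('a) - Var 1 ^ (CARD('a) - 1) * Var 2) ^ (CARD('a) - 1)"

definition Q20 :: "'a::{field,finite} mpol" where "Q20 = L2 (Var 1) (Var 2) ^ (CARD('a) - 1)"

text \<open>The defining polynomial of the Dickson invariants of \<open>x\<^sub>1\<close> and \<open>x\<^sub>2\<close>.\<close>

definition E2 :: "'a::{field,finite} mpol \<Rightarrow> 'a mpol" where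
  "E2 z = z ^ (CARD('a) ^ 2) - Q21 * z ^ CARD('a) + Q20 * z"

lemma E2_factor:
  defines "v \<equiv> (Var 2 ^ CARD('a) - Var 1 ^ (CARD('a) - 1) * Var 2 :: 'a::{field,finite} mpol)"
  shows "E2 z = (z ^ CARD('a) - Var 1 ^ (CARD('a) - 1) * z) ^ CARD('a) - v ^ (CARD('a) - 1) * (z ^ CARD('a) - Var 1 ^ (CARD('a) - 1) * z)"
proof -
  let ?q = "CARD('a)"
  have "Var 1 * v = L2 (Var 1) (Var 2)"
    using card_field_ge2[where 'a='a] by (simp add: v_def L2_def right_diff_distrib mult.assoc[symmetric] flip: power_Suc)
  then have D: "Q20 = Var 1 ^ (?q - 1) * v ^ (?q - 1)" by (simp add: Q20_def flip: power_mult_distrib)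
  have "(z ^ ?q - Var 1 ^ (?q - 1) * z) ^ ?q = z ^ (?q ^ 2) - Var 1 ^ (?q * (?q - 1)) * z ^ ?q"
    using mfrob_diff[of "z ^ ?q" "Var 1 ^ (?q - 1) * z" 1]
    by (simp add: power_mult_distrib power2_eq_square mult.commute[of "?q - 1"] flip: power_mult)
  then show ?thesis unfolding E2_def D Q21_def v_def[symmetric] by (simp add: algebra_simps)
qed

lemma E2_zero [simp]: "E2 (Var 1) = (0 :: 'a::{field,finite} mpol)" "E2 (Var 2) = (0 :: 'a mpol)"
proof -
  have q: "2 \<le> CARD('a)" by (rule card_field_ge2)
  have "(Var 1 :: 'a mpol) ^ CARD('a) - Var 1 ^ (CARD('a) - 1) * Var 1 = 0" using q by (simp flip: power_Suc2)
  then show "E2 (Var 1) = (0 :: 'a mpol)" using q by (simp add: E2_factor power_0_left)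
  show "E2 (Var 2) = (0 :: 'a mpol)" using q by (simp add: E2_factor flip: power_Suc2)
qed

lemma lessThan_2: "{..<2::nat} = {0, 1}" and lessThan_3: "{..<3::nat} = {0, 1, 2}" by auto

lemma dickson_2_sum:
  "z ^ (CARD('a) ^ 2) + (\<Sum>i<2. (- 1) ^ (2 - i) * (if i = 0 then Q20 else Q21) * z ^ (CARD('a) ^ i))
    = (E2 z :: 'a::{field,finite} mpol)"
  by (simp add: lessThan_2 E2_def)

lemma dickson_2: "dickson 2 1 = (Q21 :: 'a::{field,finite} mpol)" "dickson 2 0 = (Q20 :: 'a mpol)"
  and poly_dickson_poly_2: "poly (dickson_poly 2) z = (E2 z :: 'a mpol)"
proof -
  have *: "Var k ^ (CARD('a) ^ 2) + (\<Sum>i<2. (- 1) ^ (2 - i) * (if i = 0 then Q20 else Q21) * Var k ^ (CARD('a) ^ i)) = (0 :: 'a mpol)"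
    if "1 \<le> k" "k \<le> 2" for k
  proof -
    have "k = 1 \<or> k = 2" using that by auto
    then show ?thesis unfolding dickson_2_sum by auto
  qed
  show "dickson 2 1 = (Q21 :: 'a mpol)" using dickson_eqI(1)[OF *, of 1] by simp
  show "dickson 2 0 = (Q20 :: 'a mpol)" using dickson_eqI(1)[OF *, of 0] by simp
  show "poly (dickson_poly 2) z = (E2 z :: 'a mpol)" using dickson_eqI(2)[OF *, of z] unfolding dickson_2_sum .
qed

lemma Q21_Sn [intro]: "(Q21 :: 'a::{field,finite} mpol) \<in> Sn 2" using dickson_Sn[of 2 1] by (simp add: dickson_2)
lemma Q20_Sn [intro]: "(Q20 :: 'a::{field,finite} mpol) \<in> Sn 2" using dickson_Sn[of 2 0] by (simp add: dickson_2)

text \<open>The product of all \<open>x\<^sub>3 + \<lambda>\<^sub>1 x\<^sub>1 + \<lambda>\<^sub>2 x\<^sub>2\<close>; see \<open>V3_prod\<close>.\<close>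

definition V3 :: "'a::{field,finite} mpol" where "V3 = E2 (Var 3)"

lemma V3_Sn [intro]: "(V3 :: 'a::{field,finite} mpol) \<in> Sn 3"
  unfolding V3_def E2_def by (intro Sn_add Sn_diff Sn_mult Sn_power Sn_Var Sn_mono[OF Q21_Sn] Sn_mono[OF Q20_Sn]) auto

text \<open>The \<open>q\<close>-polynomial \<open>E2(z)\<^sup>q - V\<^sup>q\<^sup>-\<^sup>1 E2(z)\<close> vanishes at all three variables, as \<open>E2\<close> vanishes at \<open>x\<^sub>1, x\<^sub>2\<close> and takes
  the value \<open>V\<close> at \<open>x\<^sub>3\<close>.\<close>

lemma dickson_3:
  "dickson 3 2 = (Q21 ^ CARD('a) + V3 ^ (CARD('a) - 1) :: 'a::{field,finite} mpol)"
  "dickson 3 1 = (Q20 ^ CARD('a) + Q21 * V3 ^ (CARD('a) - 1) :: 'a mpol)"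
  "dickson 3 0 = (Q20 * V3 ^ (CARD('a) - 1) :: 'a mpol)"
  and dickson_3_relation: "k = 1 \<or> k = 2 \<or> k = 3 \<Longrightarrow>
    (Var k :: 'a mpol) ^ (CARD('a) ^ 3) = dickson 3 2 * Var k ^ (CARD('a) ^ 2) - dickson 3 1 * Var k ^ CARD('a) + dickson 3 0 * Var k"
proof -
  let ?q = "CARD('a)"
  define c :: "nat \<Rightarrow> 'a mpol" where "c i = (if i = 0 then Q20 * V3 ^ (?q - 1) else if i = 1 then Q20 ^ ?q + Q21 * V3 ^ (?q - 1)
     else Q21 ^ ?q + V3 ^ (?q - 1))" for i
  have E: "z ^ (?q ^ 3) + (\<Sum>i<3. (- 1) ^ (3 - i) * c i * z ^ (?q ^ i)) = E2 z ^ ?q - V3 ^ (?q - 1) * E2 z" for z :: "'a mpol"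
  proof -
    have "E2 z ^ ?q = z ^ (?q ^ 3) - Q21 ^ ?q * z ^ (?q ^ 2) + Q20 ^ ?q * z ^ ?q"
      unfolding E2_def using mfrob1[of "z ^ (?q ^ 2) - Q21 * z ^ ?q" "Q20 * z"] mfrob_diff[of "z ^ (?q ^ 2)" "Q21 * z ^ ?q" 1]
      by (simp add: power_mult_distrib power2_eq_square power3_eq_cube flip: power_mult)
    then show ?thesis by (simp add: lessThan_3 c_def E2_def algebra_simps)
  qed
  have *: "Var k ^ (?q ^ 3) + (\<Sum>i<3. (- 1) ^ (3 - i) * c i * Var k ^ (?q ^ i)) = (0 :: 'a mpol)"
    if "1 \<le> k" "k \<le> 3" for k
  proof -
    have "k = 1 \<or> k = 2 \<or> k = 3" using that by auto
    moreover have "V3 ^ ?q = V3 ^ (?q - 1) * (V3 :: 'a mpol)" using card_field_ge2[where 'a='a] by (simp flip: power_Suc2)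
    ultimately show ?thesis unfolding E using card_field_ge2[where 'a='a] by (auto simp: power_0_left V3_def[symmetric])
  qed
  have d: "dickson 3 i = c i" if "i < 3" for i using dickson_eqI(1)[OF *] that by blast
  show 1: "dickson 3 2 = (Q21 ^ ?q + V3 ^ (?q - 1) :: 'a mpol)" "dickson 3 1 = (Q20 ^ ?q + Q21 * V3 ^ (?q - 1) :: 'a mpol)"
    "dickson 3 0 = (Q20 * V3 ^ (?q - 1) :: 'a mpol)" by (simp_all add: d c_def)
  assume "k = 1 \<or> k = 2 \<or> k = 3"
  then have "Var k ^ (?q ^ 3) + (\<Sum>i<3. (- 1) ^ (3 - i) * c i * Var k ^ (?q ^ i)) = (0 :: 'a mpol)" by (intro *) auto
  then show "(Var k :: 'a mpol) ^ (?q ^ 3) = dickson 3 2 * Var k ^ (?q ^ 2) - dickson 3 1 * Var k ^ ?q + dickson 3 0 * Var k"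
    by (simp add: lessThan_3 1 c_def algebra_simps eq_neg_iff_add_eq_0)
qed

inductive_set Dickson2 :: "'a::{field,finite} mpol set" where
  mon: "Const c * Q21 ^ i * Q20 ^ j \<in> Dickson2"
| add: "f \<in> Dickson2 \<Longrightarrow> g \<in> Dickson2 \<Longrightarrow> f + g \<in> Dickson2"

lemma Dickson2_Const [intro]: "Const c \<in> Dickson2" using Dickson2.mon[of c 0 0] by simp
lemma Dickson2_0 [intro]: "0 \<in> Dickson2" using Dickson2_Const[of 0] by simp
lemma Dickson2_1 [intro]: "1 \<in> Dickson2" using Dickson2_Const[of 1] by simp
lemma Dickson2_A [intro]: "Q21 \<in> Dickson2" using Dickson2.mon[of 1 1 0] by simp
lemma Dickson2_D [intro]: "Q20 \<in> Dickson2" using Dickson2.mon[of 1 0 1] by simp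
lemma Dickson2_mult [intro]: assumes "f \<in> Dickson2" "g \<in> Dickson2" shows "f * g \<in> Dickson2"
  using assms
proof (induction f arbitrary: g)
  case (mon c i j)
  from mon show ?case
  proof (induction g)
    case (mon d k l)
    have "Const c * Q21 ^ i * Q20 ^ j * (Const d * Q21 ^ k * Q20 ^ l) = Const (c * d) * Q21 ^ (i + k) * Q20 ^ (j + l)"
      by (simp add: power_add Const.hom_mult mult_ac)
    then show ?case by (metis Dickson2.mon)
  qed (simp add: distrib_left Dickson2.add)
qed (simp add: distrib_right Dickson2.add)
lemma Dickson2_power [intro]: "f \<in> Dickson2 \<Longrightarrow> f ^ k \<in> Dickson2" by (induction k) auto
lemma Dickson2_uminus [intro]: assumes "f \<in> Dickson2" shows "- f \<in> Dickson2"
  using Dickson2_mult[OF Dickson2_Const[of "-1"] assms] by (simp add: Const.hom_uminus)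
lemma Dickson2_diff [intro]: "f \<in> Dickson2 \<Longrightarrow> g \<in> Dickson2 \<Longrightarrow> f - g \<in> Dickson2" using Dickson2.add[OF _ Dickson2_uminus, of f g] by simp
lemma Dickson2_sum [intro]: "(\<And>i. i \<in> A \<Longrightarrow> f i \<in> Dickson2) \<Longrightarrow> sum f A \<in> Dickson2"
  by (induction A rule: infinite_finite_induct) (auto intro: Dickson2.add)

lemma Dickson2_Sn: "f \<in> Dickson2 \<Longrightarrow> f \<in> Sn 2"
  by (induction rule: Dickson2.induct) (auto intro!: Sn_add Sn_mult Sn_power)

lemma Dickson2_invariant: "f \<in> Dickson2 \<Longrightarrow> g \<in> GL 2 \<Longrightarrow> lin_subst 2 g f = f"
proof (induction rule: Dickson2.induct)
  case (mon c i j)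
  then show ?case using dickson_invariant[of g 2 1] dickson_invariant[of g 2 0]
    by (simp add: lin_subst_subs subs.hom_mult subs.hom_power dickson_2)
qed (simp add: lin_subst_subs subs.hom_add)

definition eval2 :: "'a::{field,finite} mpol \<Rightarrow> 'a mpol \<Rightarrow> 'a mpol \<Rightarrow> 'a mpol" where
  "eval2 f p r = subs (\<lambda>i. if i = 1 then p else r) f"

text \<open>Evaluation at a pair of elements depends only on the pair up to an invertible linear
  substitution.\<close>

lemma Dickson2_eval2:
  fixes a b c d :: "'a::{field,finite}"
  assumes f: "f \<in> Dickson2" and det: "a * d - b * c \<noteq> 0"
  shows "eval2 f (Const a * p + Const b * r) (Const c * p + Const d * r) = eval2 f p r"
proof -
  define \<sigma> :: "nat \<Rightarrow> 'a mpol" where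
    "\<sigma> i = (if i = 1 then Const a * Var 1 + Const b * Var 2 else Const c * Var 1 + Const d * Var 2)" for i
  define e where "e = inverse (a * d - b * c)"
  define \<tau> :: "nat \<Rightarrow> 'a mpol" where
    "\<tau> i = (if i = 1 then Const (e * d) * Var 1 - Const (e * b) * Var 2 else Const (e * a) * Var 2 - Const (e * c) * Var 1)" for i
  have e: "e * (a * d - b * c) = 1" using det by (simp add: e_def)
  have "subs \<tau> (\<sigma> i) = Var i" if "1 \<le> i" "i \<le> 2" for i
  proof -
    have "i = 1 \<or> i = 2" using that by auto
    moreover have "subs \<tau> (\<sigma> 1) = Const (e * (a * d - b * c)) * Var 1" "subs \<tau> (\<sigma> 2) = Const (e * (a * d - b * c)) * Var 2"
      by (simp_all add: \<sigma>_def \<tau>_def subs.hom_add subs.hom_mult Const.hom_mult Const.hom_minus algebra_simps)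
    ultimately show ?thesis by (auto simp: e)
  qed
  then obtain g :: "'a mat" where g: "g \<in> GL 2" "\<And>u. u \<in> Sn 2 \<Longrightarrow> lin_subst 2 g u = subs \<sigma> u"
    by (rule lin_subst_of_subst[of 2 \<sigma> \<tau>, rotated 2]) (auto simp: \<sigma>_def \<tau>_def intro!: lin_forms_add lin_forms_diff lin_forms_scale lin_forms_Var)
  have "subs \<sigma> f = f" using g(2)[OF Dickson2_Sn[OF f]] Dickson2_invariant[OF f g(1)] by simp
  then have "eval2 f p r = subs (\<lambda>i. if i = 1 then p else r) (subs \<sigma> f)" by (simp add: eval2_def)
  also have "\<dots> = eval2 f (Const a * p + Const b * r) (Const c * p + Const d * r)"
    unfolding subs_subs eval2_def by (rule arg_cong[where f = "\<lambda>\<sigma>. subs \<sigma> f"]) (auto simp: \<sigma>_def subs.hom_add subs.hom_mult)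
  finally show ?thesis by simp
qed

text \<open>For an invariant \<open>f\<close> this is an alternating form in \<open>p, r\<close> on any plane of linear combinations, since
  \<open>L2\<close> transforms by the determinant and \<open>f\<close> is unchanged.\<close>

definition alt_form :: "'a::{field,finite} mpol \<Rightarrow> 'a mpol \<Rightarrow> 'a mpol \<Rightarrow> 'a mpol" where
  "alt_form f p r = L2 p r * eval2 f p r"

lemma alt_form_lin:
  assumes "f \<in> Dickson2"
  shows "alt_form f (Const a * p + Const b * r) (Const c * p + Const d * r) = Const (a * d - b * c) * alt_form f p r"
  using Dickson2_eval2[OF assms, of a d b c p r] by (cases "a * d - b * c = 0") (simp_all add: alt_form_def L2_lin)

lemma subs_alt_form: "subs \<sigma> (alt_form f p r) = alt_form f (subs \<sigma> p) (subs \<sigma> r)"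
proof -
  have "(\<lambda>i. subs \<sigma> (if i = (1::nat) then p else r)) = (\<lambda>i. if i = 1 then subs \<sigma> p else subs \<sigma> r)" by auto
  then show ?thesis by (simp add: alt_form_def subs.hom_mult subs_L2 eval2_def subs_subs)
qed

lemma eval2_id: "(f :: 'a::{field,finite} mpol) \<in> Sn 2 \<Longrightarrow> eval2 f (Var 1) (Var 2) = f"
  unfolding eval2_def
proof (rule subs_ident)
  fix i :: nat assume "1 \<le> i" "i \<le> 2"
  then have "i = 1 \<or> i = 2" by linarith
  then show "(if i = 1 then Var 1 else Var 2) = (Var i :: 'a mpol)" by auto
qed

section \<open>The polynomials \<open>\<delta>\<^sub>3\<^sub>;\<^sub>b(f)\<close>\<close>

text \<open>The Moore determinant of the three variables; see \<open>L3_numer3\<close>.\<close>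

definition L3 :: "'a::{field,finite} mpol" where "L3 = L2 (Var 1) (Var 2) * V3"

text \<open>The numerator of \<open>\<delta>\<^sub>3\<^sub>;\<^sub>b(f)\<close>: the determinant expanded along its last row.\<close>

definition numer3 :: "nat \<Rightarrow> 'a::{field,finite} mpol \<Rightarrow> 'a mpol \<Rightarrow> 'a mpol \<Rightarrow> 'a mpol \<Rightarrow> 'a mpol" where
  "numer3 b f p r s = s ^ (CARD('a) ^ b) * alt_form f p r - r ^ (CARD('a) ^ b) * alt_form f p s + p ^ (CARD('a) ^ b) * alt_form f r s"

abbreviation delta3_numer :: "nat \<Rightarrow> 'a::{field,finite} mpol \<Rightarrow> 'a mpol" where
  "delta3_numer b f \<equiv> numer3 b f (Var 1) (Var 2) (Var 3)"

lemma eval2_simps [simp]: "eval2 1 p r = 1" "eval2 0 p r = 0" "eval2 (f + g) p r = eval2 f p r + eval2 g p r"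
  "eval2 (f * g) p r = eval2 f p r * eval2 g p r" "eval2 (Const c) p r = Const c" "eval2 (f - g) p r = eval2 f p r - eval2 g p r"
  "eval2 (f ^ k) p r = eval2 f p r ^ k"
  by (simp_all add: eval2_def subs.hom_add subs.hom_mult subs.hom_minus subs.hom_power)

lemma eval2_L2: "eval2 (L2 (Var 1) (Var 2)) p r = L2 p r"
  by (simp add: eval2_def subs_L2)

lemma Var_relation:
  "(Var 1 :: 'a::{field,finite} mpol) ^ (CARD('a) ^ 2) = Q21 * Var 1 ^ CARD('a) - Q20 * Var 1"
  "(Var 2 :: 'a mpol) ^ (CARD('a) ^ 2) = Q21 * Var 2 ^ CARD('a) - Q20 * Var 2"
  using E2_zero[where 'a='a] by (simp_all add: E2_def algebra_simps eq_neg_iff_add_eq_0 add_eq_0_iff2)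

lemma L2_Q21: "L2 (Var 1) (Var 2) * Q21 = Var 1 * Var 2 ^ (CARD('a) ^ 2) - Var 2 * (Var 1 :: 'a::{field,finite} mpol) ^ (CARD('a) ^ 2)"
  unfolding Var_relation L2_def by (simp add: algebra_simps)

lemma L2_Q20: "L2 (Var 1) (Var 2) * Q20 = Var 1 ^ CARD('a) * Var 2 ^ (CARD('a) ^ 2) - Var 2 ^ CARD('a) * (Var 1 :: 'a::{field,finite} mpol) ^ (CARD('a) ^ 2)"
  unfolding Var_relation L2_def by (simp add: algebra_simps)

lemma alt_form_1: "alt_form 1 p r = L2 p r" by (simp add: alt_form_def)
lemma alt_form_Q21: "alt_form Q21 p r = p * r ^ (CARD('a) ^ 2) - r * (p :: 'a::{field,finite} mpol) ^ (CARD('a) ^ 2)"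
proof -
  have "alt_form Q21 p r = eval2 (L2 (Var 1) (Var 2) * Q21) p r" by (simp add: alt_form_def eval2_L2)
  then show ?thesis unfolding L2_Q21 by (simp add: eval2_def subs.hom_minus subs.hom_mult subs.hom_power)
qed
lemma alt_form_Q20: "alt_form Q20 p r = p ^ CARD('a) * r ^ (CARD('a) ^ 2) - r ^ CARD('a) * (p :: 'a::{field,finite} mpol) ^ (CARD('a) ^ 2)"
proof -
  have "alt_form Q20 p r = eval2 (L2 (Var 1) (Var 2) * Q20) p r" by (simp add: alt_form_def eval2_L2)
  then show ?thesis unfolding L2_Q20 by (simp add: eval2_def subs.hom_minus subs.hom_mult subs.hom_power)
qed

text \<open>On linearly dependent triples the numerator vanishes, which makes it divisible by the
  Moore determinant.\<close>

lemma numer3_span: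
  assumes "f \<in> Dickson2"
  shows "numer3 b f (Const a1 * u + Const b1 * v) (Const a2 * u + Const b2 * v) (Const a3 * u + Const b3 * v) = 0"
  unfolding numer3_def alt_form_lin[OF assms] by (simp add: mfrob power_mult_distrib Const_pow Const.hom_minus Const.hom_mult algebra_simps)

lemma alt_form_defect_span:
  assumes f: "f \<in> Dickson2"
    and p: "p = Const a1 * u + Const b1 * v" and r: "r = Const a2 * u + Const b2 * v" and s: "s = Const a3 * u + Const b3 * v"
  shows "alt_form f (p + Const c * r) s - alt_form f p s - Const c * alt_form f r s = 0"
proof -
  have 1: "p + Const c * r = Const (a1 + c * a2) * u + Const (b1 + c * b2) * v"
    by (simp add: p r Const.hom_add Const.hom_mult algebra_simps)
  show ?thesis unfolding 1 unfolding p r s alt_form_lin[OF f]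
    by (simp add: Const.hom_minus Const.hom_mult Const.hom_add algebra_simps)
qed

lemma subs_numer3: "subs \<sigma> (numer3 b f p r s) = numer3 b f (subs \<sigma> p) (subs \<sigma> r) (subs \<sigma> s)"
  by (simp add: numer3_def subs.hom_add subs.hom_minus subs.hom_mult subs.hom_power subs_alt_form)

lemma alt_form_swap: "f \<in> Dickson2 \<Longrightarrow> alt_form f r p = - alt_form f p r"
  using alt_form_lin[of f 0 p 1 r 1 0] by (simp add: Const.hom_uminus)

lemma alt_form_add: "alt_form (f + g) p r = alt_form f p r + alt_form g p r" by (simp add: alt_form_def distrib_left)
lemma alt_form_Const: "alt_form (Const c * f) p r = Const c * alt_form f p r" by (simp add: alt_form_def mult.left_commute)
lemma numer3_add: "numer3 b (f + g) p r s = numer3 b f p r s + numer3 b g p r s" by (simp add: numer3_def alt_form_add algebra_simps)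
lemma numer3_Const: "numer3 b (Const c * f) p r s = Const c * numer3 b f p r s"
  unfolding numer3_def alt_form_Const by (simp add: algebra_simps)

lemma V3_prod: "V3 = (\<Prod>l \<in> {1..2} \<rightarrow>\<^sub>E (UNIV :: 'a set). Var 3 - (- (\<Sum>j = 1..2. Const (l j) * (Var j :: 'a::{field,finite} mpol))))"
  unfolding V3_def poly_dickson_poly_2[symmetric] poly_dickson_poly by (simp add: add.commute)

lemma L3_dvd:
  fixes E :: "'a::{field,finite} mpol"
  assumes "subs (Var(1 := 0)) E = 0" "\<And>c. subs (Var(2 := Const c * Var 1)) E = 0"
    and E: "\<And>c d. subs (Var(3 := Const c * Var 1 + Const d * Var 2)) E = 0"
  shows "L3 dvd E"
proof -
  have "L2 (Var 1) (Var 2) dvd E" using assms by (intro L2_dvd) auto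
  then obtain v where v: "E = L2 (Var 1) (Var 2) * v" by (auto elim: dvdE)
  have "V3 dvd v" unfolding V3_prod
  proof (rule prod_forms_dvd)
    fix l :: "nat \<Rightarrow> 'a"
    let ?r = "- (\<Sum>j = 1..2. Const (l j) * Var j) :: 'a mpol"
    have r: "?r = Const (- l 1) * Var 1 + Const (- l 2) * Var 2"
      by (simp add: numeral_2_eq_2 Const.hom_uminus One_nat_def)
    have "subs (Var(3 := ?r)) E = 0" unfolding r by (rule E)
    then have "L2 (Var 1) (Var 2) * subs (Var(3 := ?r)) v = 0" by (simp add: v subs.hom_mult subs_L2)
    then show "subs (Var(3 := ?r)) v = 0" using L2_Var_nz[of 1 2, where 'a='a] by (simp del: fun_upd_apply)
  next
    fix l l' :: "nat \<Rightarrow> 'a" assume l: "l \<in> {1..2} \<rightarrow>\<^sub>E UNIV" "l' \<in> {1..2} \<rightarrow>\<^sub>E UNIV" "l \<noteq> l'"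
    have "subs (Var(3 := z)) (\<Sum>j = 1..2. Const (l' j) * (Var j :: 'a mpol)) = (\<Sum>j = 1..2. Const (l' j) * Var j)" for z
      unfolding subs.hom_sum by (rule sum.cong) (auto simp: subs.hom_mult)
    then show "subs (Var(3 := - (\<Sum>j = 1..2. Const (l j) * Var j))) (Var 3 - - (\<Sum>j = 1..2. Const (l' j) * (Var j :: 'a mpol))) \<noteq> 0"
      using PiE_form_inj[OF l(1,2)] l(3) by (auto simp add: subs.hom_minus subs.hom_uminus subs.hom_add simp del: fun_upd_apply) (simp)
  qed (simp add: finite_PiE)
  then show ?thesis unfolding v L3_def by (rule mult_dvd_mono[OF dvd_refl])
qed

lemma L3_nz [simp]: "L3 \<noteq> (0 :: 'a::{field,finite} mpol)"
proof -
  have "Var 3 - - (\<Sum>j = 1..2. Const (l j) * Var j) \<noteq> (0 :: 'a mpol)" for l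
  proof
    assume "Var 3 - - (\<Sum>j = 1..2. Const (l j) * Var j) = (0 :: 'a mpol)"
    then have "subs (Var(1 := 0, 2 := 0)) (Var 3 - - (\<Sum>j = 1..2. Const (l j) * Var j)) = (0 :: 'a mpol)"
      by (simp only: subs.hom_zero)
    moreover have "subs (Var(1 := 0, 2 := 0)) (\<Sum>j = 1..2. Const (l j) * Var j) = (0 :: 'a mpol)"
      unfolding subs.hom_sum
    proof (rule sum.neutral, rule ballI)
      fix j :: nat assume "j \<in> {1..2}"
      then have "j = 1 \<or> j = 2" by auto
      then show "subs (Var(1 := 0, 2 := 0)) (Const (l j) * Var j) = (0 :: 'a mpol)" by (auto simp: subs.hom_mult)
    qed
    ultimately have "subs (Var(1 := 0, 2 := 0)) (Var 3 :: 'a mpol) = 0" by (simp only: subs.hom_minus subs.hom_uminus) simp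
    then show False by simp
  qed
  then have "V3 \<noteq> (0 :: 'a mpol)" unfolding V3_prod by (simp add: finite_PiE)
  then show ?thesis using L2_Var_nz[of 1 2, where 'a='a] by (simp add: L3_def)
qed

lemma L3_numer3: "L3 = (delta3_numer 2 1 :: 'a::{field,finite} mpol)"
  unfolding L3_def V3_def E2_def numer3_def alt_form_1 Var_relation unfolding L2_def by (simp add: algebra_simps)

lemma L3_Sn: "L3 \<in> Sn 3"
  unfolding L3_def by (intro Sn_mult L2_Sn Sn_Var V3_Sn) auto

lemma alt_form_Sn: assumes "f \<in> Sn 2" "p \<in> Sn n" "r \<in> Sn n" shows "alt_form f p r \<in> Sn n"
  unfolding alt_form_def eval2_def by (intro Sn_mult L2_Sn subs_in_Sn[OF assms(1)]) (use assms in auto)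

lemma numer3_Sn: assumes "f \<in> Dickson2" shows "delta3_numer b f \<in> Sn 3"
  unfolding numer3_def by (intro Sn_add Sn_diff Sn_mult Sn_power alt_form_Sn[OF Dickson2_Sn[OF assms]] Sn_Var) auto

lemma L3_dvd_numer3: assumes f: "f \<in> Dickson2" shows "L3 dvd (delta3_numer b f :: 'a::{field,finite} mpol)"
proof (rule L3_dvd)
  show "subs (Var(1 := 0)) (delta3_numer b f) = 0"
    using numer3_span[OF f, of b 0 "Var 2" 0 "Var 3" 1 0 0 1] by (simp add: subs_numer3)
  show "subs (Var(2 := Const c * Var 1)) (delta3_numer b f) = 0" for c
    using numer3_span[OF f, of b 1 "Var 1" 0 "Var 3" c 0 0 1] by (simp add: subs_numer3)
  show "subs (Var(3 := Const c * Var 1 + Const d * Var 2)) (delta3_numer b f) = 0" for c d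
    using numer3_span[OF f, of b 1 "Var 1" 0 "Var 2" 0 1 c d] by (simp add: subs_numer3)
qed

definition delta3_poly :: "nat \<Rightarrow> 'a::{field,finite} mpol \<Rightarrow> 'a mpol" where
  "delta3_poly b f = (SOME g. g * L3 = delta3_numer b f)"

lemma delta3_poly: assumes "f \<in> Dickson2" shows "delta3_poly b f * L3 = delta3_numer b f"
proof -
  obtain g where "delta3_numer b f = L3 * g" using L3_dvd_numer3[OF assms] by (auto elim: dvdE)
  then have "g * L3 = delta3_numer b f" by (simp add: mult.commute)
  then show ?thesis unfolding delta3_poly_def by (rule someI)
qed

lemma delta3_poly_unique: "f \<in> Dickson2 \<Longrightarrow> g * L3 = delta3_numer b f \<Longrightarrow> g = delta3_poly b f"
  using delta3_poly[of f b] mult_right_cancel[OF L3_nz] by metis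

lemma delta3_poly_Sn: "f \<in> Dickson2 \<Longrightarrow> delta3_poly b f \<in> Sn 3"
  by (rule Sn_quotient[OF delta3_poly L3_Sn numer3_Sn L3_nz])

lemma delta3_poly_add: assumes "f \<in> Dickson2" "g \<in> Dickson2" shows "delta3_poly b (f + g) = delta3_poly b f + delta3_poly b g"
proof -
  have "(delta3_poly b f + delta3_poly b g) * L3 = delta3_numer b (f + g)" by (simp only: distrib_right delta3_poly[OF assms(1)] delta3_poly[OF assms(2)] numer3_add)
  then show ?thesis using delta3_poly_unique[OF Dickson2.add[OF assms]] by metis
qed

lemma delta3_poly_Const: assumes "f \<in> Dickson2" shows "delta3_poly b (Const c * f) = Const c * delta3_poly b f"
proof -
  have "(Const c * delta3_poly b f) * L3 = delta3_numer b (Const c * f)" by (simp only: mult.assoc delta3_poly[OF assms] numer3_Const)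
  then show ?thesis using delta3_poly_unique[OF Dickson2_mult[OF Dickson2_Const assms]] by metis
qed

lemma numer3_swaps:
  assumes "f \<in> Dickson2"
  shows "numer3 b f r p s = - numer3 b f p r s" "numer3 b f s r p = - numer3 b f p r s" "numer3 b f p s r = - numer3 b f p r s"
  using alt_form_swap[OF assms, of p r] alt_form_swap[OF assms, of r s] alt_form_swap[OF assms, of p s]
  by (simp_all add: numer3_def algebra_simps)

text \<open>Numerator and denominator change by the same sign or scalar under transpositions and scalings.
  Under \<open>x\<^sub>1 \<mapsto> x\<^sub>1 + c x\<^sub>2\<close> the numerator changes by \<open>x\<^sub>2\<close> to the power \<open>q\<^sup>b\<close> times a polynomial that the denominator
  divides.\<close>

lemma delta3_poly_invar:
  assumes f: "f \<in> Dickson2" shows "invar b 3 (delta3_poly b f :: 'a::{field,finite} mpol)"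
proof (rule invar_if_elementary)
  let ?g = "delta3_poly b f"
  have fac: "subs \<sigma> ?g * subs \<sigma> L3 = subs \<sigma> (delta3_numer b f)" for \<sigma> using delta3_poly[OF f, of b] by (simp flip: subs.hom_mult)
  show "?g \<in> Sn 3" by (rule delta3_poly_Sn[OF f])
  fix i j :: nat assume ij: "1 \<le> i" "i \<le> 3" "1 \<le> j" "j \<le> 3" "i \<noteq> j"
  then consider "{i, j} = {1, 2}" | "{i, j} = {1, 3}" | "{i, j} = {2, 3}" by (force simp: doubleton_eq_iff)
  then have sw: "subs (swap i j) (delta3_numer c h) = - delta3_numer c h" if "h \<in> Dickson2" for c and h :: "'a mpol"
  proof cases
    case 1
    then have "subs (swap i j) (delta3_numer c h) = numer3 c h (Var 2) (Var 1) (Var 3)" by (auto simp: doubleton_eq_iff subs_numer3)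
    from this numer3_swaps(1)[OF that] show ?thesis by (rule trans)
  next
    case 2
    then have "subs (swap i j) (delta3_numer c h) = numer3 c h (Var 3) (Var 2) (Var 1)" by (auto simp: doubleton_eq_iff subs_numer3)
    from this numer3_swaps(2)[OF that] show ?thesis by (rule trans)
  next
    case 3
    then have "subs (swap i j) (delta3_numer c h) = numer3 c h (Var 1) (Var 3) (Var 2)" by (auto simp: doubleton_eq_iff subs_numer3)
    from this numer3_swaps(3)[OF that] show ?thesis by (rule trans)
  qed
  from sw[OF f, of b] sw[OF Dickson2_1, of 2] have "subs (swap i j) ?g * (- L3) = - (?g * L3)"
    using fac[of "swap i j"] delta3_poly[OF f, of b] by (simp add: L3_numer3 del: fun_upd_apply)
  then have "subs (swap i j) ?g * L3 = ?g * L3" by simp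
  then have "subs (swap i j) ?g = ?g" using mult_right_cancel[OF L3_nz] by blast
  then show "in_ideal b 3 (subs (swap i j) ?g - ?g)" by (simp del: fun_upd_apply)
next
  let ?g = "delta3_poly b f"
  have fac: "subs \<sigma> ?g * subs \<sigma> L3 = subs \<sigma> (delta3_numer b f)" for \<sigma> using delta3_poly[OF f, of b] by (simp flip: subs.hom_mult)
  fix c :: 'a assume c: "c \<noteq> 0"
  let ?\<sigma> = "Var(1 := Const c * Var 1) :: nat \<Rightarrow> 'a mpol"
  have h: "alt_form h (Const c * p) r = Const c * alt_form h p r" if "h \<in> Dickson2" for h p r :: "'a mpol"
    using alt_form_lin[OF that, of c p 0 r 0 1] by simp
  have "subs ?\<sigma> (delta3_numer d h) = Const c * delta3_numer d h" if "h \<in> Dickson2" for d and h :: "'a mpol"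
    unfolding subs_numer3 by (simp add: numer3_def h[OF that] power_mult_distrib Const_pow algebra_simps)
  from this[OF f, of b] this[OF Dickson2_1, of 2] have "subs ?\<sigma> ?g * (Const c * L3) = Const c * (?g * L3)"
    using fac[of ?\<sigma>] delta3_poly[OF f, of b] by (simp add: L3_numer3 del: fun_upd_apply)
  then have "Const c * (subs ?\<sigma> ?g * L3) = Const c * (?g * L3)" by (simp only: mult.left_commute)
  moreover have "Const c \<noteq> (0 :: 'a mpol)" using c Const_eq_iff[of c 0] by simp
  ultimately have "subs ?\<sigma> ?g = ?g" by (simp del: fun_upd_apply)
  then show "in_ideal b 3 (subs ?\<sigma> ?g - ?g)" by (simp del: fun_upd_apply)
next
  let ?g = "delta3_poly b f"
  have fac: "subs \<sigma> ?g * subs \<sigma> L3 = subs \<sigma> (delta3_numer b f)" for \<sigma> using delta3_poly[OF f, of b] by (simp flip: subs.hom_mult)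
  fix c :: 'a
  let ?\<tau> = "Var(1 := Var 1 + Const c * Var 2) :: nat \<Rightarrow> 'a mpol"
  \<comment> \<open>The failure of \<open>h\<close> to be additive in its first argument vanishes on dependent triples.\<close>
  define E where "E h = alt_form h (Var 1 + Const c * Var 2) (Var 3) - alt_form h (Var 1) (Var 3) - Const c * alt_form h (Var 2) (Var 3)"
    for h :: "'a mpol"
  have E_dvd: "L3 dvd E f"
  proof (rule L3_dvd)
    show "subs (Var(1 := 0)) (E f) = 0"
      using alt_form_defect_span[OF f, of 0 0 "Var 2" 0 "Var 3" "Var 2" 1 0 "Var 3" 0 1 c]
      by (simp add: E_def subs.hom_minus subs.hom_mult subs.hom_add subs_alt_form)
    show "subs (Var(2 := Const d * Var 1)) (E f) = 0" for d
      using alt_form_defect_span[OF f, of "Var 1" 1 "Var 1" 0 "Var 3" "Const d * Var 1" d 0 "Var 3" 0 1 c]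
      by (simp add: E_def subs.hom_minus subs.hom_mult subs.hom_add subs_alt_form)
    show "subs (Var(3 := Const d * Var 1 + Const e * Var 2)) (E f) = 0" for d e
      using alt_form_defect_span[OF f, of "Var 1" 1 "Var 1" 0 "Var 2" "Var 2" 0 1 "Const d * Var 1 + Const e * Var 2" d e c]
      by (simp add: E_def subs.hom_minus subs.hom_mult subs.hom_add subs_alt_form)
  qed
  then obtain v where v: "E f = L3 * v" by (auto elim: dvdE)
  have h12: "alt_form h (Var 1 + Const c * Var 2) (Var 2) = alt_form h (Var 1) (Var 2)" if "h \<in> Dickson2" for h :: "'a mpol"
    using alt_form_lin[OF that, of 1 "Var 1" c "Var 2" 0 1] by simp
  have N: "subs ?\<tau> (delta3_numer d h) = delta3_numer d h - Var 2 ^ (CARD('a) ^ d) * E h" if "h \<in> Dickson2" for d and h :: "'a mpol"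
    unfolding subs_numer3 by (simp add: numer3_def h12[OF that] mfrob power_mult_distrib Const_pow E_def algebra_simps)
  have "E 1 = 0" by (simp add: E_def alt_form_1 L2_def mfrob1 power_mult_distrib Const_pow1 algebra_simps)
  then have "subs ?\<tau> L3 = L3" using N[OF Dickson2_1, of 2] by (simp add: L3_numer3 del: fun_upd_apply)
  then have "subs ?\<tau> ?g * L3 = ?g * L3 - Var 2 ^ (CARD('a) ^ b) * (L3 * v)"
    using fac[of ?\<tau>] N[OF f, of b] delta3_poly[OF f, of b] by (simp add: v del: fun_upd_apply)
  also have "\<dots> = (?g - Var 2 ^ (CARD('a) ^ b) * v) * L3" by (simp add: algebra_simps)
  finally have "subs ?\<tau> ?g = ?g - Var 2 ^ (CARD('a) ^ b) * v" using mult_right_cancel[OF L3_nz] by blast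
  then show "in_ideal b 3 (subs ?\<tau> ?g - ?g)"
    by (simp del: fun_upd_apply) (intro in_ideal_uminus in_ideal_mult in_ideal_Var, auto)
qed simp

section \<open>Division of \<open>x\<^sub>3\<close> to the power \<open>q\<^sup>b\<close> by a monic \<open>q\<close>-polynomial\<close>

text \<open>The quotient and the coefficients of \<open>z\<close> and \<open>z\<^sup>q\<close> in the remainder on division of \<open>z\<close> to the power \<open>q\<^sup>b\<close> by
  \<open>E2 z\<close> at \<open>z = x\<^sub>3\<close>. The step raises the previous equation to the power \<open>q\<close>.\<close>

primrec V3_division :: "nat \<Rightarrow> 'a::{field,finite} mpol \<times> 'a mpol \<times> 'a mpol" where
  "V3_division 0 = (0, 1, 0)"
| "V3_division (Suc b) = (case V3_division b of (H, \<alpha>, \<beta>) \<Rightarrow>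
     (V3 ^ (CARD('a) - 1) * H ^ CARD('a) + \<beta> ^ CARD('a), - (Q20 * \<beta> ^ CARD('a)), \<alpha> ^ CARD('a) + Q21 * \<beta> ^ CARD('a)))"

definition V3_quot :: "nat \<Rightarrow> 'a::{field,finite} mpol" where "V3_quot b = fst (V3_division b)"
definition V3_rem0 :: "nat \<Rightarrow> 'a::{field,finite} mpol" where "V3_rem0 b = fst (snd (V3_division b))"
definition V3_rem1 :: "nat \<Rightarrow> 'a::{field,finite} mpol" where "V3_rem1 b = snd (snd (V3_division b))"

lemma V3_division_0: "V3_quot 0 = 0" "V3_rem0 0 = 1" "V3_rem1 0 = 0" by (simp_all add: V3_quot_def V3_rem0_def V3_rem1_def)
lemma V3_division_Suc: "V3_quot (Suc b) = V3 ^ (CARD('a) - 1) * V3_quot b ^ CARD('a) + (V3_rem1 b ^ CARD('a) :: 'a::{field,finite} mpol)"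
  "V3_rem0 (Suc b) = - (Q20 * V3_rem1 b ^ CARD('a) :: 'a mpol)" "V3_rem1 (Suc b) = (V3_rem0 b ^ CARD('a) + Q21 * V3_rem1 b ^ CARD('a) :: 'a mpol)"
  by (simp_all add: V3_quot_def V3_rem0_def V3_rem1_def split: prod.split)

lemma V3_rem0_V3_rem1_Dickson2: "V3_rem0 b \<in> (Dickson2 :: 'a::{field,finite} mpol set) \<and> V3_rem1 b \<in> (Dickson2 :: 'a::{field,finite} mpol set)"
  by (induction b) (auto simp: V3_division_0 V3_division_Suc intro!: Dickson2.add Dickson2_uminus Dickson2_mult Dickson2_power)
lemmas V3_rem0_Dickson2 = V3_rem0_V3_rem1_Dickson2[THEN conjunct1] and V3_rem1_Dickson2 = V3_rem0_V3_rem1_Dickson2[THEN conjunct2]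

lemma power_reduction_root:
  assumes "E2 z = 0" shows "z ^ (CARD('a) ^ b) = V3_rem0 b * z + V3_rem1 b * (z :: 'a::{field,finite} mpol) ^ CARD('a)"
proof (induction b)
  case (Suc b)
  have z: "z ^ (CARD('a) ^ 2) = Q21 * z ^ CARD('a) - Q20 * z"
    using assms by (simp add: E2_def algebra_simps eq_neg_iff_add_eq_0 add_eq_0_iff2)
  have "z ^ (CARD('a) ^ Suc b) = (z ^ (CARD('a) ^ b)) ^ CARD('a)" by (simp add: mult.commute flip: power_mult)
  also have "\<dots> = V3_rem0 b ^ CARD('a) * z ^ CARD('a) + V3_rem1 b ^ CARD('a) * z ^ (CARD('a) ^ 2)"
    unfolding Suc mfrob1 by (simp add: power_mult_distrib power2_eq_square flip: power_mult)
  also have "\<dots> = V3_rem0 (Suc b) * z + V3_rem1 (Suc b) * z ^ CARD('a)"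
    unfolding z by (simp add: V3_division_Suc algebra_simps)
  finally show ?case .
qed (simp add: V3_division_0)

lemma power_reduction_Var3:
  "(Var 3 :: 'a::{field,finite} mpol) ^ (CARD('a) ^ b) = V3 * V3_quot b + V3_rem0 b * Var 3 + V3_rem1 b * Var 3 ^ CARD('a)"
proof (induction b)
  case (Suc b)
  let ?q = "CARD('a)" let ?z = "Var 3 :: 'a mpol"
  have z: "?z ^ (?q ^ 2) = V3 + Q21 * ?z ^ ?q - Q20 * ?z" by (simp add: V3_def E2_def)
  have Vq: "V3 ^ ?q = V3 * (V3 :: 'a mpol) ^ (?q - 1)" using card_field_ge2[where 'a='a] by (simp flip: power_Suc)
  have "?z ^ (?q ^ Suc b) = (?z ^ (?q ^ b)) ^ ?q" by (simp add: mult.commute flip: power_mult)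
  also have "\<dots> = V3 ^ ?q * V3_quot b ^ ?q + V3_rem0 b ^ ?q * ?z ^ ?q + V3_rem1 b ^ ?q * ?z ^ (?q ^ 2)"
    unfolding Suc mfrob1 by (simp add: power_mult_distrib power2_eq_square flip: power_mult)
  also have "\<dots> = V3 * V3_quot (Suc b) + V3_rem0 (Suc b) * ?z + V3_rem1 (Suc b) * ?z ^ ?q"
    unfolding z Vq by (simp add: V3_division_Suc algebra_simps)
  finally show ?case .
qed (simp add: V3_division_0)

lemma Var_reduction:
  "(Var 1 :: 'a::{field,finite} mpol) ^ (CARD('a) ^ b) = V3_rem0 b * Var 1 + V3_rem1 b * Var 1 ^ CARD('a)"
  "(Var 2 :: 'a mpol) ^ (CARD('a) ^ b) = V3_rem0 b * Var 2 + V3_rem1 b * Var 2 ^ CARD('a)"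
  by (rule power_reduction_root, simp)+

lemma L2_V3_rem1: "L2 (Var 1) (Var 2) * V3_rem1 b = Var 1 * Var 2 ^ (CARD('a) ^ b) - Var 2 * (Var 1 :: 'a::{field,finite} mpol) ^ (CARD('a) ^ b)"
  unfolding Var_reduction L2_def by (simp add: algebra_simps)

lemma L2_V3_rem0: "L2 (Var 1) (Var 2) * V3_rem0 b = Var 1 ^ (CARD('a) ^ b) * Var 2 ^ CARD('a) - Var 2 ^ (CARD('a) ^ b) * (Var 1 :: 'a::{field,finite} mpol) ^ CARD('a)"
  unfolding Var_reduction L2_def by (simp add: algebra_simps)

lemma in_ideal_L2_V3_rem1: "in_ideal b 2 (L2 (Var 1) (Var 2) * V3_rem1 b)"
  unfolding L2_V3_rem1 by (intro in_ideal_diff in_ideal_mult2 in_ideal_Var) auto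
lemma in_ideal_L2_V3_rem0: "in_ideal b 2 (L2 (Var 1) (Var 2) * V3_rem0 b)"
  unfolding L2_V3_rem0 by (intro in_ideal_diff in_ideal_mult in_ideal_Var) auto

lemma in_ideal_L2_V3_V3_quot: "in_ideal b 3 (L2 (Var 1) (Var 2) * (V3 * V3_quot b) :: 'a::{field,finite} mpol)"
proof -
  let ?L = "L2 (Var 1) (Var 2) :: 'a mpol"
  have e: "?L * (V3 * V3_quot b) = ?L * Var 3 ^ (CARD('a) ^ b) - (?L * V3_rem0 b) * Var 3 - (?L * V3_rem1 b) * Var 3 ^ CARD('a)"
    unfolding power_reduction_Var3 by (simp add: algebra_simps)
  have "in_ideal b 3 (?L * V3_rem0 b)" "in_ideal b 3 (?L * V3_rem1 b)"
    using in_ideal_mono[OF in_ideal_L2_V3_rem0, of b b 3] in_ideal_mono[OF in_ideal_L2_V3_rem1, of b b 3] by simp_all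
  then have "in_ideal b 3 ((?L * V3_rem0 b) * Var 3)" "in_ideal b 3 ((?L * V3_rem1 b) * Var 3 ^ CARD('a))" by (auto intro: in_ideal_mult)
  moreover have "in_ideal b 3 (?L * Var 3 ^ (CARD('a) ^ b))" by (rule in_ideal_mult2[OF in_ideal_Var]) auto
  ultimately show ?thesis unfolding e by (intro in_ideal_diff)
qed

text \<open>\<open>V3\<close> is monic in \<open>x\<^sub>3\<close>, hence no zero divisor modulo an ideal generated by polynomials in
  \<open>x\<^sub>1\<close> and \<open>x\<^sub>2\<close>: look at a monomial outside the ideal with the largest exponent of \<open>x\<^sub>3\<close>.\<close>

lemma in_ideal_V3_cancel:
  fixes Z :: "'a::{field,finite} mpol"
  assumes "in_ideal b 2 (V3 * Z)" shows "in_ideal b 2 Z"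
proof (rule ccontr)
  let ?q = "CARD('a)"
  let ?B = "{t \<in> Poly_Mapping.keys Z. \<forall>i\<in>{1..2}. Poly_Mapping.lookup t i < ?q ^ b}"
  assume "\<not> in_ideal b 2 Z"
  then have "?B \<noteq> {}" by (auto simp: in_ideal_def not_le)
  define d where "d = Max ((\<lambda>t. Poly_Mapping.lookup t 3) ` ?B)"
  have "d \<in> (\<lambda>t. Poly_Mapping.lookup t 3) ` ?B" unfolding d_def by (rule Max_in) (use \<open>?B \<noteq> {}\<close> in auto)
  then obtain t where t: "t \<in> ?B" "Poly_Mapping.lookup t 3 = d" by auto
  have mx: "Poly_Mapping.lookup s 3 \<le> d" if "s \<in> ?B" for s
    unfolding d_def by (rule Max_ge) (use that in auto)
  \<comment> \<open>Only the leading term of \<open>V3\<close> contributes to the coefficient at \<open>?t\<close>.\<close>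
  let ?t = "Poly_Mapping.single 3 (?q ^ 2) + t"
  have low: "Poly_Mapping.lookup (G * Var 3 ^ k * Z) ?t = 0" if G: "G \<in> Sn 2" and k: "k < ?q ^ 2" for G :: "'a mpol" and k
  proof (rule ccontr)
    assume "\<not> ?thesis"
    then have "?t \<in> Poly_Mapping.keys (G * (Var 3 ^ k * Z))" by (simp add: in_keys_iff mult.assoc)
    then obtain u v where uv: "?t = u + v" "u \<in> Poly_Mapping.keys G" "v \<in> Poly_Mapping.keys (Var 3 ^ k * Z)"
      using keys_mult[of G "Var 3 ^ k * Z"] by blast
    obtain z where z: "v = Poly_Mapping.single 3 k + z" "z \<in> Poly_Mapping.keys Z"
      using keys_mult[of "Var 3 ^ k" Z] uv(3) by (auto simp: Var_power)
    have "Poly_Mapping.keys u \<subseteq> {1..2}" using G uv(2) by (simp add: Sn_iff)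
    then have "3 \<notin> Poly_Mapping.keys u" by auto
    then have "Poly_Mapping.lookup u 3 = 0" by (simp add: in_keys_iff)
    moreover have l: "Poly_Mapping.lookup ?t i = Poly_Mapping.lookup u i + (Poly_Mapping.lookup (Poly_Mapping.single 3 k) i + Poly_Mapping.lookup z i)" for i
      unfolding uv(1) z(1) by (simp add: lookup_add)
    ultimately have "?q ^ 2 + d = k + Poly_Mapping.lookup z 3" using l[of 3] t(2) by (simp add: lookup_add)
    then have "d < Poly_Mapping.lookup z 3" using k by linarith
    moreover have "Poly_Mapping.lookup z i < ?q ^ b" if "i \<in> {1..2}" for i
    proof -
      have "Poly_Mapping.lookup t i = Poly_Mapping.lookup u i + Poly_Mapping.lookup z i"
        using l[of i] that by (simp add: lookup_add lookup_single when_def)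
      moreover have "Poly_Mapping.lookup t i < ?q ^ b" using t(1) that by simp
      ultimately show ?thesis by linarith
    qed
    ultimately show False using mx[of z] z(2) by auto
  qed
  have q: "2 \<le> ?q" by (rule card_field_ge2)
  have "?q ^ 1 < ?q ^ 2" by (rule power_strict_increasing) (use q in auto)
  then have qq: "?q < ?q ^ 2" "1 < ?q ^ 2" using q by simp_all
  have "V3 * Z = Var 3 ^ (?q ^ 2) * Z - Q21 * Var 3 ^ ?q * Z + Q20 * Var 3 ^ 1 * Z"
    by (simp add: V3_def E2_def algebra_simps)
  then have "Poly_Mapping.lookup (V3 * Z) ?t = Poly_Mapping.lookup Z t"
    using low[OF Q21_Sn qq(1)] low[OF Q20_Sn qq(2)]
    by (simp add: lookup_minus lookup_add Var_power lookup_single_mult)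
  moreover have "Poly_Mapping.lookup (V3 * Z) ?t = 0"
  proof (rule lookup_in_ideal[OF assms])
    fix i :: nat assume "1 \<le> i" "i \<le> 2"
    then show "Poly_Mapping.lookup ?t i < ?q ^ b" using t(1) by (auto simp: lookup_add lookup_single when_def)
  qed
  ultimately show False using t(1) by (simp add: in_keys_iff)
qed

text \<open>Multiply by \<open>V3\<close>, which can be cancelled again. The numerator has the term \<open>L f\<close> times \<open>x\<^sub>3\<close> to the power \<open>q\<^sup>b\<close>, whose
  division by \<open>V3\<close> gives \<open>L f V H\<close> and a remainder that lies in the ideal, as \<open>L \<alpha>\<close> and \<open>L \<beta>\<close> do.\<close>

lemma L2_delta3_poly:
  assumes f: "f \<in> Dickson2"
  shows "in_ideal b 2 (L2 (Var 1) (Var 2) * (delta3_poly b f - f * V3_quot b) :: 'a::{field,finite} mpol)"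
proof (rule in_ideal_V3_cancel)
  let ?L = "L2 (Var 1) (Var 2) :: 'a mpol" let ?Q = "CARD('a) ^ b"
  have h12: "alt_form f (Var 1) (Var 2) = ?L * f" by (simp add: alt_form_def eval2_id[OF Dickson2_Sn[OF f]])
  have "V3 * (?L * (delta3_poly b f - f * V3_quot b)) = delta3_poly b f * L3 - ?L * f * (V3 * V3_quot b)"
    by (simp add: L3_def algebra_simps)
  also have "\<dots> = Var 1 ^ ?Q * alt_form f (Var 2) (Var 3) - Var 2 ^ ?Q * alt_form f (Var 1) (Var 3)
      + f * ((?L * V3_rem0 b) * Var 3 + (?L * V3_rem1 b) * Var 3 ^ CARD('a))"
  proof -
    have e: "V3 * V3_quot b = (Var 3 :: 'a mpol) ^ ?Q - V3_rem0 b * Var 3 - V3_rem1 b * Var 3 ^ CARD('a)"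
      using power_reduction_Var3[of b, where 'a='a, symmetric] by (simp only: add.assoc eq_diff_eq diff_diff_eq)
    show ?thesis unfolding delta3_poly[OF f] numer3_def h12 e by (simp add: algebra_simps)
  qed
  also have "in_ideal b 2 \<dots>"
    by (intro in_ideal_add in_ideal_diff in_ideal_mult in_ideal_mult2[of _ _ _ f] in_ideal_Var in_ideal_L2_V3_rem0 in_ideal_L2_V3_rem1) auto
  finally show "in_ideal b 2 (V3 * (?L * (delta3_poly b f - f * V3_quot b)))" .
qed

section \<open>The invariants built from \<open>\<delta>\<^sub>3\<close>\<close>

abbreviation L12 :: "'a::{field,finite} mpol" where "L12 \<equiv> L2 (Var 1) (Var 2)"

text \<open>The polynomials whose classes form the subspace for \<open>n = 3\<close>, \<open>k = 2\<close>; the witness \<open>g\<close> is meant to be the \<open>f\<close>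
  of a \<open>\<delta>\<^sub>3\<^sub>;\<^sub>m(f)\<close> that differs from \<open>u\<close> by an element of \<open>B1\<close>, see \<open>B2_decompose\<close>.\<close>

definition B2 :: "nat \<Rightarrow> 'a::{field,finite} mpol set" where
  "B2 m = {u \<in> Sn 3. invar m 3 u \<and> (\<exists>g\<in>Dickson2. in_ideal m 3 (L12 * (u - g * V3_quot m)))}"

lemma B2I: "u \<in> Sn 3 \<Longrightarrow> invar m 3 u \<Longrightarrow> g \<in> Dickson2 \<Longrightarrow> in_ideal m 3 (L12 * (u - g * V3_quot m)) \<Longrightarrow> u \<in> B2 m"
  by (auto simp: B2_def)

lemma B1_B2: "u \<in> B1 m 3 \<Longrightarrow> u \<in> B2 m"
  by (rule B2I[of _ _ 0]) (auto simp: B1_def)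

lemma B2_add: assumes "u \<in> B2 m" "v \<in> B2 m" shows "u + v \<in> B2 m"
proof -
  obtain g h where g: "g \<in> Dickson2" "in_ideal m 3 (L12 * (u - g * V3_quot m))" and h: "h \<in> Dickson2" "in_ideal m 3 (L12 * (v - h * V3_quot m))"
    using assms by (auto simp: B2_def)
  have "L12 * (u + v - (g + h) * V3_quot m) = L12 * (u - g * V3_quot m) + L12 * (v - h * V3_quot m)" by (simp add: algebra_simps)
  then have "in_ideal m 3 (L12 * (u + v - (g + h) * V3_quot m))" using g h by auto
  then show ?thesis using assms Dickson2.add[OF g(1) h(1)] by (intro B2I[of _ _ "g + h"]) (auto simp: B2_def intro: invar_add)
qed

text \<open>\<open>L V H\<close> lies in the ideal, so only the class of \<open>Q\<close> modulo \<open>V3\<close> matters.\<close>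

lemma B2_mult:
  assumes u: "u \<in> B2 m" and Q: "Q \<in> Sn 3" "\<And>g. g \<in> GL 3 \<Longrightarrow> lin_subst 3 g Q = Q"
    and G: "G \<in> Dickson2" "Q = G + V3 * R"
  shows "Q * u \<in> B2 m"
proof -
  obtain g where g: "g \<in> Dickson2" "in_ideal m 3 (L12 * (u - g * V3_quot m))" using u by (auto simp: B2_def)
  have e: "L12 * (Q * u - G * g * V3_quot m) = Q * (L12 * (u - g * V3_quot m)) + (L12 * (V3 * V3_quot m)) * (R * g)"
    unfolding G(2) by (simp add: algebra_simps)
  have "in_ideal m 3 (L12 * (Q * u - G * g * V3_quot m))"
    unfolding e by (intro in_ideal_add in_ideal_mult2[OF g(2)] in_ideal_mult[OF in_ideal_L2_V3_V3_quot])
  then show ?thesis using u Q g(1) G(1) by (intro B2I[of _ _ "G * g"]) (auto simp: B2_def intro: invar_mult)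
qed

lemma B2_Const: "u \<in> B2 m \<Longrightarrow> Const c * u \<in> B2 m"
  by (rule B2_mult[of _ _ _ "Const c" 0]) (auto simp: lin_subst_subs)

lemma B2_0: "0 \<in> B2 m" by (rule B1_B2[OF B1_0])
lemma B2_diff: "u \<in> B2 m \<Longrightarrow> v \<in> B2 m \<Longrightarrow> u - v \<in> B2 m"
  using B2_add[OF _ B2_Const[of v m "-1"], of u] by (simp add: Const.hom_uminus)
lemma B2_sum: "(\<And>i. i \<in> A \<Longrightarrow> f i \<in> B2 m) \<Longrightarrow> sum f A \<in> B2 m"
  by (induction A rule: infinite_finite_induct) (auto simp: B2_0 B2_add)

lemma power_card_minus_1: "z ^ (CARD('a::{field,finite}) - 1) = z * z ^ (CARD('a) - 2)"
  for z :: "'b::monoid_mult"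
proof -
  have "CARD('a) - 1 = Suc (CARD('a) - 2)" using card_field_ge2[where 'a='a] by linarith
  then show ?thesis by (simp only: power_Suc)
qed

lemma B2_dickson:
  assumes u: "u \<in> B2 m" and i: "i < 3" shows "(dickson 3 i :: 'a::{field,finite} mpol) * u \<in> B2 m"
proof -
  have V: "V3 ^ (CARD('a) - 1) = V3 * (V3 :: 'a mpol) ^ (CARD('a) - 2)" by (rule power_card_minus_1)
  have "\<exists>G R. G \<in> Dickson2 \<and> (dickson 3 i :: 'a mpol) = G + V3 * R"
  proof -
    consider "i = 0" | "i = 1" | "i = 2" using i by linarith
    then show ?thesis
    proof cases
      case 1 then show ?thesis unfolding 1 dickson_3 V
        by (intro exI[of _ 0] exI[of _ "Q20 * V3 ^ (CARD('a) - 2)"]) (auto simp: mult_ac)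
    next
      case 2 then show ?thesis unfolding 2 dickson_3 V
        by (intro exI[of _ "Q20 ^ CARD('a)"] exI[of _ "Q21 * V3 ^ (CARD('a) - 2)"]) (auto simp: mult_ac)
    next
      case 3 then show ?thesis unfolding 3 dickson_3 V
        by (intro exI[of _ "Q21 ^ CARD('a)"] exI[of _ "V3 ^ (CARD('a) - 2)"]) auto
    qed
  qed
  then show ?thesis using B2_mult[OF u dickson_Sn dickson_invariant] by blast
qed

lemma delta3_poly_B2: assumes "f \<in> Dickson2" shows "delta3_poly m f \<in> B2 m"
  by (rule B2I[OF delta3_poly_Sn[OF assms] delta3_poly_invar[OF assms] assms]) (rule in_ideal_mono[OF L2_delta3_poly[OF assms]], auto)

lemma delta3_poly_T_B1:
  assumes f: "f \<in> Dickson2" and T: "in_ideal m 2 (L12 * f)" shows "delta3_poly m f \<in> B1 m 3"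
proof -
  have "L12 * delta3_poly m f = L12 * (delta3_poly m f - f * V3_quot m) + (L12 * f) * V3_quot m" by (simp add: algebra_simps)
  moreover have "in_ideal m 3 (L12 * (delta3_poly m f - f * V3_quot m))" "in_ideal m 3 (L12 * f)"
    using in_ideal_mono[OF L2_delta3_poly[OF f], of m m 3] in_ideal_mono[OF T, of m 3] by simp_all
  ultimately have "in_ideal m 3 (L12 * delta3_poly m f)" by (simp add: in_ideal_add in_ideal_mult)
  then show ?thesis using delta3_poly_Sn[OF f] delta3_poly_invar[OF f] by (simp add: B1_def)
qed

text \<open>From the recursion \<open>H\<^sub>m\<^sub>+\<^sub>1 = V\<^sup>q\<^sup>-\<^sup>1 H\<^sub>m\<^sup>q + \<beta>\<^sub>m\<^sup>q\<close> and \<open>L V H\<^sub>m, L \<beta>\<^sub>m \<in> I\<close>.\<close>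

lemma delta3_poly_Suc_B1:
  assumes f: "f \<in> Dickson2" shows "delta3_poly (Suc m) f \<in> (B1 m 3 :: 'a::{field,finite} mpol set)"
proof -
  let ?q = "CARD('a)"
  have q: "2 \<le> ?q" by (rule card_field_ge2)
  have p: "z ^ ?q = z * z ^ (?q - 1)" for z :: "'a mpol" using q by (simp flip: power_Suc)
  have e: "L12 * delta3_poly (Suc m) f = L12 * (delta3_poly (Suc m) f - f * V3_quot (Suc m))
      + (L12 * (V3 * V3_quot m)) * (V3 ^ (?q - 2) * V3_quot m ^ (?q - 1) * f) + (L12 * V3_rem1 m) * (V3_rem1 m ^ (?q - 1) * f)"
    unfolding V3_division_Suc p power_card_minus_1[of "V3 :: 'a mpol", where 'a='a] by (simp add: algebra_simps)
  have "in_ideal m 3 (L12 * (delta3_poly (Suc m) f - f * V3_quot (Suc m)))"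
    by (rule in_ideal_mono[OF L2_delta3_poly[OF f]]) auto
  moreover have "in_ideal m 3 (L12 * V3_rem1 m :: 'a mpol)" by (rule in_ideal_mono[OF in_ideal_L2_V3_rem1]) auto
  ultimately have "in_ideal m 3 (L12 * delta3_poly (Suc m) f)"
    unfolding e by (intro in_ideal_add in_ideal_mult[OF in_ideal_L2_V3_V3_quot] in_ideal_mult[of m 3 "L12 * V3_rem1 m"])
  moreover have "invar m 3 (delta3_poly (Suc m) f)" by (rule invar_mono[OF delta3_poly_invar[OF f]]) simp
  ultimately show ?thesis using delta3_poly_Sn[OF f] by (simp add: B1_def)
qed

lemma B2_decompose:
  assumes u: "u \<in> B2 m" obtains g where "g \<in> Dickson2" "u - delta3_poly m g \<in> B1 m 3"
proof -
  obtain g where g: "g \<in> Dickson2" "in_ideal m 3 (L12 * (u - g * V3_quot m))" using u by (auto simp: B2_def)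
  have e: "L12 * (u - delta3_poly m g) = L12 * (u - g * V3_quot m) - L12 * (delta3_poly m g - g * V3_quot m)" by (simp add: algebra_simps)
  have "in_ideal m 3 (L12 * (delta3_poly m g - g * V3_quot m))" by (rule in_ideal_mono[OF L2_delta3_poly[OF g(1)]]) auto
  then have "in_ideal m 3 (L12 * (u - delta3_poly m g))" unfolding e using g(2) by auto
  then have "u - delta3_poly m g \<in> B1 m 3"
    using u delta3_poly_Sn[OF g(1)] delta3_poly_invar[OF g(1)] by (auto simp: B1_def B2_def intro: invar_diff)
  then show ?thesis using that g(1) by blast
qed

section \<open>Annihilation by Dickson invariants\<close>

lemma in_ideal_Q20: "u \<in> B1 m n \<Longrightarrow> in_ideal m n ((Q20 :: 'a::{field,finite} mpol) * u)"
proof -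
  assume u: "u \<in> B1 m n"
  have "Q20 * u = L12 ^ (CARD('a) - 2) * (L12 * u)"
    unfolding Q20_def power_card_minus_1[of "L12 :: 'a mpol", where 'a='a] by (simp only: mult_ac)
  moreover have "in_ideal m n (L12 * u)" using u by (simp add: B1_def)
  ultimately show ?thesis by (metis in_ideal_mult2)
qed

lemma V3_multiples:
  obtains r s where "Var 1 * V3 = L2 (Var 1) (Var 3) * (r :: 'a::{field,finite} mpol)" "Var 2 * V3 = L2 (Var 2) (Var 3) * (s :: 'a mpol)"
proof -
  let ?q = "CARD('a)"
  define v where "v = (Var 2 ^ ?q - Var 1 ^ (?q - 1) * Var 2 :: 'a mpol)"
  define g where "g = (Var 3 ^ ?q - Var 1 ^ (?q - 1) * Var 3 :: 'a mpol)"
  have q: "2 \<le> ?q" by (rule card_field_ge2)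
  have "V3 = g ^ ?q - v ^ (?q - 1) * g" unfolding V3_def E2_factor v_def g_def ..
  also have "\<dots> = g * (g ^ (?q - 1) - v ^ (?q - 1))"
    using q by (simp add: right_diff_distrib mult.commute flip: power_Suc)
  finally have V: "V3 = g * (g ^ (?q - 1) - v ^ (?q - 1))" .
  have "Var 1 * g = L2 (Var 1) (Var 3)"
    using q by (simp add: g_def L2_def right_diff_distrib mult.assoc[symmetric] flip: power_Suc)
  then have 1: "Var 1 * V3 = L2 (Var 1) (Var 3) * (g ^ (?q - 1) - v ^ (?q - 1))"
    unfolding V by (simp only: mult.assoc[symmetric])
  have sw: "subs (swap 1 2) f = f" if f: "f \<in> Dickson2" for f :: "'a mpol"
  proof -
    have "subs (swap 1 2) f = eval2 f (Var 2) (Var 1)"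
      unfolding eval2_def
    proof (rule subs_cong[OF Dickson2_Sn[OF f]])
      fix i :: nat assume "1 \<le> i" "i \<le> 2"
      then have "i = 1 \<or> i = 2" by linarith
      then show "swap 1 2 i = (if i = 1 then Var 2 else Var 1 :: 'a mpol)" by auto
    qed
    also have "\<dots> = f" using Dickson2_eval2[OF f, of 0 0 1 1 "Var 1" "Var 2"] eval2_id[OF Dickson2_Sn[OF f]] by simp
    finally show ?thesis .
  qed
  have "subs (swap 1 2) (V3 :: 'a mpol) = V3"
    unfolding V3_def E2_def using sw[OF Dickson2_A] sw[OF Dickson2_D] by (simp add: subs.hom_minus subs.hom_add subs.hom_mult subs.hom_power)
  then have "Var 2 * V3 = subs (swap 1 2) (Var 1 * V3 :: 'a mpol)" by (simp add: subs.hom_mult)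
  also have "\<dots> = L2 (Var 2) (Var 3) * subs (swap 1 2) (g ^ (?q - 1) - v ^ (?q - 1))"
    unfolding 1 by (simp add: subs.hom_mult subs_L2)
  finally show ?thesis using that 1 by blast
qed

lemma Q21_multiple: obtains r s where "Q21 = Var 1 * r + Var 2 * (s :: 'a::{field,finite} mpol)"
proof -
  let ?q = "CARD('a)"
  have q: "2 \<le> ?q" by (rule card_field_ge2)
  have "0 < ?q * (?q - 1)" using q by simp
  then have 1: "(Var 1 :: 'a mpol) ^ (?q * (?q - 1)) = Var 1 * Var 1 ^ (?q * (?q - 1) - 1)" by (simp flip: power_Suc)
  have "(Var 2 :: 'a mpol) ^ ?q - Var 1 ^ (?q - 1) * Var 2 = Var 2 * (Var 2 ^ (?q - 1) - Var 1 ^ (?q - 1))"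
    using q by (simp add: right_diff_distrib mult.commute flip: power_Suc)
  then have "Q21 = Var 1 * Var 1 ^ (?q * (?q - 1) - 1) + Var 2 * (((Var 2 :: 'a mpol) ^ (?q - 1) - Var 1 ^ (?q - 1)) * (Var 2 ^ ?q - Var 1 ^ (?q - 1) * Var 2) ^ (?q - 2))"
    unfolding Q21_def 1 power_card_minus_1[of "(Var 2 :: 'a mpol) ^ ?q - Var 1 ^ (?q - 1) * Var 2", where 'a='a] by (simp add: mult.assoc)
  then show ?thesis using that by blast
qed

lemma B1_annihilated_2: "u \<in> B1 m 2 \<Longrightarrow> in_ideal m 2 (dickson 2 0 * u)"
  unfolding dickson_2 by (rule in_ideal_Q20)

text \<open>\<open>Q\<^sub>3\<^sub>,\<^sub>0 = D V\<^sup>q\<^sup>-\<^sup>1\<close> and \<open>Q\<^sub>3\<^sub>,\<^sub>1 = D\<^sup>q + A V\<^sup>q\<^sup>-\<^sup>1\<close> with \<open>D = L\<^sup>q\<^sup>-\<^sup>1\<close>. As \<open>A\<close> lies in the ideal \<open>(x\<^sub>1, x\<^sub>2)\<close>, it remains that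
  \<open>x\<^sub>1 V\<close> and \<open>x\<^sub>2 V\<close> are multiples of the forms in \<open>x\<^sub>1, x\<^sub>3\<close> and in \<open>x\<^sub>2, x\<^sub>3\<close>.\<close>

lemma B1_annihilated_3:
  assumes u: "(u :: 'a::{field,finite} mpol) \<in> B1 m 3" and i: "i < 2"
  shows "in_ideal m 3 (dickson 3 i * u)"
proof -
  consider "i = 0" | "i = 1" using i by linarith
  then show ?thesis
  proof cases
    case 1
    have "dickson 3 0 * u = V3 ^ (CARD('a) - 1) * (Q20 * u)" by (simp add: dickson_3 mult_ac)
    then show ?thesis unfolding 1 using in_ideal_Q20[OF u] by (metis in_ideal_mult2)
  next
    case 2
    let ?q = "CARD('a)"
    obtain r s where V: "Var 1 * V3 = L2 (Var 1) (Var 3) * (r :: 'a mpol)" "Var 2 * V3 = L2 (Var 2) (Var 3) * (s :: 'a mpol)"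
      by (rule V3_multiples)
    obtain a b where A: "Q21 = Var 1 * a + Var 2 * (b :: 'a mpol)" by (rule Q21_multiple)
    have "Q21 * V3 ^ (?q - 1) * u = ((Var 1 * V3) * a + (Var 2 * V3) * b) * V3 ^ (?q - 2) * u"
      unfolding A power_card_minus_1[of "V3 :: 'a mpol", where 'a='a] by (simp add: algebra_simps)
    also have "\<dots> = (L2 (Var 1) (Var 3) * u) * (r * a * V3 ^ (?q - 2)) + (L2 (Var 2) (Var 3) * u) * (s * b * V3 ^ (?q - 2))"
      unfolding V by (simp add: algebra_simps)
    also have "in_ideal m 3 \<dots>" by (intro in_ideal_add in_ideal_mult B1_pair[OF u]) auto
    finally have 1: "in_ideal m 3 (Q21 * V3 ^ (?q - 1) * u)" .
    have "Q20 ^ ?q * u = Q20 ^ (?q - 1) * (Q20 * u)"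
      using card_field_ge2[where 'a='a] by (simp add: mult.assoc[symmetric] flip: power_Suc2)
    then have "in_ideal m 3 (Q20 ^ ?q * u)" using in_ideal_Q20[OF u] by (metis in_ideal_mult2)
    then show ?thesis unfolding 2 dickson_3 distrib_right using 1 by auto
  qed
qed

lemma B2_annihilated:
  assumes u: "(u :: 'a::{field,finite} mpol) \<in> B2 m" shows "in_ideal m 3 (dickson 3 0 * u)"
proof -
  let ?q = "CARD('a)"
  obtain g where g: "g \<in> Dickson2" "in_ideal m 3 (L12 * (u - g * V3_quot m))" using u by (auto simp: B2_def)
  have "dickson 3 0 * u = (L12 ^ (?q - 2) * V3 ^ (?q - 1)) * (L12 * (u - g * V3_quot m))
      + (L12 * (V3 * V3_quot m)) * (g * L12 ^ (?q - 2) * V3 ^ (?q - 2))"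
    unfolding dickson_3 Q20_def power_card_minus_1[of "V3 :: 'a mpol", where 'a='a] power_card_minus_1[of "L12 :: 'a mpol", where 'a='a]
    by (simp add: algebra_simps)
  then show ?thesis using in_ideal_add[OF in_ideal_mult2[OF g(2)] in_ideal_mult[OF in_ideal_L2_V3_V3_quot]] by metis
qed

section \<open>Steenrod operations on determinants\<close>

lemma total_steenrod_Var_pow:
  "total_steenrod ((Var i :: 'a::{field,finite} mpol) ^ (CARD('a) ^ b))
    = [:Var i ^ (CARD('a) ^ b):] + Polynomial.monom (Var i ^ (CARD('a) ^ Suc b)) (CARD('a) ^ b)"
proof -
  have "total_steenrod (Var i :: 'a mpol) = [:Var i:] + Polynomial.monom (Var i ^ CARD('a)) 1"
    by (simp add: monom_Suc One_nat_def monom_0)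
  then show ?thesis
    by (simp only: total_steenrod.hom_power frobenius_add[OF comm_ring_hom_pCons_Const] monom_power poly_const_pow mult_1)
       (simp flip: power_mult)
qed

lemma steenrod_Var_pow_mult:
  "steenrod k ((Var i :: 'a::{field,finite} mpol) ^ (CARD('a) ^ b) * p)
    = Var i ^ (CARD('a) ^ b) * steenrod k p
    + (if CARD('a) ^ b \<le> k then Var i ^ (CARD('a) ^ Suc b) * steenrod (k - CARD('a) ^ b) p else 0)"
  by (simp add: steenrod_total_steenrod total_steenrod.hom_mult total_steenrod_Var_pow distrib_right coeff_monom_mult)

lemma bracket_L2:
  "Var 1 ^ (CARD('a) ^ a) * Var 2 ^ (CARD('a) ^ b) - Var 2 ^ (CARD('a) ^ a) * (Var 1 :: 'a::{field,finite} mpol) ^ (CARD('a) ^ b)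
    = L12 * (V3_rem0 a * V3_rem1 b - V3_rem1 a * V3_rem0 b)"
  unfolding Var_reduction L2_def by (simp add: algebra_simps)

text \<open>The operations turn a bracket of two \<open>q\<close>-powers into combinations of such brackets, and each
  bracket is \<open>L\<close> times an element of the Dickson algebra.\<close>

lemma steenrod_bracket:
  "\<exists>e\<in>Dickson2. steenrod k (Var 2 ^ (CARD('a) ^ b) * Var 1 - (Var 1 :: 'a::{field,finite} mpol) ^ (CARD('a) ^ b) * Var 2) = L12 * e"
proof -
  let ?q = "CARD('a)"
  have s: "\<exists>e\<in>Dickson2. Var 2 ^ (?q ^ c) * steenrod k (Var 1) - Var 1 ^ (?q ^ c) * steenrod k (Var 2) = L12 * (e :: 'a mpol)" for c k
  proof -
    have "V3_rem0 0 * V3_rem1 c - V3_rem1 0 * V3_rem0 c \<in> (Dickson2 :: 'a mpol set)" "V3_rem0 1 * V3_rem1 c - V3_rem1 1 * V3_rem0 c \<in> (Dickson2 :: 'a mpol set)"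
      by (intro Dickson2_diff Dickson2_mult V3_rem0_Dickson2 V3_rem1_Dickson2)+
    moreover have "Var 2 ^ (?q ^ c) * Var 1 - (Var 1 :: 'a mpol) ^ (?q ^ c) * Var 2 = L12 * (V3_rem0 0 * V3_rem1 c - V3_rem1 0 * V3_rem0 c)"
      using bracket_L2[of 0 c, where 'a='a] by (simp add: mult.commute)
    moreover have "Var 2 ^ (?q ^ c) * Var 1 ^ ?q - (Var 1 :: 'a mpol) ^ (?q ^ c) * Var 2 ^ ?q = L12 * (V3_rem0 1 * V3_rem1 c - V3_rem1 1 * V3_rem0 c)"
      using bracket_L2[of 1 c, where 'a='a] by (simp add: mult.commute)
    moreover have "steenrod k (Var 1) = (if k = 0 then Var 1 else if k = 1 then Var 1 ^ ?q else 0 :: 'a mpol)"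
      "steenrod k (Var 2) = (if k = 0 then Var 2 else if k = 1 then Var 2 ^ ?q else 0 :: 'a mpol)"
      by (rule steenrod_Var)+
    moreover have "Var 2 ^ (?q ^ c) * 0 - Var 1 ^ (?q ^ c) * 0 = L12 * (0 :: 'a mpol)" by simp
    ultimately show ?thesis by (metis Dickson2_0)
  qed
  obtain e1 where e1: "e1 \<in> Dickson2" "Var 2 ^ (?q ^ b) * steenrod k (Var 1) - Var 1 ^ (?q ^ b) * steenrod k (Var 2) = L12 * (e1 :: 'a mpol)"
    using s by blast
  obtain e2 where e2: "e2 \<in> Dickson2" "Var 2 ^ (?q ^ Suc b) * steenrod (k - ?q ^ b) (Var 1) - Var 1 ^ (?q ^ Suc b) * steenrod (k - ?q ^ b) (Var 2) = L12 * (e2 :: 'a mpol)"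
    using s by blast
  have "steenrod k (Var 2 ^ (?q ^ b) * Var 1 - (Var 1 :: 'a mpol) ^ (?q ^ b) * Var 2)
      = L12 * e1 + (if ?q ^ b \<le> k then L12 * e2 else 0)"
    unfolding steenrod_diff steenrod_Var_pow_mult e1(2)[symmetric] e2(2)[symmetric] by (simp add: algebra_simps)
  also have "\<dots> = L12 * (e1 + (if ?q ^ b \<le> k then e2 else 0))" by (simp add: distrib_left)
  finally show ?thesis using e1(1) e2(1) by (intro bexI[of _ "e1 + (if ?q ^ b \<le> k then e2 else 0)"]) (auto intro: Dickson2.add)
qed

definition L2_steenrod_factor :: "nat \<Rightarrow> 'a::{field,finite} mpol" where
  "L2_steenrod_factor k = (if k = 0 then 1 else if k = CARD('a) then Q21 else if k = Suc (CARD('a)) then Q20 else 0)"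

lemma L2_steenrod_factor_Dickson2 [intro]: "L2_steenrod_factor k \<in> Dickson2" by (auto simp: L2_steenrod_factor_def)

lemma steenrod_L2: "steenrod k (L12 :: 'a::{field,finite} mpol) = L12 * L2_steenrod_factor k"
proof -
  let ?q = "CARD('a)"
  have q: "2 \<le> ?q" by (rule card_field_ge2)
  have L: "(L12 :: 'a mpol) = Var 2 ^ (?q ^ 1) * Var 1 - Var 1 ^ (?q ^ 1) * Var 2"
    by (simp add: L2_def mult.commute)
  have st: "steenrod k (L12 :: 'a mpol) = Var 2 ^ ?q * steenrod k (Var 1) - Var 1 ^ ?q * steenrod k (Var 2)
    + (if ?q \<le> k then Var 2 ^ (?q ^ 2) * steenrod (k - ?q) (Var 1) - Var 1 ^ (?q ^ 2) * steenrod (k - ?q) (Var 2) else 0)"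
    unfolding L steenrod_diff steenrod_Var_pow_mult by (simp add: numeral_2_eq_2 One_nat_def)
  \<comment> \<open>Only the four products of \<open>\<P>\<^sup>0, \<P>\<^sup>1\<close> on \<open>x\<^sub>i\<close> with \<open>\<P>\<^sup>0, \<P>\<^sup>q\<close> on \<open>x\<^sub>j\<^sup>q\<close> occur.\<close>
  consider "k = 0" | "k = 1" | "k = ?q" | "k = Suc ?q" | "k \<noteq> 0 \<and> k \<noteq> 1 \<and> k \<noteq> ?q \<and> k \<noteq> Suc ?q" by blast
  then show ?thesis
  proof cases
    case 1 then show ?thesis by (simp add: L2_steenrod_factor_def steenrod_0)
  next
    case 2 then show ?thesis unfolding st using q by (simp add: L2_steenrod_factor_def steenrod_Var mult.commute)
  next
    case 3 then show ?thesis unfolding st using q L2_Q21[where 'a='a] by (simp add: L2_steenrod_factor_def steenrod_Var mult.commute)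
  next
    case 4 then show ?thesis unfolding st using q L2_Q20[where 'a='a] by (simp add: L2_steenrod_factor_def steenrod_Var mult.commute)
  next
    case 5
    then have "?q \<le> k \<Longrightarrow> k - ?q \<noteq> 0 \<and> k - ?q \<noteq> 1" by linarith
    then show ?thesis unfolding st using 5 by (simp add: L2_steenrod_factor_def steenrod_Var)
  qed
qed

text \<open>For \<open>Q\<^sub>2\<^sub>,\<^sub>0\<close>, a power of \<open>L\<close>, this follows from the formula for \<open>L\<close>; for \<open>Q\<^sub>2\<^sub>,\<^sub>1\<close> apply the Cartan formula to the
  bracket \<open>L Q\<^sub>2\<^sub>,\<^sub>1\<close> and cancel \<open>L\<close>.\<close>

lemma Dickson2_steenrod: "f \<in> Dickson2 \<Longrightarrow> steenrod k f \<in> (Dickson2 :: 'a::{field,finite} mpol set)"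
proof -
  define st where "st f \<longleftrightarrow> (\<forall>k. steenrod k f \<in> Dickson2)" for f :: "'a mpol"
  have st_mult: "st (f * g)" if "st f" "st g" for f g
    using that unfolding st_def steenrod_Cartan by (auto intro!: Dickson2_sum Dickson2_mult)
  have st_add: "st (f + g)" if "st f" "st g" for f g
    using that unfolding st_def steenrod_add by (auto intro!: Dickson2.add)
  have st_Const: "st (Const c)" for c unfolding st_def steenrod_Const by auto
  have st_pow: "st (f ^ j)" if "st f" for f j
  proof (induction j)
    case 0 then show ?case using st_Const[of 1] by simp
  next
    case (Suc j) then show ?case using st_mult[OF that] by simp
  qed
  have L: "\<exists>e. \<forall>k. e k \<in> Dickson2 \<and> steenrod k (L12 ^ j) = L12 ^ j * (e k :: 'a mpol)" for j
  proof (induction j)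
    case 0
    have "steenrod k (1 :: 'a mpol) = Const (if k = 0 then 1 else 0)" for k using steenrod_Const[of k 1] by (cases "k = 0") auto
    then show ?case by (intro exI[of _ "\<lambda>k. Const (if k = 0 then 1 else 0)"]) (auto intro!: Dickson2_1 Dickson2_0)
  next
    case (Suc j)
    then obtain e where e: "\<And>k. e k \<in> Dickson2" "\<And>k. steenrod k (L12 ^ j) = L12 ^ j * (e k :: 'a mpol)" by blast
    have "steenrod k (L12 ^ Suc j) = L12 ^ Suc j * (\<Sum>a\<le>k. L2_steenrod_factor a * e (k - a))" for k
      by (simp add: steenrod_Cartan steenrod_L2 e(2) sum_distrib_left mult_ac)
    then show ?case by (intro exI[of _ "\<lambda>k. \<Sum>a\<le>k. L2_steenrod_factor a * e (k - a)"]) (auto intro!: Dickson2_sum Dickson2_mult e)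
  qed
  have stD: "st Q20"
  proof -
    obtain e where "\<And>k. e k \<in> Dickson2" "\<And>k. steenrod k (L12 ^ (CARD('a) - 1)) = L12 ^ (CARD('a) - 1) * (e k :: 'a mpol)" using L by blast
    then show ?thesis unfolding st_def Q20_def by (metis Dickson2_mult Dickson2_D Q20_def)
  qed
  have stA: "st Q21" unfolding st_def
  proof
    fix k show "steenrod k Q21 \<in> (Dickson2 :: 'a mpol set)"
    proof (induction k rule: less_induct)
      case (less k)
      obtain e where e: "e \<in> Dickson2" "steenrod k (Var 2 ^ (CARD('a) ^ 2) * Var 1 - (Var 1 :: 'a mpol) ^ (CARD('a) ^ 2) * Var 2) = L12 * e"
        using steenrod_bracket by blast
      have "Q21 * L12 = Var 2 ^ (CARD('a) ^ 2) * Var 1 - (Var 1 :: 'a mpol) ^ (CARD('a) ^ 2) * Var 2"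
        using L2_Q21[where 'a='a] by (simp add: mult.commute)
      then have "L12 * e = steenrod k (Q21 * L12)" using e(2) by simp
      also have "\<dots> = steenrod k Q21 * L12 + (\<Sum>a<k. steenrod a Q21 * (L12 * L2_steenrod_factor (k - a)))"
        by (simp add: steenrod_Cartan' steenrod_L2)
      also have "\<dots> = L12 * (steenrod k Q21 + (\<Sum>a<k. steenrod a Q21 * L2_steenrod_factor (k - a)))"
        by (simp add: distrib_left sum_distrib_left mult_ac)
      finally have "e = steenrod k Q21 + (\<Sum>a<k. steenrod a Q21 * L2_steenrod_factor (k - a))"
        using mult_left_cancel[OF L2_Var_nz[of 1 2, where 'a='a]] by simp
      then have "steenrod k Q21 = e - (\<Sum>a<k. steenrod a Q21 * L2_steenrod_factor (k - a))" by simp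
      moreover have "(\<Sum>a<k. steenrod a Q21 * L2_steenrod_factor (k - a)) \<in> (Dickson2 :: 'a mpol set)" by (intro Dickson2_sum Dickson2_mult L2_steenrod_factor_Dickson2) (use less in auto)
      ultimately show ?case using e(1) by auto
    qed
  qed
  assume "f \<in> Dickson2"
  then have "st f" by (induction rule: Dickson2.induct) (intro st_mult st_pow st_Const stA stD st_add; assumption)+
  then show ?thesis by (simp add: st_def)
qed

text \<open>The quotient of \<open>\<P>\<^sup>k(L f)\<close> by \<open>L\<close>.\<close>

definition twisted_steenrod :: "'a::{field,finite} mpol \<Rightarrow> nat \<Rightarrow> 'a mpol" where
  "twisted_steenrod f k = (\<Sum>a\<le>k. L2_steenrod_factor a * steenrod (k - a) f)"

lemma twisted_steenrod_Dickson2: "f \<in> Dickson2 \<Longrightarrow> twisted_steenrod f k \<in> Dickson2"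
  unfolding twisted_steenrod_def by (intro Dickson2_sum Dickson2_mult L2_steenrod_factor_Dickson2 Dickson2_steenrod)

lemma twisted_steenrod_1: "twisted_steenrod 1 k = L2_steenrod_factor k"
proof -
  have "steenrod (k - a) (1 :: 'a mpol) = (if k - a = 0 then 1 else 0)" for a
    using steenrod_Const[of "k - a" "1 :: 'a"] by simp
  then have "twisted_steenrod 1 k = (\<Sum>a\<le>k. if a = k then L2_steenrod_factor a else 0 :: 'a mpol)"
    unfolding twisted_steenrod_def by (intro sum.cong) auto
  then show ?thesis by simp
qed

lemma steenrod_alt_form: "steenrod k (alt_form f (Var i) (Var j)) = alt_form (twisted_steenrod f k) (Var i) (Var j)"
proof -
  let ?\<sigma> = "\<lambda>l. if l = (1::nat) then Var i else Var j :: 'a mpol"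
  have h: "alt_form g (Var i) (Var j) = subs ?\<sigma> (L12 * g)" for g
    by (simp add: alt_form_def eval2_def subs.hom_mult subs_L2)
  have "steenrod k (alt_form f (Var i) (Var j)) = subs ?\<sigma> (steenrod k (L12 * f))"
    unfolding h by (rule steenrod_subs) auto
  also have "steenrod k (L12 * f) = L12 * twisted_steenrod f k"
    unfolding steenrod_Cartan steenrod_L2 twisted_steenrod_def sum_distrib_left by (simp add: mult_ac)
  finally show ?thesis by (simp only: h)
qed

lemma steenrod_numer3:
  "steenrod k (delta3_numer b f :: 'a::{field,finite} mpol) = delta3_numer b (twisted_steenrod f k)
    + (if CARD('a) ^ b \<le> k then delta3_numer (Suc b) (twisted_steenrod f (k - CARD('a) ^ b)) else 0)"
  unfolding numer3_def steenrod_add steenrod_diff steenrod_Var_pow_mult steenrod_alt_form by (simp add: algebra_simps)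

lemma numer3_2: "delta3_numer 2 Q21 = (0 :: 'a::{field,finite} mpol)" "delta3_numer 2 Q20 = (0 :: 'a mpol)"
  unfolding numer3_def alt_form_Q21 alt_form_Q20 by (simp_all add: algebra_simps)

lemma numer3_zero: "numer3 b 0 p r s = 0" by (simp add: numer3_def alt_form_def)

text \<open>Expanding the \<open>q\<^sup>3\<close>-th powers of the variables in lower ones gives the Dickson invariants.\<close>

lemma numer3_3:
  "delta3_numer 3 1 = dickson 3 2 * (L3 :: 'a::{field,finite} mpol)"
  "delta3_numer 3 Q21 = dickson 3 1 * (L3 :: 'a mpol)"
  "delta3_numer 3 Q20 = dickson 3 0 * (L3 :: 'a mpol)"
proof -
  have e: "delta3_numer 3 f = dickson 3 2 * delta3_numer 2 f - dickson 3 1 * delta3_numer 1 f + dickson 3 0 * delta3_numer 0 f" for f :: "'a mpol"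
    unfolding numer3_def dickson_3_relation[of 1, simplified] dickson_3_relation[of 2, simplified] dickson_3_relation[of 3, simplified]
    by (simp add: algebra_simps)
  have "delta3_numer 1 1 = (0 :: 'a mpol)" "delta3_numer 0 1 = (0 :: 'a mpol)" unfolding numer3_def alt_form_1 L2_def by (simp_all add: algebra_simps)
  then show "delta3_numer 3 1 = dickson 3 2 * (L3 :: 'a mpol)" unfolding e by (simp add: L3_numer3)
  have "delta3_numer 1 Q21 = - (L3 :: 'a mpol)" "delta3_numer 0 Q21 = (0 :: 'a mpol)"
    unfolding L3_numer3 unfolding numer3_def alt_form_Q21 alt_form_1 L2_def by (simp_all add: algebra_simps)
  then show "delta3_numer 3 Q21 = dickson 3 1 * (L3 :: 'a mpol)" unfolding e numer3_2 by simp
  have "delta3_numer 1 Q20 = (0 :: 'a mpol)" "delta3_numer 0 Q20 = (L3 :: 'a mpol)"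
    unfolding L3_numer3 unfolding numer3_def alt_form_Q20 alt_form_1 L2_def by (simp_all add: algebra_simps)
  then show "delta3_numer 3 Q20 = dickson 3 0 * (L3 :: 'a mpol)" unfolding e numer3_2 by simp
qed

lemma steenrod_L3:
  "\<exists>d. steenrod k L3 = d * (L3 :: 'a::{field,finite} mpol) \<and> (\<forall>u\<in>B2 m. d * u \<in> B2 m)"
proof -
  let ?q = "CARD('a)"
  define act where "act d \<longleftrightarrow> (\<forall>u\<in>B2 m. d * u \<in> B2 m)" for d :: "'a mpol"
  have act_add: "act d \<Longrightarrow> act e \<Longrightarrow> act (d + e)" for d e by (simp add: act_def distrib_right B2_add)
  have act0: "act 0" and act1: "act 1" by (simp_all add: act_def B2_0)
  have actQ: "i < 3 \<Longrightarrow> act (dickson 3 i)" for i by (simp add: act_def B2_dickson)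
  have 2: "\<exists>d. delta3_numer 2 (L2_steenrod_factor k) = d * (L3 :: 'a mpol) \<and> act d" for k
  proof -
    have "L2_steenrod_factor k \<in> {1, Q21, Q20, 0 :: 'a mpol}" by (auto simp: L2_steenrod_factor_def)
    then show ?thesis
      using act0 act1 by (elim insertE) (force simp: L3_numer3[symmetric] numer3_2 numer3_zero)+
  qed
  have 3: "\<exists>d. delta3_numer 3 (L2_steenrod_factor k) = d * (L3 :: 'a mpol) \<and> act d" for k
  proof -
    have "L2_steenrod_factor k \<in> {1, Q21, Q20, 0 :: 'a mpol}" by (auto simp: L2_steenrod_factor_def)
    then show ?thesis
      using act0 actQ[of 0] actQ[of 1] actQ[of 2] by (elim insertE) (force simp: numer3_3 numer3_zero)+
  qed
  obtain d where d: "delta3_numer 2 (L2_steenrod_factor k) = d * (L3 :: 'a mpol)" "act d" using 2 by blast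
  obtain e where e: "delta3_numer 3 (L2_steenrod_factor (k - ?q ^ 2)) = e * (L3 :: 'a mpol)" "act e" using 3 by blast
  have S: "Suc 2 = (3 :: nat)" by simp
  have "steenrod k (L3 :: 'a mpol) = delta3_numer 2 (twisted_steenrod 1 k) + (if ?q ^ 2 \<le> k then delta3_numer (Suc 2) (twisted_steenrod 1 (k - ?q ^ 2)) else 0)"
    by (subst L3_numer3) (rule steenrod_numer3)
  also have "\<dots> = (d + (if ?q ^ 2 \<le> k then e else 0)) * L3"
    unfolding twisted_steenrod_1 S d(1) e(1) by (cases "?q ^ 2 \<le> k") (simp_all only: if_True if_False distrib_right mult_zero_left)
  finally show ?thesis using d(2) e(2) act0 act_add unfolding act_def[symmetric] by auto
qed

text \<open>Apply the Cartan formula to the product of \<open>\<delta>\<^sub>3\<^sub>;\<^sub>m(f)\<close> with its denominator. The operations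
  on the denominator multiply it by Dickson invariants, so induction on \<open>k\<close> isolates the operation on
  \<open>\<delta>\<^sub>3\<^sub>;\<^sub>m(f)\<close>.\<close>

lemma delta3_poly_steenrod: assumes f: "f \<in> Dickson2" shows "steenrod k (delta3_poly m f :: 'a::{field,finite} mpol) \<in> B2 m"
proof (induction k rule: less_induct)
  case (less k)
  let ?Q = "CARD('a) ^ m"
  obtain d where d: "\<And>j. steenrod j L3 = d j * (L3 :: 'a mpol)" "\<And>j u. u \<in> B2 m \<Longrightarrow> d j * u \<in> B2 m"
    using steenrod_L3[of _ m, where 'a='a] by metis
  have 1: "steenrod k (delta3_poly m f * L3) = (delta3_poly m (twisted_steenrod f k) + (if ?Q \<le> k then delta3_poly (Suc m) (twisted_steenrod f (k - ?Q)) else 0)) * L3"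
    unfolding delta3_poly[OF f] steenrod_numer3 by (simp add: delta3_poly[OF twisted_steenrod_Dickson2[OF f]] distrib_right)
  have 2: "steenrod k (delta3_poly m f * L3) = (steenrod k (delta3_poly m f) + (\<Sum>a<k. d (k - a) * steenrod a (delta3_poly m f))) * L3"
  proof -
    have "(\<Sum>a<k. steenrod a (delta3_poly m f) * steenrod (k - a) L3) = (\<Sum>a<k. d (k - a) * steenrod a (delta3_poly m f)) * L3"
      unfolding sum_distrib_right by (rule sum.cong[OF refl]) (simp only: d(1) mult_ac)
    then show ?thesis by (simp only: steenrod_Cartan'[of k "delta3_poly m f" L3] distrib_right)
  qed
  have "steenrod k (delta3_poly m f) + (\<Sum>a<k. d (k - a) * steenrod a (delta3_poly m f))
      = delta3_poly m (twisted_steenrod f k) + (if ?Q \<le> k then delta3_poly (Suc m) (twisted_steenrod f (k - ?Q)) else 0)"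
    by (rule mult_right_cancel[OF L3_nz, THEN iffD1, OF trans[OF sym[OF 2] 1]])
  then have e: "steenrod k (delta3_poly m f) = delta3_poly m (twisted_steenrod f k) + (if ?Q \<le> k then delta3_poly (Suc m) (twisted_steenrod f (k - ?Q)) else 0)
      - (\<Sum>a<k. d (k - a) * steenrod a (delta3_poly m f))" by (simp add: eq_diff_eq)
  show ?case unfolding e
    by (intro B2_diff B2_add B2_sum d(2) delta3_poly_B2 twisted_steenrod_Dickson2 f)
       (use less in \<open>auto intro!: B1_B2 delta3_poly_Suc_B1 twisted_steenrod_Dickson2 f B2_0\<close>)
qed

lemma B2_steenrod: assumes u: "u \<in> B2 m" shows "steenrod k u \<in> B2 m"
proof -
  obtain g where g: "g \<in> Dickson2" "u - delta3_poly m g \<in> B1 m 3" by (rule B2_decompose[OF u])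
  have "steenrod k u = steenrod k (delta3_poly m g) + steenrod k (u - delta3_poly m g)" by (simp add: steenrod_diff)
  then show ?thesis using delta3_poly_steenrod[OF g(1)] B1_B2[OF B1_steenrod[OF g(2)]] by (simp add: B2_add)
qed

section \<open>The monomials of \<open>\<Delta>\<close> span\<close>

lemma qnum_add: "qnum q (l + b) = qnum q l + q ^ l * qnum q b"
  by (induction b) (simp_all add: qnum_Suc power_add distrib_left)

lemma qnum_div: assumes q: "2 \<le> q" shows "(q ^ a - q ^ b) div (q - 1) = qnum q a - qnum q b"
proof -
  have "q ^ a - q ^ b = (q ^ a - 1) - (q ^ b - 1)" using q by simp
  also have "\<dots> = (q - 1) * (qnum q a - qnum q b)"
    unfolding diff_mult_distrib2 using q by (simp add: qnum_eq)
  finally show ?thesis using q by simp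
qed

lemma qnum_interval: "e < qnum q b \<Longrightarrow> \<exists>l<b. qnum q l \<le> e \<and> e < qnum q (Suc l)"
proof (induction b)
  case (Suc b)
  then show ?case using less_Suc_eq by (cases "e < qnum q b") fastforce+
qed simp

lemma prod_1_2: "(\<Prod>i = 1..2. g i) = g 1 * (g (2 :: nat) :: 'a::comm_monoid_mult)"
proof -
  have "{1..2} = {1, 2 :: nat}" by auto
  then show ?thesis by simp
qed

lemma Delta_2: "Delta m 2 \<subseteq> (Dickson2 :: 'a::{field,finite} mpol set)"
proof
  fix f :: "'a mpol" assume "f \<in> Delta m 2"
  then obtain e :: "nat \<Rightarrow> nat" where "f = (\<Prod>i = 1..2. dickson 2 (2 - i) ^ e i)"
    by (auto simp: Delta_def split: if_splits)
  then have "f = Const 1 * Q21 ^ e 1 * Q20 ^ e 2"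
    by (simp add: prod_1_2 dickson_2[unfolded One_nat_def])
  then show "f \<in> Dickson2" by (simp only: Dickson2.mon)
qed

text \<open>The bounds on the exponents are those of \<open>Delta\<close> for the partition \<open>l1 \<ge> l\<close>.\<close>

lemma Delta_2I:
  assumes "l \<le> l1" "l1 + 2 \<le> m"
    "qnum CARD('a) l1 \<le> i + qnum CARD('a) l" "i + qnum CARD('a) l < qnum CARD('a) (Suc l1)"
    "qnum CARD('a) l \<le> e" "e < qnum CARD('a) (Suc l)"
  shows "Q21 ^ i * Q20 ^ e \<in> (Delta m 2 :: 'a::{field,finite} mpol set)"
proof -
  define ee where "ee j = (if j = 1 then i else e)" for j :: nat
  define ll where "ll j = (if j = 1 then l1 else if j = 2 then l else 0)" for j :: nat
  have "Q21 ^ i * Q20 ^ e = (\<Prod>j = 1..2. (dickson 2 (2 - j) :: 'a mpol) ^ ee j)"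
    by (simp add: prod_1_2 dickson_2[unfolded One_nat_def] ee_def)
  moreover have "ll 1 \<le> m - 2 \<and> (\<forall>j\<in>{1..2}. ll (Suc j) \<le> ll j) \<and> ll (Suc 2) = 0 \<and>
            (\<forall>j\<in>{1..2}.
               (CARD('a) ^ ll j - CARD('a) ^ ll (Suc j)) div (CARD('a) - 1) \<le> ee j \<and>
               ee j < (CARD('a) ^ (ll j + 1) - CARD('a) ^ ll (Suc j)) div (CARD('a) - 1))"
  proof -
    have J: "{1..2} = {1, 2 :: nat}" by auto
    show ?thesis
      unfolding J qnum_div[OF card_field_ge2] using assms
      by (auto simp: ll_def ee_def simp flip: Suc_eq_plus1)
  qed
  ultimately show ?thesis using assms(2) unfolding Delta_def by auto
qed

text \<open>Modulo \<open>Q\<^sub>2\<^sub>,\<^sub>0\<close> the recursion for the remainders collapses to powers of \<open>Q\<^sub>2\<^sub>,\<^sub>1\<close>.\<close>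

lemma V3_rem1_mod_D:
  "\<exists>h\<in>Dickson2. \<exists>k\<in>Dickson2. V3_rem0 (Suc b) = Q20 * (h :: 'a mpol) \<and> V3_rem1 (Suc b) = Q21 ^ qnum CARD('a) b + Q20 * (k :: 'a::{field,finite} mpol)"
proof (induction b)
  case 0
  have "CARD('a) > 0" using card_field_ge2[where 'a='a] by simp
  then have "V3_rem0 (Suc 0) = Q20 * (0 :: 'a mpol)" "V3_rem1 (Suc 0) = Q21 ^ qnum CARD('a) 0 + Q20 * (0 :: 'a mpol)"
    unfolding V3_division_Suc V3_division_0 by (simp_all add: power_0_left)
  then show ?case using Dickson2_0[where 'a='a] by blast
next
  case (Suc b)
  let ?q = "CARD('a)"
  obtain h k :: "'a mpol" where D: "h \<in> Dickson2" "k \<in> Dickson2" and e: "V3_rem0 (Suc b) = Q20 * h" "V3_rem1 (Suc b) = Q21 ^ qnum ?q b + Q20 * k"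
    using Suc by blast
  have p: "Q20 ^ ?q = Q20 * (Q20 :: 'a mpol) ^ (?q - 1)" using card_field_ge2[where 'a='a] by (simp flip: power_Suc)
  let ?h = "- (V3_rem1 (Suc b) ^ ?q) :: 'a mpol" let ?k = "Q20 ^ (?q - 1) * h ^ ?q + Q21 * Q20 ^ (?q - 1) * k ^ ?q"
  have "V3_rem0 (Suc (Suc b)) = Q20 * ?h" unfolding V3_division_Suc(2)[of "Suc b"] by simp
  moreover have "V3_rem1 (Suc (Suc b)) = Q21 ^ qnum ?q (Suc b) + Q20 * ?k"
    unfolding V3_division_Suc(3)[of "Suc b"] e mfrob1 power_mult_distrib p qnum_Suc2
    by (simp add: algebra_simps power_add flip: power_mult)
  moreover have "?h \<in> Dickson2" "?k \<in> Dickson2" using D by (auto intro!: Dickson2.add Dickson2_uminus Dickson2_mult Dickson2_power V3_rem1_Dickson2)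
  ultimately show ?case by blast
qed

lemma in_ideal_Frobenius: "in_ideal b n u \<Longrightarrow> in_ideal (l + b) n ((u :: 'a::{field,finite} mpol) ^ (CARD('a) ^ l))"
proof (induction rule: in_ideal_induct[consumes 1, case_names gen zero add])
  case (gen i p)
  have "(Var i ^ (CARD('a) ^ b) * p) ^ (CARD('a) ^ l) = Var i ^ (CARD('a) ^ (l + b)) * p ^ (CARD('a) ^ l)"
    by (simp add: power_mult_distrib power_add mult.commute flip: power_mult)
  then show ?case using gen by (simp add: in_ideal_mult in_ideal_Var)
next
  case zero then show ?case by (simp add: power_0_left)
next
  case (add u v) then show ?case by (simp add: mfrob in_ideal_add)
qed

lemma in_ideal_L2_Q20_V3_rem1:
  assumes "l \<le> m"
  shows "in_ideal m 2 (L12 * (Q20 ^ qnum CARD('a) l * (V3_rem1 (m - l) :: 'a::{field,finite} mpol) ^ (CARD('a) ^ l)))"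
proof -
  let ?q = "CARD('a)"
  have "Suc ((?q - 1) * qnum ?q l) = ?q ^ l" using card_field_ge2[where 'a='a] by (simp add: qnum_eq)
  then have "L12 * Q20 ^ qnum ?q l = (L12 :: 'a mpol) ^ (?q ^ l)"
    unfolding Q20_def by (metis power_Suc power_mult)
  then have "L12 * (Q20 ^ qnum ?q l * V3_rem1 (m - l) ^ (?q ^ l)) = (L12 * V3_rem1 (m - l) :: 'a mpol) ^ (?q ^ l)"
    by (simp add: power_mult_distrib flip: mult.assoc)
  then show ?thesis using in_ideal_Frobenius[OF in_ideal_L2_V3_rem1, of l "m - l", where 'a='a] assms by simp
qed

text \<open>Induction on the exponent of \<open>Q\<^sub>2\<^sub>,\<^sub>0\<close>, downwards from the bound beyond which \<open>L\<close> sends everything into the ideal. In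
  each range of that exponent the remainders give a relation with leading term a power of
  \<open>Q\<^sub>2\<^sub>,\<^sub>1\<close>; the monomials of \<open>\<Delta>\<close> are those that no leading term divides.\<close>

lemma Delta_2_spans:
  fixes G :: "'a::{field,finite} mpol \<Rightarrow> bool"
  assumes m: "2 \<le> m"
    and add: "\<And>f g. f \<in> Dickson2 \<Longrightarrow> g \<in> Dickson2 \<Longrightarrow> G f \<Longrightarrow> G g \<Longrightarrow> G (f + g)"
    and scale: "\<And>c f. f \<in> Dickson2 \<Longrightarrow> G f \<Longrightarrow> G (Const c * f)"
    and gen: "\<And>f. f \<in> Delta m 2 \<Longrightarrow> G f"
    and T: "\<And>t. t \<in> Dickson2 \<Longrightarrow> in_ideal m 2 (L12 * t) \<Longrightarrow> G t"
    and f: "f \<in> Dickson2"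
  shows "G f"
proof -
  let ?q = "CARD('a)" let ?N = "qnum ?q (m - 1)"
  have q: "2 \<le> ?q" by (rule card_field_ge2)
  have "\<forall>f\<in>Dickson2. G (Q20 ^ e * f)" for e
  proof (induction "?N - e" arbitrary: e rule: less_induct)
    case less
    show ?case
    proof (cases "?N \<le> e")
      case True
      have "V3_rem1 (m - (m - 1)) = (1 :: 'a mpol)" using m V3_division_Suc(3)[of 0, where 'a='a] q by (simp add: V3_division_0 One_nat_def)
      then have 0: "in_ideal m 2 (L12 * Q20 ^ ?N :: 'a mpol)" using in_ideal_L2_Q20_V3_rem1[of "m - 1" m, where 'a='a] by simp
      show ?thesis
      proof
        fix f :: "'a mpol" assume f: "f \<in> Dickson2"
        have "L12 * (Q20 ^ e * f) = (L12 * Q20 ^ ?N) * (Q20 ^ (e - ?N) * f)"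
          using True by (simp add: mult.assoc[symmetric]) (simp add: mult.assoc flip: power_add)
        then have "in_ideal m 2 (L12 * (Q20 ^ e * f))" using in_ideal_mult[OF 0] by metis
        then show "G (Q20 ^ e * f)" by (intro T Dickson2_mult Dickson2_power Dickson2_D f)
      qed
    next
      case False
      then have IH: "f \<in> Dickson2 \<Longrightarrow> G (Q20 ^ Suc e * f)" for f by (intro less[rule_format]) auto
      obtain l where l: "l < m - 1" "qnum ?q l \<le> e" "e < qnum ?q (Suc l)" using qnum_interval[of e ?q "m - 1"] False by auto
      define b where "b = m - l - 2"
      have b: "m - l = Suc (Suc b)" "m - 1 = l + Suc b" using l m by (auto simp: b_def)
      \<comment> \<open>The power of \<open>Q\<^sub>2\<^sub>,\<^sub>1\<close> in the leading term of the relation for this range.\<close>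
      define \<mu> where "\<mu> = ?q ^ l * qnum ?q (Suc b)"
      have \<mu>: "?N = qnum ?q l + \<mu>" unfolding b qnum_add \<mu>_def ..
      obtain k :: "'a mpol" where k: "k \<in> Dickson2" "V3_rem1 (Suc (Suc b)) = Q21 ^ qnum ?q (Suc b) + Q20 * k"
        using V3_rem1_mod_D[of "Suc b"] by blast
      define k' where "k' = Q20 ^ (?q ^ l - 1) * k ^ (?q ^ l)"
      have k': "k' \<in> Dickson2" unfolding k'_def by (intro Dickson2_mult Dickson2_power Dickson2_D k)
      have p: "Q20 ^ (?q ^ l) = Q20 * (Q20 :: 'a mpol) ^ (?q ^ l - 1)" using q by (simp flip: power_Suc)
      have P: "V3_rem1 (m - l) ^ (?q ^ l) = Q21 ^ \<mu> + Q20 * k'"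
        unfolding b k(2) mfrob power_mult_distrib p k'_def \<mu>_def by (simp add: mult_ac flip: power_mult)
      have mon: "G (Q21 ^ i * Q20 ^ e)" for i
      proof (cases "i < \<mu>")
        case True
        then obtain l1 where l1: "l1 < m - 1" "qnum ?q l1 \<le> i + qnum ?q l" "i + qnum ?q l < qnum ?q (Suc l1)"
          using qnum_interval[of "i + qnum ?q l" ?q "m - 1"] \<mu> by auto
        have "l \<le> l1"
        proof (rule ccontr)
          assume "\<not> l \<le> l1"
          then have "qnum ?q (Suc l1) \<le> qnum ?q l" by (intro qnum_mono) simp
          then show False using l1(3) by simp
        qed
        then show ?thesis by (intro gen Delta_2I[OF _ _ l1(2,3) l(2,3)]) (use l1(1) in auto)
      next
        case False
        have 1: "Q21 ^ i * Q20 ^ e = (Q21 ^ (i - \<mu>) * Q20 ^ (e - qnum ?q l)) * (Q20 ^ qnum ?q l * V3_rem1 (m - l) ^ (?q ^ l))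
            + Q20 ^ Suc e * (- (Q21 ^ (i - \<mu>) * k'))"
        proof -
          have i: "Q21 ^ i = (Q21 ^ (i - \<mu>) * Q21 ^ \<mu> :: 'a mpol)" using False by (simp flip: power_add)
          have e: "Q20 ^ e = (Q20 ^ (e - qnum ?q l) * Q20 ^ qnum ?q l :: 'a mpol)" using l(2) by (simp flip: power_add)
          show ?thesis unfolding P power_Suc e i by (simp add: algebra_simps)
        qed
        have "in_ideal m 2 (L12 * (Q21 ^ (i - \<mu>) * Q20 ^ (e - qnum ?q l) * (Q20 ^ qnum ?q l * (V3_rem1 (m - l) :: 'a mpol) ^ (?q ^ l))))"
          unfolding mult.left_commute[of L12 "Q21 ^ (i - \<mu>) * Q20 ^ (e - qnum ?q l)"]
          by (rule in_ideal_mult2[OF in_ideal_L2_Q20_V3_rem1]) (use l(1) in simp)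
        then have "G ((Q21 ^ (i - \<mu>) * Q20 ^ (e - qnum ?q l)) * (Q20 ^ qnum ?q l * V3_rem1 (m - l) ^ (?q ^ l)))"
          by (intro T Dickson2_mult Dickson2_power Dickson2_D Dickson2_A V3_rem1_Dickson2)
        moreover have "G (Q20 ^ Suc e * (- (Q21 ^ (i - \<mu>) * k')))"
          by (intro IH Dickson2_uminus Dickson2_mult Dickson2_power Dickson2_A k')
        ultimately show ?thesis unfolding 1
          by (intro add) (auto intro!: Dickson2_mult Dickson2_power Dickson2_uminus V3_rem1_Dickson2 k')
      qed
      show ?thesis
      proof
        fix f :: "'a mpol" assume "f \<in> Dickson2"
        then show "G (Q20 ^ e * f)"
        proof (induction f rule: Dickson2.induct)
          case (mon c i j)
          show ?case
          proof (cases j)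
            case 0
            have "G (Const c * (Q21 ^ i * Q20 ^ e))" by (intro scale Dickson2_mult Dickson2_power Dickson2_A Dickson2_D \<open>\<And>i. G (Q21 ^ i * Q20 ^ e)\<close>)
            then show ?thesis by (simp add: 0 mult_ac)
          next
            case (Suc j')
            have "G (Q20 ^ Suc e * (Const c * Q21 ^ i * Q20 ^ j'))" by (intro IH Dickson2.mon)
            then show ?thesis by (simp add: Suc mult_ac)
          qed
        next
          case (add f g)
          have "G (Q20 ^ e * f + Q20 ^ e * g)" by (intro assms(2) add Dickson2_mult Dickson2_power Dickson2_D)
          then show ?case by (simp add: distrib_left)
        qed
      qed
    qed
  qed
  from this[of 0] f show ?thesis by simp
qed

section \<open>The delta operator on polynomials\<close>

lemma sub_mat_simps: "mat_delete (mat (Suc r) (Suc c) f) i j = mat r c (\<lambda>(i', j'). f (if i' < i then i' else Suc i', if j' < j then j' else Suc j'))"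
  unfolding mat_delete_def by (rule eq_matI) auto

lemma det_2x2: "det (mat 2 2 f) = f (0, 0) * f (1, 1) - f (0, 1) * (f (1, 0) :: 'b::comm_ring_1)"
proof -
  have "det (mat 2 2 f) = (\<Sum>j<2. mat 2 2 f $$ (0, j) * cofactor (mat 2 2 f) 0 j)"
    by (rule laplace_expansion_row) auto
  also have "\<dots> = f (0, 0) * f (1, 1) - f (0, 1) * f (1, 0)"
    by (simp add: numeral_2_eq_2 cofactor_def sub_mat_simps det_single One_nat_def)
  finally show ?thesis .
qed

lemma det_3x3: "det (mat 3 3 f) = f (2, 0) * (f (0, 1) * f (1, 2) - f (0, 2) * f (1, 1))
    - f (2, 1) * (f (0, 0) * f (1, 2) - f (0, 2) * f (1, 0))
    + f (2, 2) * (f (0, 0) * f (1, 1) - f (0, 1) * (f (1, 0) :: 'b::comm_ring_1))"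
proof -
  have 3: "3 = Suc 2" and 2: "{..<3} = {0, 1, 2 :: nat}" by auto
  have "det (mat 3 3 f) = (\<Sum>j<3. mat 3 3 f $$ (2, j) * cofactor (mat 3 3 f) 2 j)"
    by (rule laplace_expansion_row) auto
  also have "\<dots> = f (2, 0) * det (mat_delete (mat 3 3 f) 2 0) - f (2, 1) * det (mat_delete (mat 3 3 f) 2 1)
      + f (2, 2) * det (mat_delete (mat 3 3 f) 2 2)"
    by (simp add: 2 cofactor_def)
  finally show ?thesis unfolding 3 sub_mat_simps det_2x2 by (simp add: One_nat_def numeral_2_eq_2)
qed

lemma skip_var_subs: "skip_var j = subs (\<lambda>i. Var (if i < j then i else Suc i))"
  by (rule ext) (simp add: skip_var_def subs_def)

lemma skip_var_fract_poly: "skip_var_fract j (to_fract p) = to_fract (skip_var j p)"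
  using skip_var_fract_Fract[of 1 j p] by (simp add: to_fract_def skip_var_subs)

lemma to_fract_divide: "b \<noteq> 0 \<Longrightarrow> a = c * b \<Longrightarrow> to_fract a / to_fract b = to_fract (c :: 'a::idom)"
  by simp

lemma to_fract_power: "to_fract (a ^ n) = to_fract (a :: 'a::idom) ^ n"
  by (induction n) simp_all

lemma delta_1:
  assumes "Var 1 ^ (CARD('a) ^ b) * skip_var 1 p = g * (Var 1 :: 'a::{field,finite} mpol)"
  shows "delta 1 b (to_fract p) = to_fract g"
proof -
  have "delta 1 b (to_fract p) = to_fract (Var 1 ^ (CARD('a) ^ b) * skip_var 1 p) / to_fract (Var 1)"
    unfolding delta_def by (subst (1 2) det_single) (simp_all add: skip_var_fract_poly to_fract_power One_nat_def)
  then show ?thesis using to_fract_divide[OF Var_nz assms] by simp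
qed

lemma delta_2:
  assumes "Var 1 * (Var 2 ^ (CARD('a) ^ b) * skip_var 2 p) - Var 2 * (Var 1 ^ (CARD('a) ^ b) * skip_var 1 p)
    = g * (L12 :: 'a::{field,finite} mpol)"
  shows "delta 2 b (to_fract p) = to_fract g"
proof -
  have "delta 2 b (to_fract p) = to_fract (Var 1 * (Var 2 ^ (CARD('a) ^ b) * skip_var 2 p) - Var 2 * (Var 1 ^ (CARD('a) ^ b) * skip_var 1 p)) / to_fract L12"
    unfolding delta_def det_2x2 
    by (simp add: skip_var_fract_poly L2_def numeral_2_eq_2 One_nat_def to_fract_power mult.commute)
  then show ?thesis using to_fract_divide[OF L2_Var_nz assms] by simp
qed

lemma delta_3:
  assumes "Var 1 ^ (CARD('a) ^ b) * skip_var 1 p * L2 (Var 2) (Var 3) - Var 2 ^ (CARD('a) ^ b) * skip_var 2 p * L2 (Var 1) (Var 3)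
      + Var 3 ^ (CARD('a) ^ b) * skip_var 3 p * L12
    = g * (L3 :: 'a::{field,finite} mpol)"
  shows "delta 3 b (to_fract p) = to_fract g"
proof -
  have 1: "L3 = Var 1 ^ (CARD('a) ^ 2) * L2 (Var 2) (Var 3) - Var 2 ^ (CARD('a) ^ 2) * L2 (Var 1) (Var 3) + Var 3 ^ (CARD('a) ^ 2) * (L12 :: 'a mpol)"
    unfolding L3_numer3 numer3_def alt_form_1 by simp
  have L: "det (mat 3 3 (\<lambda>(i, j). to_fract (Var (Suc j)) ^ (CARD('a) ^ i))) = to_fract (L3 :: 'a mpol)"
    unfolding det_3x3 1 by (simp add: L2_def eval_nat_numeral One_nat_def to_fract_power mult.commute)
  have "delta 3 b (to_fract p) = to_fract (Var 1 ^ (CARD('a) ^ b) * skip_var 1 p * L2 (Var 2) (Var 3) - Var 2 ^ (CARD('a) ^ b) * skip_var 2 p * L2 (Var 1) (Var 3)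
      + Var 3 ^ (CARD('a) ^ b) * skip_var 3 p * L12) / to_fract L3"
    unfolding delta_def L unfolding det_3x3
    by (simp add: skip_var_fract_poly L2_def eval_nat_numeral One_nat_def to_fract_power mult.commute)
  then show ?thesis using to_fract_divide[OF L3_nz assms] by simp
qed

lemma image_skip:
  assumes "1 \<le> j" "j \<le> Suc c"
  shows "(\<lambda>i. if i < j then i else Suc i) ` {1..c} = {1..Suc c} - {j}"
proof
  show "{1..Suc c} - {j} \<subseteq> (\<lambda>i. if i < j then i else Suc i) ` {1..c}"
  proof
    fix x assume x: "x \<in> {1..Suc c} - {j}"
    then show "x \<in> (\<lambda>i. if i < j then i else Suc i) ` {1..c}"
      using assms by (intro image_eqI[of _ _ "if x < j then x else x - 1"]) auto
  qed
qed (use assms in auto)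

lemma skip_var_Phi:
  assumes "1 \<le> j" "j \<le> Suc c"
  shows "skip_var j (Phi m {1..c} e) = Phi m ({1..Suc c} - {j}) e"
  unfolding skip_var_subs image_skip[OF assms, symmetric]
  by (rule subs_Phi_perm) (auto simp: inj_on_def split: if_splits)

lemma delta_1_iterate:
  assumes m: "1 \<le> m"
  shows "(delta 1 m ^^ n) (to_fract 1) = to_fract (Top m n :: 'a::{field,finite} mpol)"
proof (induction n)
  case (Suc n)
  have "CARD('a) ^ m > 0" using card_field_ge2[where 'a='a] by simp
  then have p: "Var 1 ^ (CARD('a) ^ m) = Var 1 ^ (CARD('a) ^ m - 1) * (Var 1 :: 'a mpol)" by (simp flip: power_Suc2)
  have split: "(\<Prod>i = 1..Suc n. g i) = g 1 * (\<Prod>i = 1..n. g (Suc i))" for g :: "nat \<Rightarrow> 'a mpol"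
  proof -
    have "(\<Prod>i = 1..Suc n. g i) = g 1 * (\<Prod>i = Suc 1..Suc n. g i)" by (rule prod.atLeast_Suc_atMost) simp
    then show ?thesis by (simp only: prod.shift_bounds_cl_Suc_ivl)
  qed
  have "skip_var 1 (Top m n) = (\<Prod>i = 1..n. Var (Suc i) ^ (CARD('a) ^ m - 1) :: 'a mpol)"
    unfolding Top_def skip_var_subs subs.hom_prod by (rule prod.cong) (auto simp: subs.hom_power)
  then have "Var 1 ^ (CARD('a) ^ m - 1) * skip_var 1 (Top m n) = (Top m (Suc n) :: 'a mpol)"
    unfolding Top_def split by simp
  then have "delta 1 m (to_fract (Top m n)) = to_fract (Top m (Suc n) :: 'a mpol)"
    by (intro delta_1) (simp only: p mult_ac)
  then show ?case using Suc by simp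
qed (simp add: Top_def)

lemma Phi_single:
  assumes "e < qnum CARD('a) m"
  shows "Phi m {1} e = (Var 1 :: 'a::{field,finite} mpol) ^ ((CARD('a) - 1) * e)"
  using assms by (simp add: Phi_def coeff_trunc_geom power_mult)

lemma delta_2_iterate:
  assumes m: "1 \<le> m" and e: "e < qnum CARD('a) m"
  shows "(delta 2 m ^^ n) (to_fract (Var 1 ^ ((CARD('a) - 1) * e)))
    = to_fract (Phi m {1..Suc n} e :: 'a::{field,finite} mpol)"
proof (induction n)
  case 0 then show ?case using Phi_single[OF e] by (simp add: One_nat_def)
next
  case (Suc n)
  have s: "skip_var 1 (Phi m {1..Suc n} e) = (Phi m ({1..Suc (Suc n)} - {1}) e :: 'a mpol)"
    "skip_var 2 (Phi m {1..Suc n} e) = (Phi m ({1..Suc (Suc n)} - {2}) e :: 'a mpol)"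
    by (rule skip_var_Phi; simp)+
  have R: "L12 * Phi m {1..Suc (Suc n)} e = Var 2 ^ (CARD('a) ^ m) * (Var 1 * Phi m ({1..Suc (Suc n)} - {2}) e)
    - Var 1 ^ (CARD('a) ^ m) * (Var 2 * (Phi m ({1..Suc (Suc n)} - {1}) e :: 'a mpol))"
    by (rule Phi_recursion) (use m in auto)
  have "delta 2 m (to_fract (Phi m {1..Suc n} e)) = to_fract (Phi m {1..Suc (Suc n)} e :: 'a mpol)"
    by (rule delta_2) (simp only: s R mult.left_commute mult.commute[of "Phi m {1..Suc (Suc n)} e" L12])
  then show ?case using Suc by simp
qed

lemma delta_3_delta3_poly:
  assumes f: "f \<in> Dickson2"
  shows "delta 3 b (to_fract f) = to_fract (delta3_poly b f :: 'a::{field,finite} mpol)"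
proof (rule delta_3)
  have "f \<in> Sn 2" by (rule Dickson2_Sn[OF f])
  then have "skip_var 1 f = eval2 f (Var 2) (Var 3)" "skip_var 2 f = eval2 f (Var 1) (Var 3)"
    "skip_var 3 f = eval2 f (Var 1) (Var 2)"
    unfolding skip_var_subs eval2_def by (rule subs_cong; auto simp: numeral_2_eq_2 numeral_3_eq_3 One_nat_def le_Suc_eq)+
  then show "Var 1 ^ (CARD('a) ^ b) * skip_var 1 f * L2 (Var 2) (Var 3) - Var 2 ^ (CARD('a) ^ b) * skip_var 2 f * L2 (Var 1) (Var 3)
      + Var 3 ^ (CARD('a) ^ b) * skip_var 3 f * L12 = delta3_poly b f * (L3 :: 'a mpol)"
    unfolding delta3_poly[OF f] numer3_def alt_form_def by (simp add: mult_ac)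
qed

section \<open>The truncated polynomial ring\<close>

lemma Sring_ops: "mult (Sring n) = (*)" "one (Sring n) = 1" "zero (Sring n) = 0" "add (Sring n) = (+)"
  by (simp_all add: Sring_def)

lemma Sring_cring: "cring (Sring n :: 'a::{field,finite} mpol ring)"
proof (rule cringI)
  show "abelian_group (Sring n :: 'a mpol ring)"
  proof (rule abelian_groupI, unfold Sring_ops)
    fix u :: "'a mpol" assume "u \<in> Sn n"
    then show "\<exists>v\<in>Sn n. v + u = 0" by (intro bexI[of _ "- u"]) auto
  qed (auto simp: add.assoc add.commute)
  show "Group.comm_monoid (Sring n :: 'a mpol ring)"
    by (rule comm_monoidI) (auto simp: Sring_ops mult_ac)
qed (auto simp: Sring_ops distrib_right)

lemma Sring_uminus: assumes "(u :: 'a::{field,finite} mpol) \<in> Sn n" shows "\<ominus>\<^bsub>Sring n\<^esub> u = - u"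
proof -
  interpret cring "Sring n :: 'a mpol ring" by (rule Sring_cring)
  show ?thesis
    by (rule minus_equality) (use assms in \<open>auto simp: Sring_ops\<close>)
qed

text \<open>For the inclusion from right to left, a decomposition into multiples of the generators is first
  brought into \<open>S(n)\<close> by setting the other variables to zero.\<close>

lemma Iideal_eq: "Iideal m n = {u \<in> Sn n. in_ideal m n (u :: 'a::{field,finite} mpol)}"
proof -
  interpret cring "Sring n :: 'a mpol ring" by (rule Sring_cring)
  let ?G = "(\<lambda>i. Var i ^ (CARD('a) ^ m)) ` {1..n} :: 'a mpol set"
  have G: "?G \<subseteq> Sn n" by (auto intro!: Sn_power Sn_Var)
  interpret I: ideal "Idl\<^bsub>Sring n\<^esub> ?G" "Sring n :: 'a mpol ring" by (rule genideal_ideal[OF G])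
  have inv: "inv\<^bsub>\<lparr>carrier = Sn n, mult = (+), one = 0\<rparr>\<^esub> u = - u" if "u \<in> Sn n" for u :: "'a mpol"
    using Sring_uminus[OF that] by (simp add: a_inv_def Sring_ops)
  have "subgroup {u \<in> Sn n. in_ideal m n (u :: 'a mpol)} (add_monoid (Sring n))"
    by (rule subgroup.intro) (auto simp: Sring_ops inv)
  then have "ideal {u \<in> Sn n. in_ideal m n (u :: 'a mpol)} (Sring n)"
    by (intro idealI) (auto simp: Sring_ops ring_axioms)
  then have "Idl\<^bsub>Sring n\<^esub> ?G \<subseteq> {u \<in> Sn n. in_ideal m n u}"
    by (rule genideal_minimal) (auto intro!: in_ideal_Var Sn_power Sn_Var)
  moreover have "u \<in> Idl\<^bsub>Sring n\<^esub> ?G" if u: "u \<in> Sn n" "in_ideal m n u" for u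
  proof -
    let ?\<pi> = "\<lambda>i. if 1 \<le> i \<and> i \<le> n then Var i else (0 :: 'a mpol)"
    have "subs ?\<pi> u \<in> Idl\<^bsub>Sring n\<^esub> ?G"
      using u(2)
    proof (induction rule: in_ideal_induct[consumes 1, case_names gen zero add])
      case (gen i p)
      have "Var i ^ (CARD('a) ^ m) \<in> Idl\<^bsub>Sring n\<^esub> ?G" using genideal_self[OF G] gen by auto
      then show ?case using I.I_r_closed[OF _ truncate_in_Sn, of _ p] gen
        by (simp add: subs.hom_mult subs.hom_power Sring_ops)
    next
      case zero then show ?case using I.zero_closed by (simp add: Sring_ops)
    next
      case (add u v) then show ?case using I.a_closed by (simp add: Sring_ops subs.hom_add)
    qed
    then show ?thesis by (simp add: subs_ident[OF u(1)])
  qed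
  ultimately show ?thesis unfolding Iideal_def by blast
qed

lemma Iideal_ideal: "ideal (Iideal m n) (Sring n :: 'a::{field,finite} mpol ring)"
proof -
  interpret cring "Sring n :: 'a mpol ring" by (rule Sring_cring)
  show ?thesis unfolding Iideal_def by (rule genideal_ideal) (auto intro!: Sn_power Sn_Var)
qed

lemma cls_eq: assumes u: "(u :: 'a::{field,finite} mpol) \<in> Sn n"
  shows "cls m n u = {v \<in> Sn n. in_ideal m n (v - u)}"
proof
  show "cls m n u \<subseteq> {v \<in> Sn n. in_ideal m n (v - u)}"
    using u by (auto simp: cls_def a_r_coset_def r_coset_def Iideal_eq Sring_ops)
  show "{v \<in> Sn n. in_ideal m n (v - u)} \<subseteq> cls m n u"
  proof
    fix v assume "v \<in> {v \<in> Sn n. in_ideal m n (v - u)}"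
    then show "v \<in> cls m n u" using u
      unfolding cls_def a_r_coset_def r_coset_def Iideal_eq
      by (auto simp: Sring_ops intro!: bexI[of _ "v - u"])
  qed
qed

lemma cls_eq_iff: "u \<in> Sn n \<Longrightarrow> v \<in> Sn n \<Longrightarrow> cls m n u = cls m n v \<longleftrightarrow> in_ideal m n (u - (v :: 'a::{field,finite} mpol))"
proof
  assume u: "u \<in> Sn n" "v \<in> Sn n" and "cls m n u = cls m n v"
  moreover have "u \<in> cls m n u" using u by (simp add: cls_eq)
  ultimately show "in_ideal m n (u - v)" by (simp add: cls_eq)
next
  assume u: "u \<in> Sn n" "v \<in> Sn n" and e: "in_ideal m n (u - v)"
  have e': "in_ideal m n (v - u)" using in_ideal_uminus[OF e] by simp
  show "cls m n u = cls m n v" unfolding cls_eq[OF u(1)] cls_eq[OF u(2)]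
    using in_ideal_trans[OF _ e] in_ideal_trans[OF _ e'] by auto
qed

lemma
  fixes u v :: "'a::{field,finite} mpol"
  assumes u: "u \<in> Sn n" "v \<in> Sn n"
  shows cls_add: "cls m n u \<oplus>\<^bsub>Qring m n\<^esub> cls m n v = cls m n (u + v)"
    and cls_mult: "cls m n u \<otimes>\<^bsub>Qring m n\<^esub> cls m n v = cls m n (u * v)"
proof -
  interpret ideal "Iideal m n" "Sring n :: 'a mpol ring" by (rule Iideal_ideal)
  show "cls m n u \<oplus>\<^bsub>Qring m n\<^esub> cls m n v = cls m n (u + v)"
    using a_rcos_sum[OF u] by (simp add: cls_def Qring_def FactRing_def Sring_ops)
  show "cls m n u \<otimes>\<^bsub>Qring m n\<^esub> cls m n v = cls m n (u * v)"
    using rcoset_mult_add[OF u] by (simp add: cls_def Qring_def FactRing_def Sring_ops)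
qed

lemma cls_0: "\<zero>\<^bsub>Qring m n\<^esub> = cls m n (0 :: 'a::{field,finite} mpol)"
  by (simp add: cls_eq Qring_def FactRing_def Iideal_eq)

lemma Qring_carrier: "carrier (Qring m n) = cls m n ` (Sn n :: 'a::{field,finite} mpol set)"
  by (auto simp: Qring_def FactRing_def A_RCOSETS_def' cls_def)

lemma induced_cls:
  fixes u :: "'a::{field,finite} mpol"
  assumes u: "u \<in> Sn n" and S: "\<And>v. v \<in> Sn n \<Longrightarrow> \<phi> v \<in> Sn n"
    and I: "\<And>v. in_ideal m n (v - u) \<Longrightarrow> in_ideal m n (\<phi> v - \<phi> u)"
  shows "induced m n \<phi> (cls m n u) = cls m n (\<phi> u)"
proof -
  have "u \<in> cls m n u" using u by (simp add: cls_eq)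
  moreover have "cls m n (\<phi> v) = cls m n (\<phi> u)" if "v \<in> cls m n u" for v
    using that u I S by (auto simp: cls_eq[OF u] cls_eq_iff)
  ultimately show ?thesis unfolding induced_def by blast
qed

lemma lin_subst_Sn: "u \<in> Sn n \<Longrightarrow> lin_subst n g u \<in> Sn n"
  unfolding lin_subst_subs by (rule subs_in_Sn) (auto simp: image_form_def intro!: Sn_sum Sn_mult)

lemma Qinv_eq: "Qinv m n = cls m n ` {u \<in> Sn n. invar m n (u :: 'a::{field,finite} mpol)}"
proof -
  have "induced m n (lin_subst n g) (cls m n u) = cls m n u \<longleftrightarrow> in_ideal m n (lin_subst n g u - u)"
    if "u \<in> Sn n" for u :: "'a mpol" and g
  proof -
    have "induced m n (lin_subst n g) (cls m n u) = cls m n (lin_subst n g u)"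
    proof (rule induced_cls[OF that lin_subst_Sn])
      fix v assume "in_ideal m n (v - u)"
      then have "in_ideal m n (lin_subst n g (v - u))" by (rule in_ideal_lin_subst)
      then show "in_ideal m n (lin_subst n g v - lin_subst n g u)" by (simp add: lin_subst_subs subs.hom_minus)
    qed
    then show ?thesis using cls_eq_iff[OF lin_subst_Sn[OF that] that] by simp
  qed
  then show ?thesis unfolding Qinv_def Qring_carrier invar_def by auto
qed

section \<open>Modules of classes\<close>

lemma Qmod_closed:
  fixes \<iota> :: "'r \<Rightarrow> 'a::{field,finite} mpol" and P :: "'a mpol set"
  assumes R: "cring R" and S: "\<And>r. r \<in> carrier R \<Longrightarrow> \<iota> r \<in> Sn n"
    and one: "\<iota> \<one>\<^bsub>R\<^esub> = 1"
    and mult: "\<And>r s. r \<in> carrier R \<Longrightarrow> s \<in> carrier R \<Longrightarrow> \<iota> (r \<otimes>\<^bsub>R\<^esub> s) = \<iota> r * \<iota> s"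
    and add: "\<And>r s. r \<in> carrier R \<Longrightarrow> s \<in> carrier R \<Longrightarrow> \<iota> (r \<oplus>\<^bsub>R\<^esub> s) = \<iota> r + \<iota> s"
    and P: "P \<subseteq> Sn n" "0 \<in> P" "\<And>u v. u \<in> P \<Longrightarrow> v \<in> P \<Longrightarrow> u + v \<in> P" "\<And>u. u \<in> P \<Longrightarrow> - u \<in> P"
      "\<And>r u. r \<in> carrier R \<Longrightarrow> u \<in> P \<Longrightarrow> \<iota> r * u \<in> P"
  shows "module R ((Qmod m n \<iota>)\<lparr>carrier := cls m n ` P\<rparr>)" (is "module R ?M")
proof -
  have ops: "carrier ?M = cls m n ` P" "\<zero>\<^bsub>?M\<^esub> = cls m n 0"
    by (simp_all add: Qmod_def ring.defs cls_0)
  have add_M: "cls m n u \<oplus>\<^bsub>?M\<^esub> cls m n v = cls m n (u + v)" if "u \<in> P" "v \<in> P" for u v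
    using that P(1) by (simp add: Qmod_def ring.defs cls_add subset_iff)
  note add_Q = add_M[simplified]
  have smult_M: "r \<odot>\<^bsub>?M\<^esub> cls m n u = cls m n (\<iota> r * u)" if "r \<in> carrier R" "u \<in> P" for r u
    using that P(1) S by (simp add: Qmod_def ring.defs cls_mult subset_iff)
  note smult_Q = smult_M[simplified]
  interpret R: cring R by (rule R)
  show ?thesis
  proof (rule moduleI[OF R])
    show "abelian_group ?M"
    proof (rule abelian_groupI, unfold ops)
      fix X assume "X \<in> cls m n ` P"
      then obtain u where u: "u \<in> P" "X = cls m n u" by blast
      then have "cls m n (- u) \<oplus>\<^bsub>?M\<^esub> X = cls m n 0" using add_M[of "- u" u] P(4) by simp
      then show "\<exists>Y\<in>cls m n ` P. Y \<oplus>\<^bsub>?M\<^esub> X = cls m n 0" using P(4)[OF u(1)] by blast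
    qed (auto simp: add_Q P add_ac)
  qed (auto simp: ops add_Q smult_Q P mult add one distrib_left distrib_right mult.assoc)
qed

lemma Qmod_module:
  fixes \<iota> :: "'r \<Rightarrow> 'a::{field,finite} mpol"
  assumes R: "cring R" and S: "\<And>r. r \<in> carrier R \<Longrightarrow> \<iota> r \<in> Sn n"
    and one: "\<iota> \<one>\<^bsub>R\<^esub> = 1"
    and mult: "\<And>r s. r \<in> carrier R \<Longrightarrow> s \<in> carrier R \<Longrightarrow> \<iota> (r \<otimes>\<^bsub>R\<^esub> s) = \<iota> r * \<iota> s"
    and add: "\<And>r s. r \<in> carrier R \<Longrightarrow> s \<in> carrier R \<Longrightarrow> \<iota> (r \<oplus>\<^bsub>R\<^esub> s) = \<iota> r + \<iota> s"
  shows "module R (Qmod m n \<iota>)"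
proof -
  have "(Qmod m n \<iota>)\<lparr>carrier := cls m n ` Sn n\<rparr> = Qmod m n \<iota>"
    by (simp add: Qmod_def ring.defs Qring_carrier)
  moreover have "module R ((Qmod m n \<iota>)\<lparr>carrier := cls m n ` Sn n\<rparr>)"
    by (rule Qmod_closed[OF R S one mult add]) (auto intro: S)
  ultimately show ?thesis by simp
qed

lemma submodule_of_closed:
  fixes \<iota> :: "'r \<Rightarrow> 'a::{field,finite} mpol"
  assumes M: "module R ((Qmod m n \<iota>)\<lparr>carrier := cls m n ` P\<rparr>)"
    and S: "\<And>r. r \<in> carrier R \<Longrightarrow> \<iota> r \<in> Sn n" and P: "P \<subseteq> Sn n"
    and B: "B \<subseteq> P" "0 \<in> B" "\<And>u v. u \<in> B \<Longrightarrow> v \<in> B \<Longrightarrow> u + v \<in> B"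
      "\<And>r u. r \<in> carrier R \<Longrightarrow> u \<in> B \<Longrightarrow> \<iota> r * u \<in> B"
  shows "submodule R (cls m n ` B) ((Qmod m n \<iota>)\<lparr>carrier := cls m n ` P\<rparr>)"
proof (rule submodule.intro[OF M])
  have B': "u \<in> Sn n" if "u \<in> B" for u using B(1) P that by blast
  fix X Y assume "X \<in> cls m n ` B" "Y \<in> cls m n ` B"
  then show "X \<oplus>\<^bsub>(Qmod m n \<iota>)\<lparr>carrier := cls m n ` P\<rparr>\<^esub> Y \<in> cls m n ` B"
    by (auto simp: Qmod_def ring.defs cls_add B' B)
next
  have B': "u \<in> Sn n" if "u \<in> B" for u using B(1) P that by blast
  fix r X assume "r \<in> carrier R" "X \<in> cls m n ` B"
  then show "r \<odot>\<^bsub>(Qmod m n \<iota>)\<lparr>carrier := cls m n ` P\<rparr>\<^esub> X \<in> cls m n ` B"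
    by (auto simp: Qmod_def ring.defs cls_mult B' B S)
qed (use B in \<open>auto simp: Qmod_def ring.defs cls_0\<close>)

lemma Const_scalars:
  "r \<in> carrier class_ring \<Longrightarrow> Const r \<in> (Sn n :: 'a::{field,finite} mpol set)"
  "Const \<one>\<^bsub>class_ring\<^esub> = (1 :: 'a mpol)"
  "Const (r \<otimes>\<^bsub>class_ring\<^esub> s) = (Const r * Const s :: 'a mpol)"
  "Const (r \<oplus>\<^bsub>class_ring\<^esub> s) = (Const r + Const s :: 'a mpol)"
  by (simp_all add: Const.hom_mult Const.hom_add)

lemma Const_uminus_mult: "Const (- 1) * u = - (u :: 'a::{field,finite} mpol)"
  by (simp add: Const.hom_uminus)

lemma Qinv_mod_Const: "module (class_ring :: 'a ring) (Qinv_mod m n (Const :: 'a::{field,finite} \<Rightarrow> _))"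
  unfolding Qinv_mod_def Qinv_eq
  by (rule Qmod_closed[OF class_cring.cring_axioms Const_scalars])
     (auto intro: invar_add invar_uminus invar_Const invar_if_in_ideal)

lemma Dring_carrier_induct [consumes 1, case_names one Const dickson uminus add mult]:
  assumes "d \<in> carrier (Dring n :: 'a::{field,finite} mpol ring)"
    and "P 1" "\<And>c. P (Const c)" "\<And>i. i < n \<Longrightarrow> P (dickson n i)"
    and "\<And>d. d \<in> Sn n \<Longrightarrow> P d \<Longrightarrow> P (- d)"
    and "\<And>d e. P d \<Longrightarrow> P e \<Longrightarrow> P (d + e)" "\<And>d e. P d \<Longrightarrow> P e \<Longrightarrow> P (d * e)"
  shows "P (d :: 'a mpol)"
proof -
  interpret cring "Sring n :: 'a mpol ring" by (rule Sring_cring)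
  have S: "range Const \<union> dickson n ` {i. i < n} \<subseteq> (Sn n :: 'a mpol set)" using dickson_Sn by auto
  have "d \<in> generate_ring (Sring n) (range Const \<union> dickson n ` {i. i < n})"
    using assms(1) by (simp add: Dring_def)
  then show ?thesis
  proof (induction rule: generate_ring.induct)
    case (a_inv h)
    then show ?case using generate_ring_in_carrier[OF S a_inv(1)] assms(5) by (simp add: Sring_uminus)
  qed (use assms in \<open>auto simp: Sring_ops\<close>)
qed

lemma Dring_Sn: "d \<in> carrier (Dring n) \<Longrightarrow> d \<in> Sn n"
  by (induction rule: Dring_carrier_induct) (auto intro: dickson_Sn)

lemma Dring_invariant: "d \<in> carrier (Dring n) \<Longrightarrow> g \<in> GL n \<Longrightarrow> lin_subst n g d = (d :: 'a::{field,finite} mpol)"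
  by (induction rule: Dring_carrier_induct)
     (auto simp: dickson_invariant, simp_all add: lin_subst_subs subs.hom_add subs.hom_mult subs.hom_uminus)

lemma Dring_cring: "cring (Dring n :: 'a::{field,finite} mpol ring)"
proof -
  interpret cring "Sring n :: 'a mpol ring" by (rule Sring_cring)
  have S: "range Const \<union> dickson n ` {i. i < n} \<subseteq> (Sn n :: 'a mpol set)" using dickson_Sn by auto
  interpret D: ring "Dring n :: 'a mpol ring" unfolding Dring_def by (rule generate_ring_is_ring[OF S])
  show ?thesis
    by (intro cring.intro D.ring_axioms D.monoid_comm_monoidI) (simp add: Dring_def Sring_ops mult.commute)
qed

lemma Dring_scalars:
  "r \<in> carrier (Dring n) \<Longrightarrow> id r \<in> (Sn n :: 'a::{field,finite} mpol set)"
  "id \<one>\<^bsub>Dring n\<^esub> = (1 :: 'a mpol)"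
  "id (r \<otimes>\<^bsub>Dring n\<^esub> s) = (id r * id s :: 'a mpol)"
  "id (r \<oplus>\<^bsub>Dring n\<^esub> s) = (id r + id s :: 'a mpol)"
  by (simp_all add: Dring_Sn) (simp_all add: Dring_def Sring_ops)

lemma Qinv_mod_Dring: "module (Dring n) (Qinv_mod m n (id :: 'a::{field,finite} mpol \<Rightarrow> 'a mpol))"
  unfolding Qinv_mod_def Qinv_eq
  by (rule Qmod_closed[OF Dring_cring Dring_scalars])
     (auto intro: invar_add invar_uminus invar_mult invar_if_in_ideal Dring_Sn Dring_invariant)

section \<open>The subspaces spanned by the generators\<close>

definition gens :: "nat \<Rightarrow> nat \<Rightarrow> nat \<Rightarrow> 'a::{field,finite} mpol set" where
  "gens m n k = {g \<in> Sn n. \<exists>s f. s \<le> k \<and> f \<in> Delta m s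
    \<and> to_fract g = (delta (s + 1) m ^^ (n - s)) (to_fract f)}"

lemma F_gens: "F m n k = module.span (class_ring :: 'a ring) (Qmod m n Const) (cls m n ` (gens m n k :: 'a::{field,finite} mpol set))"
  unfolding F_def gens_def by (rule arg_cong[where f = "module.span _ _"]) blast

text \<open>The last assumption says that \<open>B\<close> is the smallest subspace that contains the generators and the
  ideal.\<close>

lemma F_eq:
  fixes B :: "'a::{field,finite} mpol set"
  assumes gen: "gens m n k \<subseteq> B" and B: "B \<subseteq> Sn n" "0 \<in> B" "\<And>u v. u \<in> B \<Longrightarrow> v \<in> B \<Longrightarrow> u + v \<in> B"
      "\<And>c u. u \<in> B \<Longrightarrow> Const c * u \<in> B"
    and span: "\<And>G u. u \<in> B \<Longrightarrow> gens m n k \<subseteq> G \<Longrightarrow> (\<And>u v. u \<in> G \<Longrightarrow> v \<in> G \<Longrightarrow> u + v \<in> G)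
      \<Longrightarrow> (\<And>c u. u \<in> G \<Longrightarrow> Const c * u \<in> G) \<Longrightarrow> (\<And>u. u \<in> Sn n \<Longrightarrow> in_ideal m n u \<Longrightarrow> u \<in> G) \<Longrightarrow> u \<in> G"
  shows "F m n k = cls m n ` B"
proof -
  let ?K = "class_ring :: 'a ring" and ?Q = "Qmod m n (Const :: 'a \<Rightarrow> _)"
  have Q: "(Qmod m n (Const :: 'a \<Rightarrow> _))\<lparr>carrier := cls m n ` Sn n\<rparr> = ?Q"
    by (simp add: Qmod_def ring.defs Qring_carrier)
  interpret M: Module.module ?K ?Q by (rule Qmod_module[OF class_cring.cring_axioms Const_scalars])
  have C: "carrier ?Q = cls m n ` Sn n" by (simp add: Qmod_def ring.defs Qring_carrier)
  have "submodule ?K (cls m n ` B) ((Qmod m n (Const :: 'a \<Rightarrow> _))\<lparr>carrier := cls m n ` Sn n\<rparr>)"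
    by (rule submodule_of_closed) (use B M.module_axioms Q in auto)
  then have "submodule ?K (cls m n ` B) ?Q" unfolding Q .
  then have "F m n k \<subseteq> cls m n ` B" unfolding F_gens by (intro M.span_is_subset image_mono gen)
  moreover have "cls m n u \<in> F m n k" if u: "u \<in> B" for u
  proof -
    have X: "cls m n ` gens m n k \<subseteq> carrier ?Q" unfolding C by (rule image_mono[OF subset_trans[OF gen B(1)]])
    have sub: "submodule ?K (F m n k) ?Q" unfolding F_gens by (rule M.span_is_submodule[OF X])
    let ?G = "{u \<in> Sn n. cls m n u \<in> F m n k} :: 'a mpol set"
    have "u \<in> ?G" using u
    proof (rule span)
      show "gens m n k \<subseteq> ?G"
      proof
        fix g :: "'a mpol" assume g: "g \<in> gens m n k"
        have "cls m n g \<in> F m n k" unfolding F_gens by (rule subsetD[OF M.in_own_span[OF X] imageI[OF g]])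
        then show "g \<in> ?G" using subsetD[OF B(1) subsetD[OF gen g]] by simp
      qed
      show "u + v \<in> ?G" if "u \<in> ?G" "v \<in> ?G" for u v :: "'a mpol"
        using that submodule.m_closed[OF sub, of "cls m n u" "cls m n v"] by (auto simp: Qmod_def ring.defs cls_add)
      show smult: "Const c * u \<in> ?G" if "u \<in> ?G" for c and u :: "'a mpol"
        using that submodule.smult_closed[OF sub, of c "cls m n u"] by (auto simp: Qmod_def ring.defs cls_mult)
      show "u \<in> ?G" if "u \<in> Sn n" "in_ideal m n u" for u :: "'a mpol"
      proof -
        have "cls m n u = cls m n (0 :: 'a mpol)" using that by (simp add: cls_eq_iff)
        moreover have "cls m n (0 :: 'a mpol) \<in> F m n k" using submodule.zero_closed[OF sub] by (simp add: Qmod_def ring.defs cls_0)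
        ultimately show ?thesis using that by simp
      qed
    qed
    then show ?thesis by simp
  qed
  ultimately show ?thesis by blast
qed

lemma Delta_1: "Delta m 1 = {(Var 1 :: 'a::{field,finite} mpol) ^ ((CARD('a) - 1) * e) | e. e < qnum CARD('a) m}"
  (is "?L = ?R")
proof
  have J: "{1..1} = {1 :: nat}" by auto
  have d: "(\<Prod>i = 1..1. dickson 1 (1 - i) ^ e i) = (Var 1 :: 'a mpol) ^ ((CARD('a) - 1) * e 1)" for e :: "nat \<Rightarrow> nat"
    by (simp add: dickson_1 power_mult)
  show "?L \<subseteq> ?R"
  proof
    fix f :: "'a mpol" assume "f \<in> Delta m 1"
    then obtain e l :: "nat \<Rightarrow> nat" where m: "1 \<le> m" and f: "f = (\<Prod>i = 1..1. dickson 1 (1 - i) ^ e i)"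
      and l: "l 1 \<le> m - 1" "e 1 < (CARD('a) ^ (l 1 + 1) - CARD('a) ^ l (Suc 1)) div (CARD('a) - 1)"
      unfolding Delta_def J by (auto split: if_splits)
    have "qnum CARD('a) (l 1 + 1) \<le> qnum CARD('a) m" by (rule qnum_mono) (use l m in simp)
    then have "e 1 < qnum CARD('a) m" using l(2) by (simp add: qnum_div[OF card_field_ge2])
    then show "f \<in> ?R" unfolding f d by blast
  qed
  show "?R \<subseteq> ?L"
  proof
    fix f :: "'a mpol" assume "f \<in> ?R"
    then obtain e where f: "f = Var 1 ^ ((CARD('a) - 1) * e)" and e: "e < qnum CARD('a) m" by blast
    obtain l where l: "l < m" "qnum CARD('a) l \<le> e" "e < qnum CARD('a) (Suc l)" using qnum_interval[OF e] by blast
    define ll where "ll j = (if j = 1 then l else 0)" for j :: nat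
    have "f = (\<Prod>i = 1..1. dickson 1 (1 - i) ^ (\<lambda>_. e) i)" unfolding d[of "\<lambda>_. e"] f ..
    moreover have "ll 1 \<le> m - 1 \<and> (\<forall>i\<in>{1..1}. ll (Suc i) \<le> ll i) \<and> ll (Suc 1) = 0 \<and>
            (\<forall>i\<in>{1..1}.
               (CARD('a) ^ ll i - CARD('a) ^ ll (Suc i)) div (CARD('a) - 1) \<le> (\<lambda>_. e) i \<and>
               (\<lambda>_. e) i < (CARD('a) ^ (ll i + 1) - CARD('a) ^ ll (Suc i)) div (CARD('a) - 1))"
      unfolding J qnum_div[OF card_field_ge2] using l by (auto simp: ll_def simp flip: Suc_eq_plus1)
    ultimately show "f \<in> ?L" unfolding Delta_def using l(1) by auto
  qed
qed

lemma gens_0: assumes "1 \<le> m"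
  shows "to_fract g = (delta (0 + 1) m ^^ (n - 0)) (to_fract 1) \<longleftrightarrow> g = (Top m n :: 'a::{field,finite} mpol)"
  using delta_1_iterate[OF assms, of n, where 'a='a] by simp

lemma gens_1: assumes "1 \<le> m" "1 \<le> n" "e < qnum CARD('a) m"
  shows "to_fract g = (delta (1 + 1) m ^^ (n - 1)) (to_fract (Var 1 ^ ((CARD('a) - 1) * e)))
    \<longleftrightarrow> g = (Phi m {1..n} e :: 'a::{field,finite} mpol)"
  using delta_2_iterate[OF assms(1,3), of "n - 1"] assms(2) by simp

lemma gens_2: assumes "f \<in> Dickson2"
  shows "to_fract g = (delta (2 + 1) m ^^ (3 - 2)) (to_fract f) \<longleftrightarrow> g = (delta3_poly m f :: 'a::{field,finite} mpol)"
  using delta_3_delta3_poly[OF assms, of m] by simp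

lemma generator_exists:
  assumes m: "1 \<le> m" and n: "2 \<le> n" "n \<le> 3" and s: "s < n" and f: "f \<in> Delta m s"
  shows "\<exists>g\<in>Sn n. to_fract g = (delta (s + 1) m ^^ (n - s)) (to_fract (f :: 'a::{field,finite} mpol))"
proof -
  consider "s = 0" | "s = 1" | "s = 2" "n = 3" using n s by linarith
  then show ?thesis
  proof cases
    case 1
    then have "f = 1" using f by (simp add: Delta_def)
    then show ?thesis using gens_0[OF m] Top_B1[OF n(1)] unfolding 1 B1_def by blast
  next
    case 2
    then obtain e where e: "e < qnum CARD('a) m" "f = Var 1 ^ ((CARD('a) - 1) * e)" using f Delta_1[where 'a='a] by blast
    have "1 \<le> n" using n by simp
    then show ?thesis using gens_1[OF m _ e(1)] Phi_Sn[of "{1..n}" n m e] unfolding 2 e(2) by blast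
  next
    case 3
    then have "f \<in> Dickson2" using f Delta_2 by blast
    then show ?thesis using gens_2 delta3_poly_Sn unfolding 3 by blast
  qed
qed

lemma gens_1_eq:
  assumes m: "1 \<le> m" and n: "2 \<le> n"
  shows "gens m n 1 = insert (Top m n) {Phi m {1..n} e | e. e < qnum CARD('a::{field,finite}) m} \<inter> (Sn n :: 'a mpol set)"
proof -
  have s: "s \<le> 1 \<longleftrightarrow> s = 0 \<or> s = 1" for s :: nat by linarith
  have 0: "Delta m 0 = {1 :: 'a mpol}" by (simp add: Delta_def)
  have n': "1 \<le> n" using n by simp
  have E: "(\<exists>s f. s \<le> 1 \<and> f \<in> Delta m s \<and> P s f)
      \<longleftrightarrow> P 0 1 \<or> (\<exists>e. e < qnum CARD('a) m \<and> P 1 (Var 1 ^ ((CARD('a) - 1) * e)))" for P :: "nat \<Rightarrow> 'a mpol \<Rightarrow> bool"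
  proof -
    have "(\<exists>s f. s \<le> 1 \<and> f \<in> Delta m s \<and> P s f) \<longleftrightarrow> (\<exists>f\<in>Delta m 0. P 0 f) \<or> (\<exists>f\<in>Delta m 1. P 1 f)"
      unfolding s by blast
    then show ?thesis unfolding 0 Delta_1 by auto
  qed
  have P: "(\<exists>e. e < qnum CARD('a) m \<and> to_fract g = (delta (1 + 1) m ^^ (n - 1)) (to_fract (Var 1 ^ ((CARD('a) - 1) * e))))
      \<longleftrightarrow> (\<exists>e. e < qnum CARD('a) m \<and> g = Phi m {1..n} e)" for g :: "'a mpol"
    by (intro ex_cong1 conj_cong refl gens_1[OF m n'])
  show ?thesis unfolding gens_def E gens_0[OF m] P by auto
qed

lemma B1_in_span:
  fixes G :: "'a::{field,finite} mpol set"
  assumes m: "1 \<le> m" and n: "2 \<le> n" and u: "u \<in> B1 m n"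
    and gen: "gens m n 1 \<subseteq> G" and add: "\<And>u v. u \<in> G \<Longrightarrow> v \<in> G \<Longrightarrow> u + v \<in> G"
    and smult: "\<And>c u. u \<in> G \<Longrightarrow> Const c * u \<in> G" and I: "\<And>u. u \<in> Sn n \<Longrightarrow> in_ideal m n u \<Longrightarrow> u \<in> G"
  shows "u \<in> G"
proof -
  obtain c b where e: "in_ideal m n (u - (\<Sum>e<qnum CARD('a) m. Const (c e) * Phi m {1..n} e) - Const b * Top m n)"
    by (rule B1_span[OF n m u])
  have 0: "0 \<in> G" by (rule I) auto
  have sum: "(\<And>i. i \<in> A \<Longrightarrow> f i \<in> G) \<Longrightarrow> sum f A \<in> G" for f and A :: "nat set"
    by (induction A rule: infinite_finite_induct) (auto simp: 0 add)
  have P: "(\<Sum>e<qnum CARD('a) m. Const (c e) * Phi m {1..n} e) \<in> B1 m n"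
    by (intro B1_sum B1_Const Phi_B1 m n)
  have T: "Const b * Top m n \<in> B1 m n" by (intro B1_Const Top_B1 n)
  have "Phi m {1..n} e \<in> G" if "e < qnum CARD('a) m" for e
    using gen that Phi_Sn[of "{1..n}" n m e, where 'a='a] unfolding gens_1_eq[OF m n] by blast
  then have "(\<Sum>e<qnum CARD('a) m. Const (c e) * Phi m {1..n} e) \<in> G" by (intro sum smult) auto
  moreover have "Top m n \<in> G" using gen Top_B1[OF n, of m, where 'a='a] unfolding gens_1_eq[OF m n] B1_def by blast
  moreover have "u - (\<Sum>e<qnum CARD('a) m. Const (c e) * Phi m {1..n} e) - Const b * Top m n \<in> G"
    by (rule I[OF _ e]) (use B1_diff[OF B1_diff[OF u P] T] in \<open>simp add: B1_def\<close>)
  ultimately have "(u - (\<Sum>e<qnum CARD('a) m. Const (c e) * Phi m {1..n} e) - Const b * Top m n)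
      + ((\<Sum>e<qnum CARD('a) m. Const (c e) * Phi m {1..n} e) + Const b * Top m n) \<in> G"
    by (intro add smult)
  then show ?thesis by simp
qed

lemma F_1: assumes m: "1 \<le> m" and n: "2 \<le> n"
  shows "F m n 1 = cls m n ` (B1 m n :: 'a::{field,finite} mpol set)"
proof (rule F_eq)
  show "gens m n 1 \<subseteq> (B1 m n :: 'a mpol set)"
    unfolding gens_1_eq[OF m n] using Top_B1[OF n] Phi_B1[OF n m] by auto
  show "u \<in> G" if "u \<in> B1 m n" "gens m n 1 \<subseteq> G" "\<And>u v. u \<in> G \<Longrightarrow> v \<in> G \<Longrightarrow> u + v \<in> G"
    "\<And>c u. u \<in> G \<Longrightarrow> Const c * u \<in> G" "\<And>u. u \<in> Sn n \<Longrightarrow> in_ideal m n u \<Longrightarrow> u \<in> G"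
    for u and G :: "'a mpol set" by (rule B1_in_span[OF m n that])
  show "B1 m n \<subseteq> (Sn n :: 'a mpol set)" by (auto simp: B1_def)
qed (simp_all add: B1_0 B1_add B1_Const)

lemma gens_2_eq:
  assumes m: "1 \<le> m"
  shows "gens m 3 2 = gens m 3 1 \<union> (delta3_poly m ` Delta m 2 :: 'a::{field,finite} mpol set)"
proof -
  have s: "s \<le> 2 \<longleftrightarrow> s \<le> 1 \<or> s = 2" for s :: nat by linarith
  have d: "f \<in> Dickson2" if "f \<in> Delta m 2" for f :: "'a mpol" using that Delta_2 by blast
  have E: "(\<exists>s f. s \<le> 2 \<and> f \<in> Delta m s \<and> P s f)
      \<longleftrightarrow> (\<exists>s f. s \<le> 1 \<and> f \<in> Delta m s \<and> P s f) \<or> (\<exists>f. f \<in> Delta m 2 \<and> P 2 f)" for P :: "nat \<Rightarrow> 'a mpol \<Rightarrow> bool"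
    unfolding s by auto
  have P: "(\<exists>f. f \<in> Delta m 2 \<and> to_fract g = (delta (2 + 1) m ^^ (3 - 2)) (to_fract f))
      \<longleftrightarrow> (\<exists>f. f \<in> Delta m 2 \<and> g = delta3_poly m f)" for g :: "'a mpol"
    by (intro ex_cong1 conj_cong refl gens_2[OF d])
  show ?thesis unfolding gens_def E P using delta3_poly_Sn[OF d] by auto
qed

lemma F_2: assumes m: "2 \<le> m"
  shows "F m 3 2 = cls m 3 ` (B2 m :: 'a::{field,finite} mpol set)"
proof (rule F_eq)
  have m1: "1 \<le> m" using m by simp
  have g1: "gens m 3 1 \<subseteq> (B1 m 3 :: 'a mpol set)"
    unfolding gens_1_eq[OF m1, of 3, simplified] using Top_B1[of 3 m, where 'a='a] Phi_B1[of 3 m, where 'a='a] m1 by auto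
  then show "gens m 3 2 \<subseteq> (B2 m :: 'a mpol set)"
    unfolding gens_2_eq[OF m1] using B1_B2 delta3_poly_B2 Delta_2 by blast
  show "u \<in> G" if u: "u \<in> B2 m" and gen: "gens m 3 2 \<subseteq> G" and G: "\<And>u v. u \<in> G \<Longrightarrow> v \<in> G \<Longrightarrow> u + v \<in> G"
    "\<And>c u. u \<in> G \<Longrightarrow> Const c * u \<in> G" "\<And>u. u \<in> Sn 3 \<Longrightarrow> in_ideal m 3 u \<Longrightarrow> u \<in> G"
    for u and G :: "'a mpol set"
  proof -
    have gen1: "gens m 3 1 \<subseteq> G" and gen2: "f \<in> Delta m 2 \<Longrightarrow> delta3_poly m f \<in> G" for f
      using gen unfolding gens_2_eq[OF m1] by auto
    have B1: "u \<in> B1 m 3 \<Longrightarrow> u \<in> G" for u by (rule B1_in_span[OF m1 _ _ gen1 G]) auto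
    obtain g where g: "g \<in> Dickson2" "u - delta3_poly m g \<in> B1 m 3" by (rule B2_decompose[OF u])
    have "delta3_poly m g \<in> G"
    proof (rule Delta_2_spans[OF m, where G = "\<lambda>g. delta3_poly m g \<in> G"])
      fix t :: "'a mpol" assume "t \<in> Dickson2" "in_ideal m 2 (L12 * t)"
      then show "delta3_poly m t \<in> G" by (intro B1 delta3_poly_T_B1)
    qed (use g gen2 G in \<open>auto simp: delta3_poly_add delta3_poly_Const\<close>)
    then have "delta3_poly m g + (u - delta3_poly m g) \<in> G" by (rule G(1)[OF _ B1[OF g(2)]])
    then show ?thesis by simp
  qed
  show "B2 m \<subseteq> (Sn 3 :: 'a mpol set)" by (auto simp: B2_def)
qed (simp_all add: B2_0 B2_add B2_Const)

section \<open>The submodules and their annihilators\<close>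

lemma submodules_of_closed:
  fixes B :: "'a::{field,finite} mpol set"
  assumes "B \<subseteq> {u \<in> Sn n. invar m n u}" "0 \<in> B" "\<And>u v. u \<in> B \<Longrightarrow> v \<in> B \<Longrightarrow> u + v \<in> B"
    "\<And>c u. u \<in> B \<Longrightarrow> Const c * u \<in> B" "\<And>i u. i < n \<Longrightarrow> u \<in> B \<Longrightarrow> dickson n i * u \<in> B"
    "\<And>i u. u \<in> B \<Longrightarrow> steenrod i u \<in> B"
  shows "A_submodule m n (cls m n ` B)"
    and "submodule (Dring n) (cls m n ` B) (Qinv_mod m n (id :: 'a mpol \<Rightarrow> 'a mpol))"
proof -
  have "submodule (class_ring :: 'a ring) (cls m n ` B) (Qinv_mod m n Const)"
    unfolding Qinv_mod_def Qinv_eq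
    by (rule submodule_of_closed)
       (use assms Qinv_mod_Const[of m n, where 'a='a] in \<open>auto simp: Qinv_mod_def Qinv_eq\<close>)
  moreover have "induced m n (steenrod i) (cls m n u) \<in> cls m n ` B" if "u \<in> B" for i u
  proof -
    have "induced m n (steenrod i) (cls m n u) = cls m n (steenrod i u)"
      by (rule induced_cls) (use that assms(1) in \<open>auto simp: steenrod_Sn simp flip: steenrod_diff intro: in_ideal_steenrod\<close>)
    then show ?thesis using assms(6)[OF that] by simp
  qed
  ultimately show "A_submodule m n (cls m n ` B)" by (auto simp: A_submodule_def)
  have "d * u \<in> B" if "d \<in> carrier (Dring n)" "u \<in> B" for d u
  proof -
    have neg: "u \<in> B \<Longrightarrow> - u \<in> B" for u using assms(4)[of u "- 1"] by (simp add: Const_uminus_mult)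
    have "\<forall>u\<in>B. d * u \<in> B" using that(1)
      by (induction rule: Dring_carrier_induct) (auto simp: assms distrib_right mult.assoc neg)
    then show ?thesis using that(2) by blast
  qed
  then show "submodule (Dring n) (cls m n ` B) (Qinv_mod m n (id :: 'a mpol \<Rightarrow> 'a mpol))"
    unfolding Qinv_mod_def Qinv_eq
    by (intro submodule_of_closed)
       (use assms Qinv_mod_Dring[of n m, where 'a='a] Dring_Sn in \<open>auto simp: Qinv_mod_def Qinv_eq\<close>)
qed

theorem theorem1p12:
  fixes n m k :: nat
  assumes "1 \<le> n" "n \<le> 3" "1 \<le> m" "1 \<le> k" "k < min m n"
  shows "(\<forall>s\<le>k. \<forall>f\<in>Delta m s. \<exists>g\<in>carrier (Sring n).
            to_fract g = (delta (s + 1) m ^^ (n - s)) (to_fract (f :: 'a::{field,finite} mpol)))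
       \<and> A_submodule m n (F m n k :: 'a mpol set set)
       \<and> submodule (Dring n) (F m n k) (Qinv_mod m n (id :: 'a mpol \<Rightarrow> 'a mpol))
       \<and> (\<forall>i < n - k. \<forall>C \<in> F m n k.
            cls m n (dickson n i :: 'a mpol) \<otimes>\<^bsub>Qring m n\<^esub> C = \<zero>\<^bsub>Qring m n\<^esub>)"
proof -
  have n: "2 \<le> n" and k: "k < n" "k < m" using assms by auto
  have B1: "B1 m n \<subseteq> {u \<in> Sn n. invar m n (u :: 'a mpol)}" by (auto simp: B1_def)
  have "\<exists>B :: 'a mpol set. F m n k = cls m n ` B \<and> B \<subseteq> {u \<in> Sn n. invar m n u} \<and> 0 \<in> B
      \<and> (\<forall>u\<in>B. \<forall>v\<in>B. u + v \<in> B) \<and> (\<forall>c. \<forall>u\<in>B. Const c * u \<in> B) \<and> (\<forall>i<n. \<forall>u\<in>B. dickson n i * u \<in> B)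
      \<and> (\<forall>i. \<forall>u\<in>B. steenrod i u \<in> B) \<and> (\<forall>i<n - k. \<forall>u\<in>B. in_ideal m n (dickson n i * u))"
  proof -
    consider "k = 1" | "k = 2" "n = 3" using assms k by linarith
    then show ?thesis
    proof cases
      case 1
      have "in_ideal m n (dickson n i * u)" if "i < n - 1" "u \<in> B1 m n" for i and u :: "'a mpol"
      proof (cases "n = 2")
        case True
        then show ?thesis using that B1_annihilated_2 by auto
      next
        case False
        then have "n = 3" using n assms(2) by simp
        then show ?thesis using that B1_annihilated_3 by auto
      qed
      moreover have "dickson n i * u \<in> B1 m n" if "u \<in> B1 m n" for i and u :: "'a mpol"
        by (rule B1_mult[OF that dickson_Sn dickson_invariant])
      ultimately show ?thesis unfolding 1
        using F_1[OF assms(3) n, where 'a='a] B1 B1_0[of m n, where 'a='a]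
        by (intro exI[of _ "B1 m n"]) (simp add: B1_add B1_Const B1_steenrod)
    next
      case 2
      have "2 \<le> m" using k 2 by simp
      moreover have "B2 m \<subseteq> {u \<in> Sn 3. invar m 3 (u :: 'a mpol)}" by (auto simp: B2_def)
      ultimately show ?thesis unfolding 2 using F_2[of m, where 'a='a] B2_0[of m, where 'a='a]
        by (intro exI[of _ "B2 m"]) (simp add: B2_add B2_Const B2_steenrod B2_dickson B2_annihilated)
    qed
  qed
  then obtain B :: "'a mpol set" where F: "F m n k = cls m n ` B" and B: "B \<subseteq> {u \<in> Sn n. invar m n u}" "0 \<in> B"
      "\<forall>u\<in>B. \<forall>v\<in>B. u + v \<in> B" "\<forall>c. \<forall>u\<in>B. Const c * u \<in> B" "\<forall>i<n. \<forall>u\<in>B. dickson n i * u \<in> B"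
      "\<forall>i. \<forall>u\<in>B. steenrod i u \<in> B" and ann: "\<forall>i<n - k. \<forall>u\<in>B. in_ideal m n (dickson n i * u)"
    by blast
  have "cls m n (dickson n i :: 'a mpol) \<otimes>\<^bsub>Qring m n\<^esub> C = \<zero>\<^bsub>Qring m n\<^esub>" if i: "i < n - k" and C: "C \<in> F m n k" for i C
  proof -
    obtain u where u: "u \<in> B" "C = cls m n u" using C unfolding F by blast
    have "u \<in> Sn n" using u B(1) by blast
    then show ?thesis using ann i u(1)
      by (simp add: u(2) cls_mult dickson_Sn cls_0 cls_eq_iff Sn_mult)
  qed
  moreover have "\<forall>s\<le>k. \<forall>f\<in>Delta m s. \<exists>g\<in>carrier (Sring n).
      to_fract g = (delta (s + 1) m ^^ (n - s)) (to_fract (f :: 'a mpol))"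
    using generator_exists[OF assms(3) n assms(2)] k(1) by (meson le_less_trans)
  moreover have "A_submodule m n (F m n k :: 'a mpol set set)"
    "submodule (Dring n) (F m n k) (Qinv_mod m n (id :: 'a mpol \<Rightarrow> 'a mpol))"
    unfolding F by (rule submodules_of_closed; use B in blast)+
  ultimately show ?thesis by blast
qed

end
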